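(* Let $n\ge1$, $1<p<\infty$, let $\Theta\subset\mathbf{R}^{n+1}$ be a bounded nonempty open set and let $\xi_0=(0,0)\in\partial\Theta$. Suppose that there exists a ball $B_1=B(\xi_1,R_1)=\{z\in\mathbf{R}^{n+1}:|z-\xi_1|<R_1\}$, with centre $\xi_1=(x_1,t_1)$ and radius $R_1>0$, such that $B_1\cap\Theta=\emptyset$ and $\xi_0\in\partial B_1\cap\partial\Theta$. If $x_1\ne0$, then $\xi_0$ is regular with respect to $\Theta$.
   Context: Points of $\mathbf{R}^{n+1}$ are written $(x,t)$ with $x\in\mathbf{R}^n$, $t\in\mathbf{R}$; $\nabla$ and $\operatorname{div}$ are taken with respect to $x$ only. The equation considered is $\partial_t u=\Delta_p u:=\operatorname{div}(|\nabla u|^{p-2}\nabla u)$. For an open set $U\subset\mathbf{R}^n$ and $t_1<t_2$ let $U_{t_1,t_2}=U\times(t_1,t_2)$; $D'\Subset D$ means that $\overline{D'}$ is a compact subset of $D$. A function $u$ on $\Theta$ is \emph{$p$-parabolic} if it is a continuous weak solution, i.e. $u$ is continuous and, whenever $U_{t_1,t_2}\Subset\Theta$, one has $u\in L^p(t_1,t_2;W^{1,p}(U))$, $t\mapsto\int_U|u(x,t)|^2\,dx$ is continuous on $[t_1,t_2]$, and $\int_{t_1}^{t_2}\int_U|\nabla u|^{p-2}\nabla u\cdot\nabla\varphi\,dx\,dt-\int_{t_1}^{t_2}\int_U u\,\partial_t\varphi\,dx\,dt=0$ for all $\varphi\in C_0^\infty(U_{t_1,t_2})$. A space-time box is $Q_{t_1,t_2}$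 with $Q=(a_1,b_1)\times\cdots\times(a_n,b_n)$; its parabolic boundary is $\partial_pQ_{t_1,t_2}=(\overline{Q}\times\{t_1\})\cup(\partial Q\times(t_1,t_2])$. A function $u:\Theta\to(-\infty,\infty]$ is \emph{$p$-superparabolic} if (i) $u$ is lower semicontinuous; (ii) $u$ is finite in a dense subset of $\Theta$; (iii) for each space-time box $Q_{t_1,t_2}\Subset\Theta$: if $h$ is $p$-parabolic in $Q_{t_1,t_2}$, continuous on $\overline{Q}_{t_1,t_2}$ and $h\le u$ on $\partial_pQ_{t_1,t_2}$, then $h\le u$ in $Q_{t_1,t_2}$. For a bounded function $f:\partial\Theta\to\mathbf{R}$, the upper class $\mathcal{U}_f$ is the set of all $p$-superparabolic functions $u$ on $\Theta$ which are bounded below and satisfy $\liminf_{\Theta\ni\eta\to\xi}u(\eta)\ge f(\xi)$ for all $\xi\in\partial\Theta$. The upper Perron solution is $\overline{H}f(\xi)=\inf_{u\in\mathcal{U}_f}u(\xi)$, $\xi\in\Theta$. A point $\xi_0\in\partial\Theta$ is \emph{regular} with respect to $\Theta$ if $\lim_{\Theta\ni\xi\to\xi_0}\overline{H}f(\xi)=f(\xi_0)$ for every continuous $f:\partial\Theta\to\mathbf{R}$. *)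

theory Defs
  imports "HOL-Analysis.Analysis"
begin

type_synonym 'n spacetime = "(real^'n) \<times> real"

definition compactly_contained :: "'a::topological_space set \<Rightarrow> 'a set \<Rightarrow> bool" where
  "compactly_contained D' D \<longleftrightarrow> compact (closure D') \<and> closure D' \<subseteq> D"


section \<open>Test functions and gradients\<close>

text \<open>On the whole space, a function is \<open>C\<^sup>k\<^sup>+\<^sup>1\<close> iff it is (Frechet) differentiable with partial
  derivatives of class \<open>C\<^sup>k\<close>.\<close>

primrec Ck :: "nat \<Rightarrow> ('a::euclidean_space \<Rightarrow> real) \<Rightarrow> bool" where
  "Ck 0 f \<longleftrightarrow> continuous_on UNIV f"
| "Ck (Suc k) f \<longleftrightarrow> (\<forall>x. f differentiable (at x)) \<and>
      (\<forall>e\<in>Basis. Ck k (\<lambda>x. frechet_derivative f (at x) e))"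

text \<open>Elements of \<open>C\<^sub>0\<^sup>\<infinity>(D)\<close> are represented by their extensions by zero to the whole space.\<close>

definition test_functions :: "'a::euclidean_space set \<Rightarrow> ('a \<Rightarrow> real) set" where
  "test_functions D = {\<phi>. (\<forall>k. Ck k \<phi>) \<and> compactly_contained {x. \<phi> x \<noteq> 0} D}"

definition grad :: "(real^'n \<Rightarrow> real) \<Rightarrow> real^'n \<Rightarrow> real^'n" where
  "grad \<psi> x = (\<chi> i. frechet_derivative \<psi> (at x) (axis i 1))"


section \<open>Sobolev spaces\<close>

text \<open>Functions stand for their almost-everywhere classes; using Borel representatives (\<open>lborel\<close>)
  is no restriction.\<close>

definition Lp :: "real \<Rightarrow> 'a::euclidean_space set \<Rightarrow> ('a \<Rightarrow> 'b::euclidean_space) set" where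
  "Lp p D = {f. set_borel_measurable lborel D f \<and>
                set_integrable lborel D (\<lambda>x. norm (f x) powr p)}"

definition weak_gradient :: "(real^'n) set \<Rightarrow> (real^'n \<Rightarrow> real) \<Rightarrow> (real^'n \<Rightarrow> real^'n) \<Rightarrow> bool" where
  "weak_gradient U v g \<longleftrightarrow>
     (\<forall>K. compact K \<and> K \<subseteq> U \<longrightarrow> set_integrable lborel K v \<and> set_integrable lborel K g) \<and>
     (\<forall>\<psi>\<in>test_functions U.
        (LINT x:U|lborel. v x *\<^sub>R grad \<psi> x) = - (LINT x:U|lborel. \<psi> x *\<^sub>R g x))"

definition sobolev :: "real \<Rightarrow> (real^'n) set \<Rightarrow> (real^'n \<Rightarrow> real) set" where
  "sobolev p U = {v \<in> Lp p U. \<exists>g\<in>Lp p U. weak_gradient U v g}"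

text \<open>\<open>parabolic_sobolev p U t1 t2 u G\<close> says that \<open>u\<close> belongs to \<open>L\<^sup>p(t1,t2;W\<^sup>1\<^sup>,\<^sup>p(U))\<close> with spatial
  gradient \<open>G\<close>: for almost every \<open>t\<close> the slice \<open>u(\<cdot>,t)\<close> is in \<open>W\<^sup>1\<^sup>,\<^sup>p(U)\<close> with weak gradient
  \<open>G(\<cdot>,t)\<close>, and the space-time integrals of \<open>|u|\<^sup>p\<close> and \<open>|G|\<^sup>p\<close> are finite. Such a \<open>G\<close> is unique
  almost everywhere.\<close>

definition parabolic_sobolev ::
    "real \<Rightarrow> (real^'n) set \<Rightarrow> real \<Rightarrow> real \<Rightarrow> ('n::finite spacetime \<Rightarrow> real) \<Rightarrow> ('n::finite spacetime \<Rightarrow> real^'n) \<Rightarrow> bool" where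
  "parabolic_sobolev p U t1 t2 u G \<longleftrightarrow>
     u \<in> Lp p (U \<times> {t1<..<t2}) \<and> G \<in> Lp p (U \<times> {t1<..<t2}) \<and>
     (AE t in lborel. t \<in> {t1<..<t2} \<longrightarrow>
        (\<lambda>x. u (x, t)) \<in> sobolev p U \<and> weak_gradient U (\<lambda>x. u (x, t)) (\<lambda>x. G (x, t)))"


section \<open>Parabolic and superparabolic functions\<close>

text \<open>Since \<open>0 powr a = 0\<close>, the field \<open>|G|\<^sup>p\<^sup>-\<^sup>2 G\<close> is zero where \<open>G = 0\<close>, also for \<open>p < 2\<close>.\<close>

definition p_parabolic :: "real \<Rightarrow> 'n::finite spacetime set \<Rightarrow> ('n::finite spacetime \<Rightarrow> real) \<Rightarrow> bool" where
  "p_parabolic p \<Theta> u \<longleftrightarrow>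
     continuous_on \<Theta> u \<and>
     (\<forall>U t1 t2. open U \<and> t1 < t2 \<and> compactly_contained (U \<times> {t1<..<t2}) \<Theta> \<longrightarrow>
        (\<exists>G. parabolic_sobolev p U t1 t2 u G \<and>
             continuous_on {t1..t2} (\<lambda>t. LINT x:U|lborel. \<bar>u (x, t)\<bar>\<^sup>2) \<and>
             (\<forall>\<phi>\<in>test_functions (U \<times> {t1<..<t2}).
                (LINT t:{t1<..<t2}|lborel. LINT x:U|lborel.
                   (norm (G (x, t)) powr (p - 2) *\<^sub>R G (x, t)) \<bullet> grad (\<lambda>y. \<phi> (y, t)) x)
              - (LINT t:{t1<..<t2}|lborel. LINT x:U|lborel.
                   u (x, t) * deriv (\<lambda>s. \<phi> (x, s)) t) = 0)))"

definition parabolic_boundary :: "(real^'n) set \<Rightarrow> real \<Rightarrow> real \<Rightarrow> 'n::finite spacetime set" where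
  "parabolic_boundary Q t1 t2 = closure Q \<times> {t1} \<union> frontier Q \<times> {t1<..t2}"

definition lower_semicontinuous_on :: "'a::topological_space set \<Rightarrow> ('a \<Rightarrow> ereal) \<Rightarrow> bool" where
  "lower_semicontinuous_on D u \<longleftrightarrow> (\<forall>\<xi>\<in>D. u \<xi> \<le> Liminf (at \<xi> within D) u)"

definition p_superparabolic :: "real \<Rightarrow> 'n::finite spacetime set \<Rightarrow> ('n::finite spacetime \<Rightarrow> ereal) \<Rightarrow> bool" where
  "p_superparabolic p \<Theta> u \<longleftrightarrow>
     (\<forall>\<xi>\<in>\<Theta>. u \<xi> \<noteq> -\<infinity>) \<and>
     lower_semicontinuous_on \<Theta> u \<and>
     \<Theta> \<subseteq> closure {\<xi>\<in>\<Theta>. u \<xi> < \<infinity>} \<and>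
     (\<forall>a b t1 t2. (\<forall>i. a $ i < b $ i) \<and> t1 < t2 \<and>
          compactly_contained (box a b \<times> {t1<..<t2}) \<Theta> \<longrightarrow>
        (\<forall>h. p_parabolic p (box a b \<times> {t1<..<t2}) h \<and>
             continuous_on (closure (box a b \<times> {t1<..<t2})) h \<and>
             (\<forall>\<xi>\<in>parabolic_boundary (box a b) t1 t2. ereal (h \<xi>) \<le> u \<xi>) \<longrightarrow>
             (\<forall>\<xi>\<in>box a b \<times> {t1<..<t2}. ereal (h \<xi>) \<le> u \<xi>)))"


section \<open>Upper Perron solutions and regular boundary points\<close>

definition upper_class ::
    "real \<Rightarrow> 'n::finite spacetime set \<Rightarrow> ('n::finite spacetime \<Rightarrow> real) \<Rightarrow> ('n::finite spacetime \<Rightarrow> ereal) set" where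
  "upper_class p \<Theta> f =
     {u. p_superparabolic p \<Theta> u \<and>
         (\<exists>m::real. \<forall>\<xi>\<in>\<Theta>. ereal m \<le> u \<xi>) \<and>
         (\<forall>\<xi>\<in>frontier \<Theta>. ereal (f \<xi>) \<le> Liminf (at \<xi> within \<Theta>) u)}"

definition upper_perron ::
    "real \<Rightarrow> 'n::finite spacetime set \<Rightarrow> ('n::finite spacetime \<Rightarrow> real) \<Rightarrow> 'n::finite spacetime \<Rightarrow> ereal" where
  "upper_perron p \<Theta> f \<xi> = (INF u\<in>upper_class p \<Theta> f. u \<xi>)"

definition regular_point :: "real \<Rightarrow> 'n::finite spacetime set \<Rightarrow> 'n::finite spacetime \<Rightarrow> bool" where
  "regular_point p \<Theta> \<xi>\<^sub>0 \<longleftrightarrow>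
     \<xi>\<^sub>0 \<in> frontier \<Theta> \<and>
     (\<forall>f. continuous_on (frontier \<Theta>) f \<longrightarrow>
          (upper_perron p \<Theta> f \<longlongrightarrow> ereal (f \<xi>\<^sub>0)) (at \<xi>\<^sub>0 within \<Theta>))"

end

theory Submission
  imports Defs
begin

text \<open>A smaller ball, internally tangent to the given one at the origin, touches \<open>closure \<Theta>\<close> only there. With centre
  \<open>\<zeta>\<close> and \<open>q (z) = |z - \<zeta>|\<^sup>2 - |\<zeta>|\<^sup>2\<close>, the function \<open>\<Psi> = 2 M (1 - exp (- \<gamma> q))\<close> vanishes at the origin, exceeds
  \<open>M\<close> away from it, and, since the spatial gradient of \<open>q\<close> does not vanish near the origin (\<open>x\<^sub>1 \<noteq> 0\<close>), it
  is a strict classical supersolution where \<open>\<Psi> < M\<close> once \<open>\<gamma>\<close> is large; likewise \<open>- \<Psi>\<close> is a strict subsolution.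

  Upper bound: \<open>f (0) + \<epsilon> + min \<Psi> M\<close> lies in the upper class. This needs the comparison of a continuous weak solution
  with a classical supersolution. Weak solutions are mollified in space and time; this only tests the equation with
  translates of one smooth bump, and the energy estimate for the positive part of the difference then involves
  classical functions only.

  Lower bound: a member of the upper class is only known to dominate solutions on boxes, so no comparison with
  subsolutions is available beforehand. If \<open>u\<close> first touched the Gaussian subsolution from above at some point, an
  explicit solution \<open>H (|x - y|\<^sup>2) + c t\<close> with a smaller Hessian and a larger time derivative there, raised slightly,
  would violate the comparison property of \<open>u\<close> on a small box.\<close>

section \<open>Smooth bump functions\<close>

text \<open>How large \<gamma> works: after division by a common positive factor, diffusion
  contributes \<open>2 * \<gamma> * (p - 1) * r^2\<close> (\<open>r\<close> the spatial distance to
  the centre), while the time derivative contributes \<open>|gradient| powr (2 - p)\<close> times a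
  bounded time distance. Where \<Psi> < M the Gaussian lies between \<open>M\<close> and
  \<open>2 * M\<close>, so the gradient is of exact order \<gamma>, and the second term divided by
  \<gamma> is of order \<open>\<gamma> powr (1 - p)\<close>; this tends to 0 because
  \<open>p > 1\<close>. The factor in \<open>2 * M\<close> turns \<Psi> < M into
  \<open>\<gamma> * q < ln 2\<close>, and \<open>q \<ge> |z|^2 / 2\<close> on
  \<open>closure \<Theta>\<close> then confines the region to a small neighbourhood of the origin.
  The obstacle in the lower bound is that the Dirichlet problem on boxes is not solved here, so the
  competitors must be explicit. The form \<open>H + c t\<close> reduces the equation to a linear
  ordinary differential equation for the flux. Moreover the Gaussian is a subsolution only where
  \<Psi> < M; one must know beforehand that members of the upper class are at least
  \<open>f (0) - M\<close>. The same touching argument gives this, with Gaussians of small amplitude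
  centred off \<Theta>.\<close>

lemma Ck_Suc_imp_Ck: "Ck (Suc k) f \<Longrightarrow> Ck k f"
proof (induction k arbitrary: f)
  case 0
  then show ?case
    by (simp add: continuous_at_imp_continuous_on differentiable_imp_continuous_within)
next
  case (Suc k)
  then show ?case by (metis Ck.simps(2))
qed

lemma Ck_const: "Ck k (\<lambda>_. c)"
proof (induction k arbitrary: c)
  case (Suc k)
  have "frechet_derivative (\<lambda>_::'a. c) (at x) e = 0" for x e
    by simp
  then show ?case using Suc by simp
qed simp

lemma Ck_add: "Ck k f \<Longrightarrow> Ck k g \<Longrightarrow> Ck k (\<lambda>x. f x + g x)"
proof (induction k arbitrary: f g)
  case 0
  then show ?case by (auto intro: continuous_intros)
next
  case (Suc k)
  have "frechet_derivative (\<lambda>x. f x + g x) (at x) e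
        = frechet_derivative f (at x) e + frechet_derivative g (at x) e" for x e
    by (subst frechet_derivative_at[symmetric, OF has_derivative_add[of f "frechet_derivative f (at x)"
            _ g "frechet_derivative g (at x)"]])
      (use Suc.prems in \<open>auto simp: frechet_derivative_works[symmetric]\<close>)
  then show ?case using Suc by simp
qed

lemma Ck_mult: "Ck k f \<Longrightarrow> Ck k g \<Longrightarrow> Ck k (\<lambda>x. f x * g x)"
proof (induction k arbitrary: f g)
  case 0
  then show ?case by (auto intro: continuous_intros)
next
  case (Suc k)
  have "Ck k f" "Ck k g" using Suc.prems Ck_Suc_imp_Ck by blast+
  have "frechet_derivative (\<lambda>x. f x * g x) (at x) e
        = f x * frechet_derivative g (at x) e + frechet_derivative f (at x) e * g x" for x e
    by (subst frechet_derivative_at[symmetric, OF has_derivative_mult[of f "frechet_derivative f (at x)"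
            x UNIV g "frechet_derivative g (at x)"]])
      (use Suc.prems in \<open>auto simp: frechet_derivative_works[symmetric]\<close>)
  then show ?case using Suc \<open>Ck k f\<close> \<open>Ck k g\<close> by (auto intro!: Ck_add)
qed

lemma Ck_sum: "(\<And>i. i \<in> I \<Longrightarrow> Ck k (f i)) \<Longrightarrow> Ck k (\<lambda>x. \<Sum>i\<in>I. f i x)"
  by (induction I rule: infinite_finite_induct) (auto intro: Ck_add Ck_const)

lemma Ck_prod: "(\<And>i. i \<in> I \<Longrightarrow> Ck k (f i)) \<Longrightarrow> Ck k (\<lambda>x. \<Prod>i\<in>I. f i x)"
  by (induction I rule: infinite_finite_induct) (auto intro: Ck_mult Ck_const)

lemma Ck_affine:
  fixes f :: "'b::euclidean_space \<Rightarrow> real" and L :: "'a::euclidean_space \<Rightarrow> 'b"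
  assumes "linear L"
  shows "Ck k f \<Longrightarrow> Ck k (\<lambda>x. f (L x + c))"
proof (induction k arbitrary: f)
  case 0
  have "continuous_on UNIV (\<lambda>x. L x + c)"
    using assms by (intro continuous_intros linear_continuous_on) (simp add: linear_conv_bounded_linear)
  then show ?case using 0
    by (auto intro: continuous_on_compose2[where t=UNIV])
next
  case (Suc k)
  have bl: "bounded_linear L" using assms by (simp add: linear_conv_bounded_linear)
  have d: "((\<lambda>x. f (L x + c)) has_derivative (\<lambda>h. frechet_derivative f (at (L x + c)) (L h))) (at x)" for x
  proof -
    have "((\<lambda>x. L x + c) has_derivative L) (at x)"
      using bl by (auto intro!: derivative_eq_intros bounded_linear_imp_has_derivative)
    moreover have "(f has_derivative frechet_derivative f (at (L x + c))) (at (L x + c))"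
      using Suc.prems by (simp add: frechet_derivative_works[symmetric])
    ultimately show ?thesis by (rule has_derivative_compose)
  qed
  then have fr: "frechet_derivative (\<lambda>x. f (L x + c)) (at x) = (\<lambda>h. frechet_derivative f (at (L x + c)) (L h))" for x
    by (metis frechet_derivative_at)
  \<comment> \<open>\<open>Ck\<close> controls basis directions only, while the chain rule produces
    the direction \<open>L e\<close>; hence the expansion in the basis.\<close>
  have lin: "frechet_derivative f (at z) w = (\<Sum>b\<in>Basis. (w \<bullet> b) * frechet_derivative f (at z) b)" for z w
  proof -
    interpret linear "frechet_derivative f (at z)"
      using Suc.prems by (simp add: linear_frechet_derivative)
    have "frechet_derivative f (at z) w = frechet_derivative f (at z) (\<Sum>b\<in>Basis. (w \<bullet> b) *\<^sub>R b)"
      by (simp add: euclidean_representation)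
    then show ?thesis by (simp add: sum scale)
  qed
  show ?case unfolding Ck.simps
  proof (intro conjI allI ballI)
    show "(\<lambda>x. f (L x + c)) differentiable at x" for x
      using d by (auto simp: differentiable_def)
    fix e :: 'a assume "e \<in> Basis"
    have "Ck k (\<lambda>x. \<Sum>b\<in>Basis. (L e \<bullet> b) * frechet_derivative f (at (L x + c)) b)"
      using Suc by (intro Ck_sum Ck_mult Ck_const) auto
    then show "Ck k (\<lambda>x. frechet_derivative (\<lambda>x. f (L x + c)) (at x) e)"
      unfolding fr lin[of _ "L e"] .
  qed
qed

section \<open>Flat functions on the line and the existence of mollifiers\<close>

lemma Ck_realI:
  fixes D :: "nat \<Rightarrow> real \<Rightarrow> real"
  assumes "\<And>k x. (D k has_real_derivative D (Suc k) x) (at x)"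
  shows "Ck j (D k)"
proof (induction j arbitrary: k)
  case 0
  then show ?case using assms
    by (auto intro!: continuous_at_imp_continuous_on DERIV_isCont)
next
  case (Suc j)
  have "frechet_derivative (D k) (at x) = (\<lambda>h. D (Suc k) x * h)" for x
    using assms[of k x] by (metis frechet_derivative_at has_field_derivative_def)
  then show ?case using assms Suc
    by (auto simp: differentiable_def has_field_derivative_def)
qed

text \<open>The polynomial factor makes this family of flat functions closed under differentiation,
  so all orders are treated at once.\<close>

definition flat_exp :: "real poly \<Rightarrow> real \<Rightarrow> real" where
  "flat_exp P x = (if x > 0 then poly P (1/x) * exp (-1/x) else 0)"

lemma poly_exp_tendsto_0: "((\<lambda>y. poly P y * exp (-y::real)) \<longlongrightarrow> 0) at_top"
proof -
  have "((\<lambda>y. (\<Sum>i\<le>degree P. coeff P i * (y ^ i * exp (-y)))) \<longlongrightarrow> (\<Sum>i\<le>degree P. coeff P i * 0)) at_top"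
  proof (intro tendsto_intros)
    fix i
    show "((\<lambda>y::real. y ^ i * exp (-y)) \<longlongrightarrow> 0) at_top"
      using tendsto_power_div_exp_0[of i] by (simp add: exp_minus divide_inverse)
  qed
  moreover have "poly P y * exp (-y) = (\<Sum>i\<le>degree P. coeff P i * (y ^ i * exp (-y)))" for y
    by (simp add: poly_altdef sum_distrib_right mult.assoc)
  ultimately show ?thesis by simp
qed

text \<open>With \<open>y = 1/x\<close>, the derivative of \<open>P(y) exp(-y)\<close> in
  \<open>x\<close> is \<open>y^2 (P(y) - P'(y)) exp(-y)\<close>, again a member of the family. At 0
  the difference quotients decide.\<close>

lemma flat_exp_deriv:
  "(flat_exp P has_real_derivative flat_exp ([:0,0,1:] * (P - pderiv P)) x) (at x)"
proof -
  consider "x > 0" | "x < 0" | "x = 0" by linarith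
  then show ?thesis
  proof cases
    case 1
    have "((\<lambda>x. poly P (1/x) * exp (-1/x)) has_real_derivative flat_exp ([:0,0,1:] * (P - pderiv P)) x) (at x)"
      using 1 by (auto intro!: derivative_eq_intros DERIV_chain2[where f="poly P"] poly_DERIV
          simp: flat_exp_def field_simps power2_eq_square)
    then show ?thesis
      by (rule DERIV_cong_ev[THEN iffD1, rotated -1])
        (use 1 in \<open>auto simp: flat_exp_def intro!: eventually_mono[OF eventually_nhds_in_open[of "{0<..}"]]\<close>)
  next
    case 2
    have "((\<lambda>x. 0) has_real_derivative flat_exp ([:0,0,1:] * (P - pderiv P)) x) (at x)"
      using 2 by (auto simp: flat_exp_def)
    then show ?thesis
      by (rule DERIV_cong_ev[THEN iffD1, rotated -1])
        (use 2 in \<open>auto simp: flat_exp_def intro!: eventually_mono[OF eventually_nhds_in_open[of "{..<0}"]]\<close>)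
  next
    case 3
    have l: "((\<lambda>h. flat_exp P h / h) \<longlongrightarrow> 0) (at_left 0)"
      by (rule tendsto_eventually) (auto simp: flat_exp_def eventually_at_filter)
    \<comment> \<open>Division by \<open>h\<close> multiplies the polynomial by its variable
      \<open>1/h\<close>, and the exponential still wins.\<close>
    have "((\<lambda>h. poly (pCons 0 P) (inverse h) * exp (- inverse h)) \<longlongrightarrow> 0) (at_right (0::real))"
      by (rule filterlim_compose[OF poly_exp_tendsto_0 filterlim_inverse_at_top_right])
    then have r: "((\<lambda>h. flat_exp P h / h) \<longlongrightarrow> 0) (at_right 0)"
      by (rule Lim_transform_eventually)
        (auto simp: flat_exp_def eventually_at_filter field_simps)
    have "((\<lambda>h. flat_exp P h / h) \<longlongrightarrow> 0) (at 0)"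
      using l r by (simp add: filterlim_at_split)
    then show ?thesis using 3 by (simp add: DERIV_def flat_exp_def)
  qed
qed

lemma Ck_flat_exp: "Ck j (flat_exp P)"
proof -
  define Q where "Q k = ((\<lambda>P. [:0,0,1:] * (P - pderiv P)) ^^ k) P" for k
  have "Ck j ((\<lambda>k. flat_exp (Q k)) 0)"
    by (rule Ck_realI) (simp add: Q_def flat_exp_deriv[simplified])
  then show ?thesis by (simp add: Q_def)
qed

text \<open>The zero set is closed and contains almost every point, so it is everything.\<close>

lemma continuous_AE_eq_0:
  fixes f :: "'a::euclidean_space \<Rightarrow> real"
  assumes "continuous_on UNIV f" "AE z in lborel. f z = 0"
  shows "f z = 0"
proof -
  have "AE z in lebesgue. z \<in> {z. f z = 0}"
    using AE_completion[OF assms(2)] by simp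
  moreover have "closed {z. f z = 0}" using assms(1)
    by (simp add: closed_Collect_eq)
  ultimately show ?thesis
    using mem_closed_if_AE_lebesgue[of "{z. f z = 0}" z] by simp
qed

definition mollifier :: "real \<Rightarrow> ('a::euclidean_space \<Rightarrow> real) \<Rightarrow> bool" where
  "mollifier \<epsilon> \<rho> \<longleftrightarrow> (\<forall>k. Ck k \<rho>) \<and> (\<forall>z. 0 \<le> \<rho> z) \<and> (\<forall>z. \<rho> z \<noteq> 0 \<longrightarrow> norm z < \<epsilon>) \<and>
     integrable lborel \<rho> \<and> integral\<^sup>L lborel \<rho> = 1"

lemma mollifier_exists:
  assumes "\<epsilon> > 0"
  shows "\<exists>\<rho>::'a::euclidean_space \<Rightarrow> real. mollifier \<epsilon> \<rho>"
proof -
  \<comment> \<open>The bump is a product of one-dimensional bumps of half-width \<delta>. On its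
    support the sum of the coordinates in absolute value is below
    \<open>DIM('a) * \<delta> = \<epsilon>\<close>, hence so is the norm.\<close>
  define \<delta> where "\<delta> = \<epsilon> / DIM('a)"
  have \<delta>: "\<delta> > 0" using assms by (simp add: \<delta>_def)
  define \<beta> where "\<beta> s = flat_exp 1 (\<delta> + s) * flat_exp 1 (\<delta> - s)" for s
  have \<beta>_nonneg: "\<beta> s \<ge> 0" for s by (simp add: \<beta>_def flat_exp_def)
  have \<beta>_supp: "\<beta> s \<noteq> 0 \<Longrightarrow> \<bar>s\<bar> < \<delta>" for s
    by (auto simp: \<beta>_def flat_exp_def split: if_splits)
  have \<beta>_0: "\<beta> 0 > 0" using \<delta> by (simp add: \<beta>_def flat_exp_def)
  have \<beta>_Ck: "Ck k \<beta>" for k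
  proof -
    have "Ck k (\<lambda>s::real. flat_exp 1 (s + \<delta>))"
      by (rule Ck_affine[where L="\<lambda>s. s"]) (auto intro: Ck_flat_exp simp: linear_iff)
    moreover have "Ck k (\<lambda>s::real. flat_exp 1 (- s + \<delta>))"
      by (rule Ck_affine[where L="\<lambda>s. - s"]) (auto intro: Ck_flat_exp simp: linear_iff)
    ultimately show ?thesis
      unfolding \<beta>_def by (auto dest: Ck_mult simp: add.commute)
  qed
  define r :: "'a \<Rightarrow> real" where "r z = (\<Prod>e\<in>Basis. \<beta> (z \<bullet> e))" for z
  have r_Ck: "Ck k r" for k
    unfolding r_def
  proof (rule Ck_prod)
    fix e :: 'a
    have "Ck k (\<lambda>z::'a. \<beta> (z \<bullet> e + 0))"
      by (rule Ck_affine[where L="\<lambda>z. z \<bullet> e"]) (auto intro: \<beta>_Ck simp: linear_iff inner_simps)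
    then show "Ck k (\<lambda>z::'a. \<beta> (z \<bullet> e))" by simp
  qed
  have r_supp: "norm z < \<epsilon>" if "r z \<noteq> 0" for z
  proof -
    have "\<bar>z \<bullet> e\<bar> < \<delta>" if "e \<in> Basis" for e
      using \<beta>_supp \<open>r z \<noteq> 0\<close> that by (auto simp: r_def)
    then have "(\<Sum>e\<in>Basis. \<bar>z \<bullet> e\<bar>) < (\<Sum>e\<in>(Basis::'a set). \<delta>)"
      by (intro sum_strict_mono) auto
    also have "\<dots> = \<epsilon>" by (simp add: \<delta>_def)
    finally show ?thesis using norm_le_l1[of z] by linarith
  qed
  have cont: "continuous_on UNIV r" using r_Ck[of 0] by simp
  have int: "integrable lborel r"
  proof -
    have "integrable lborel (\<lambda>z. indicator (cball 0 \<epsilon>) z *\<^sub>R r z)"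
      using borel_integrable_compact[of "cball 0 \<epsilon>" r] cont continuous_on_subset[of UNIV r "cball 0 \<epsilon>"]
      by (auto simp: indicator_def if_distrib cong: if_cong)
    moreover have "indicator (cball 0 \<epsilon>) z *\<^sub>R r z = r z" for z
      using r_supp[of z] by (cases "r z = 0") (auto simp: indicator_def)
    ultimately show ?thesis by (simp only:)
  qed
  have nonneg: "r z \<ge> 0" for z by (simp add: r_def \<beta>_nonneg prod_nonneg)
  have "integral\<^sup>L lborel r \<noteq> 0"
  proof
    assume "integral\<^sup>L lborel r = 0"
    then have "AE z in lborel. r z = 0"
      using integral_nonneg_eq_0_iff_AE[OF int] nonneg by simp
    then have "r 0 = 0" using continuous_AE_eq_0 cont by blast
    moreover have "r 0 > 0" using \<beta>_0 by (simp add: r_def prod_pos)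
    ultimately show False by simp
  qed
  then have pos: "integral\<^sup>L lborel r > 0"
    using integral_nonneg_AE[of r lborel] nonneg by (simp add: less_le)
  define c where "c = inverse (integral\<^sup>L lborel r)"
  have "mollifier \<epsilon> (\<lambda>z. c * r z)"
    unfolding mollifier_def using pos nonneg int
    by (auto simp: c_def intro!: Ck_mult Ck_const r_Ck r_supp)
  then show ?thesis by blast
qed

section \<open>Directional derivatives and convolutions\<close>

text \<open>Differentiability along a single line: this is what integration by parts uses, and it
  survives composition with functions such as the squared positive part.\<close>

definition has_partial :: "('a::euclidean_space \<Rightarrow> real) \<Rightarrow> 'a \<Rightarrow> real \<Rightarrow> 'a \<Rightarrow> bool" where
  "has_partial f e d z \<longleftrightarrow> ((\<lambda>s. f (z + s *\<^sub>R e)) has_real_derivative d) (at 0)"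

lemma has_partial_line:
  assumes "has_partial f e d (z + s *\<^sub>R e)"
  shows "((\<lambda>s. f (z + s *\<^sub>R e)) has_real_derivative d) (at s)"
proof -
  have "((\<lambda>r. f (z + s *\<^sub>R e + r *\<^sub>R e)) has_real_derivative d) (at (s - s))"
    using assms by (simp add: has_partial_def)
  then have "((\<lambda>r. f (z + s *\<^sub>R e + (r - s) *\<^sub>R e)) has_real_derivative d) (at s)"
    using DERIV_shift[of "\<lambda>r. f (z + s *\<^sub>R e + r *\<^sub>R e)" d s "-s"] by simp
  then show ?thesis by (simp add: algebra_simps)
qed

lemma has_partial_frechet:
  assumes "f differentiable (at z)"
  shows "has_partial f e (frechet_derivative f (at z) e) z"
proof -
  have "(f has_derivative frechet_derivative f (at z)) (at (z + 0 *\<^sub>R e))"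
    using assms by (simp add: frechet_derivative_works[symmetric])
  moreover have "((\<lambda>s. z + s *\<^sub>R e) has_derivative (\<lambda>s. s *\<^sub>R e)) (at 0)"
    by (auto intro!: derivative_eq_intros)
  ultimately have "((\<lambda>s. f (z + s *\<^sub>R e)) has_derivative (\<lambda>s. frechet_derivative f (at z) (s *\<^sub>R e))) (at 0)"
    using has_derivative_compose[of "\<lambda>s. z + s *\<^sub>R e" _ 0 UNIV f "frechet_derivative f (at z)"] by simp
  moreover have "frechet_derivative f (at z) (s *\<^sub>R e) = frechet_derivative f (at z) e * s" for s
    using linear_frechet_derivative[OF assms] by (simp add: linear_cmul)
  ultimately show ?thesis
    by (simp add: has_partial_def has_field_derivative_def)
qed

lemma has_partial_mult:
  "has_partial f e a z \<Longrightarrow> has_partial g e b z \<Longrightarrow> has_partial (\<lambda>z. f z * g z) e (a * g z + f z * b) z"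
  unfolding has_partial_def by (auto intro!: derivative_eq_intros simp: mult.commute)

lemma has_partial_diff:
  "has_partial f e a z \<Longrightarrow> has_partial g e b z \<Longrightarrow> has_partial (\<lambda>z. f z - g z) e (a - b) z"
  unfolding has_partial_def by (auto intro!: derivative_eq_intros)

lemma has_partial_compose:
  assumes "has_partial f e a z" "(F has_real_derivative d) (at (f z))"
  shows "has_partial (\<lambda>z. F (f z)) e (d * a) z"
  using assms DERIV_chain2[of F d "\<lambda>s. f (z + s *\<^sub>R e)" 0 a] unfolding has_partial_def by simp

lemma has_partial_local:
  assumes "has_partial f e d z" "open S" "z \<in> S" "\<And>w. w \<in> S \<Longrightarrow> f w = g w"
  shows "has_partial g e d z"
proof -
  have "((\<lambda>s. z + s *\<^sub>R e) \<longlongrightarrow> z + 0 *\<^sub>R e) (nhds (0::real))"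
    by (intro tendsto_intros filterlim_ident)
  then have "eventually (\<lambda>s. z + s *\<^sub>R e \<in> S) (nhds (0::real))"
    using assms(2,3) by (auto dest: topological_tendstoD)
  then have "eventually (\<lambda>s. f (z + s *\<^sub>R e) = g (z + s *\<^sub>R e)) (nhds 0)"
    by (rule eventually_mono) (rule assms(4))
  then show ?thesis
    using assms(1) DERIV_cong_ev[of 0 0 "\<lambda>s. f (z + s *\<^sub>R e)" "\<lambda>s. g (z + s *\<^sub>R e)" d d]
    unfolding has_partial_def by simp
qed

lemma has_partial_zeroD:
  assumes "has_partial f e d z" "open S" "z \<in> S" "\<And>w. w \<in> S \<Longrightarrow> f w = 0"
  shows "d = 0"
proof -
  have "has_partial (\<lambda>_. 0) e d z" by (rule has_partial_local[OF assms])
  then show ?thesis by (auto simp: has_partial_def dest: DERIV_unique[OF DERIV_const])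
qed

lemma has_partial_lipschitz:
  assumes "\<And>z. has_partial f e (g z) z" "\<And>z. \<bar>g z\<bar> \<le> L"
  shows "\<bar>f (z + s *\<^sub>R e) - f z\<bar> \<le> L * \<bar>s\<bar>"
proof -
  have "norm ((\<lambda>s. f (z + s *\<^sub>R e)) s - (\<lambda>s. f (z + s *\<^sub>R e)) 0) \<le> L * norm (s - 0)"
  proof (rule field_differentiable_bound[where S=UNIV])
    show "((\<lambda>s. f (z + s *\<^sub>R e)) has_field_derivative g (z + s *\<^sub>R e)) (at s within UNIV)" for s
      using assms(1) by (simp add: has_partial_line)
  qed (use assms(2) in auto)
  then show ?thesis by simp
qed

section \<open>Invariance of Lebesgue measure and integration by parts\<close>

lemma lborel_shift:
  fixes f :: "'a::euclidean_space \<Rightarrow> real"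
  assumes "f \<in> borel_measurable borel"
  shows "integral\<^sup>L lborel (\<lambda>z. f (z + c)) = integral\<^sup>L lborel f"
    and "integrable lborel (\<lambda>z. f (z + c)) = integrable lborel f"
proof -
  have "integral\<^sup>L (distr lborel borel ((+) c)) f = integral\<^sup>L lborel (\<lambda>z. f (c + z))"
    using assms by (intro integral_distr) auto
  then show "integral\<^sup>L lborel (\<lambda>z. f (z + c)) = integral\<^sup>L lborel f"
    by (simp add: lborel_distr_plus add.commute)
  have "integrable (distr lborel borel ((+) c)) f = integrable lborel (\<lambda>z. f (c + z))"
    using assms by (intro integrable_distr_eq) auto
  then show "integrable lborel (\<lambda>z. f (z + c)) = integrable lborel f"
    by (simp add: lborel_distr_plus add.commute)
qed

lemma lborel_reflect:
  fixes f :: "'a::euclidean_space \<Rightarrow> real"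
  assumes "f \<in> borel_measurable borel"
  shows "integral\<^sup>L lborel (\<lambda>z. f (c - z)) = integral\<^sup>L lborel f"
    and "integrable lborel (\<lambda>z. f (c - z)) = integrable lborel f"
proof -
  have eq: "distr lborel borel (\<lambda>x::'a. c - x) = lborel"
    using lborel_affine[of "-1" c] by (simp add: density_1)
  have "integral\<^sup>L (distr lborel borel (\<lambda>x. c - x)) f = integral\<^sup>L lborel (\<lambda>z. f (c - z))"
    using assms by (intro integral_distr) auto
  then show "integral\<^sup>L lborel (\<lambda>z. f (c - z)) = integral\<^sup>L lborel f"
    by (simp add: eq)
  have "integrable (distr lborel borel (\<lambda>x. c - x)) f = integrable lborel (\<lambda>z. f (c - z))"
    using assms by (intro integrable_distr_eq) auto
  then show "integrable lborel (\<lambda>z. f (c - z)) = integrable lborel f"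
    by (simp add: eq)
qed

lemma integrable_continuous_compact_support:
  fixes f :: "'a::euclidean_space \<Rightarrow> real"
  assumes "continuous_on UNIV f" "compact K" "\<And>z. z \<notin> K \<Longrightarrow> f z = 0"
  shows "integrable lborel f"
proof -
  have "integrable lborel (\<lambda>z. indicator K z *\<^sub>R f z)"
    using assms by (intro borel_integrable_compact) (auto intro: continuous_on_subset)
  moreover have "(\<lambda>z. indicator K z *\<^sub>R f z) = f"
    using assms(3) by (force simp: indicator_def)
  ultimately show ?thesis by simp
qed

text \<open>Every difference quotient has integral 0 by translation invariance. The quotients
  converge pointwise to \<open>g\<close> and are dominated, by the mean value theorem, by a constant
  on a fixed compact set.\<close>

lemma integral_partial_eq_0:
  fixes f g :: "'a::euclidean_space \<Rightarrow> real"
  assumes "\<And>z. has_partial f e (g z) z" "continuous_on UNIV f" "continuous_on UNIV g"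
    and "compact K" "\<And>z. z \<notin> K \<Longrightarrow> f z = 0"
  shows "integral\<^sup>L lborel g = 0"
proof -
  have g0: "g z = 0" if "z \<notin> K" for z
    by (rule has_partial_zeroD[OF assms(1), of "- K"]) (use assms that in \<open>auto simp: compact_imp_closed open_Compl\<close>)
  obtain L where L: "\<And>z. \<bar>g z\<bar> \<le> L"
  proof -
    have "bounded (g ` K)"
      using assms by (intro compact_imp_bounded compact_continuous_image) (auto intro: continuous_on_subset)
    then obtain L where "\<And>z. z \<in> K \<Longrightarrow> \<bar>g z\<bar> \<le> L" by (auto simp: bounded_iff)
    then have "\<bar>g z\<bar> \<le> max L 0" for z using g0[of z] by (cases "z \<in> K") force+
    then show thesis using that by blast
  qed
  define s where "s n = inverse (real (Suc n))" for n
  have s: "s n > 0" "s n \<le> 1" for n by (auto simp: s_def field_simps)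
  have s0: "s \<longlonglongrightarrow> 0" unfolding s_def using LIMSEQ_inverse_real_of_nat by simp
  define q where "q n = (\<lambda>z. (f (z + s n *\<^sub>R e) - f z) / s n)" for n
  \<comment> \<open>Contains the supports of all difference quotients with steps in
    \<open>(0, 1]\<close>.\<close>
  define K' where "K' = (\<lambda>(z,r). z - r *\<^sub>R e) ` (K \<times> {0..1::real})"
  have cK': "compact K'"
    unfolding K'_def using assms(4)
    by (intro compact_continuous_image compact_Times) (auto intro!: continuous_intros simp: case_prod_beta)
  have [measurable]: "f \<in> borel_measurable borel" "g \<in> borel_measurable borel"
    using assms by (auto intro: borel_measurable_continuous_onI)
  have fi: "integrable lborel f" using integrable_continuous_compact_support assms by blast
  have "integral\<^sup>L lborel (q n) = 0" for n
  proof -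
    have "integrable lborel (\<lambda>z. f (z + s n *\<^sub>R e))" using fi lborel_shift(2)[of f] by simp
    then show ?thesis
      using fi lborel_shift(1)[of f "s n *\<^sub>R e"] by (simp add: q_def)
  qed
  moreover have "(\<lambda>n. integral\<^sup>L lborel (q n)) \<longlonglongrightarrow> integral\<^sup>L lborel g"
  proof (rule integral_dominated_convergence)
    show "integrable lborel (\<lambda>z. indicator K' z * L)"
      using cK' emeasure_compact_finite[OF cK']
      by (intro integrable_mult_left) (auto simp: integrable_indicator_iff borel_compact)
    show "AE z in lborel. (\<lambda>n. q n z) \<longlonglongrightarrow> g z"
    proof (rule AE_I2)
      fix z
      have "((\<lambda>h. (f (z + h *\<^sub>R e) - f z) / h) \<longlongrightarrow> g z) (at 0)"
        using assms(1)[of z] by (simp add: has_partial_def DERIV_def)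
      moreover have "filterlim s (at 0) sequentially"
        using s0 s(1) by (auto simp: filterlim_at intro!: always_eventually) (metis less_irrefl)
      ultimately show "(\<lambda>n. q n z) \<longlonglongrightarrow> g z"
        unfolding q_def by (rule filterlim_compose)
    qed
    show "AE z in lborel. norm (q n z) \<le> indicator K' z * L" for n
    proof (rule AE_I2)
      fix z
      show "norm (q n z) \<le> indicator K' z * L"
      proof (cases "z \<in> K'")
        case True
        then show ?thesis
          using has_partial_lipschitz[of f e g L z "s n"] assms(1) L s[of n]
          by (simp add: q_def field_simps)
      next
        case False
        have "z \<notin> K" using False by (force simp: K'_def)
        moreover have "z + s n *\<^sub>R e \<notin> K"
        proof
          assume "z + s n *\<^sub>R e \<in> K"
          then have "(\<lambda>(z,r). z - r *\<^sub>R e) (z + s n *\<^sub>R e, s n) \<in> K'"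
            unfolding K'_def using s[of n] by (intro imageI) auto
          then show False using False by simp
        qed
        ultimately show ?thesis using assms(5) False by (simp add: q_def)
      qed
    qed
  qed (auto simp: q_def)
  ultimately show ?thesis by (simp add: LIMSEQ_const_iff)
qed

section \<open>Convolution with a smooth kernel\<close>

definition conv :: "('a::euclidean_space \<Rightarrow> real) \<Rightarrow> ('a \<Rightarrow> real) \<Rightarrow> 'a \<Rightarrow> real" where
  "conv \<rho> f z = (\<integral>w. \<rho> (z - w) * f w \<partial>lborel)"

lemma conv_kernel_integrable:
  fixes f :: "'a::euclidean_space \<Rightarrow> real"
  assumes "integrable lborel f" "\<rho> \<in> borel_measurable borel" "\<And>z. \<bar>\<rho> z\<bar> \<le> L"
  shows "integrable lborel (\<lambda>w. \<rho> (z - w) * f w)"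
proof -
  have [measurable]: "f \<in> borel_measurable borel" "\<rho> \<in> borel_measurable borel"
    using assms by (auto dest: borel_measurable_integrable)
  show ?thesis
  proof (rule Bochner_Integration.integrable_bound[of _ "\<lambda>w. L * \<bar>f w\<bar>"])
    show "integrable lborel (\<lambda>w. L * \<bar>f w\<bar>)" using assms(1) by simp
    show "AE w in lborel. norm (\<rho> (z - w) * f w) \<le> norm (L * \<bar>f w\<bar>)"
    proof (rule AE_I2)
      fix w
      have "\<bar>\<rho> (z - w)\<bar> * \<bar>f w\<bar> \<le> L * \<bar>f w\<bar>" by (intro mult_right_mono assms(3)) simp
      then show "norm (\<rho> (z - w) * f w) \<le> norm (L * \<bar>f w\<bar>)"
        using abs_ge_self[of "L * \<bar>f w\<bar>"]
        by (simp only: real_norm_def abs_mult[of "\<rho> (z - w)"])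
    qed
  qed measurable
qed

lemma conv_continuous:
  assumes "integrable lborel f" "continuous_on UNIV \<rho>" "\<And>z. \<bar>\<rho> z\<bar> \<le> L"
  shows "continuous_on UNIV (conv \<rho> f)"
proof (rule continuous_at_imp_continuous_on, intro ballI)
  fix z
  have [measurable]: "f \<in> borel_measurable borel" "\<rho> \<in> borel_measurable borel"
    using assms by (auto dest: borel_measurable_integrable intro: borel_measurable_continuous_onI)
  show "isCont (conv \<rho> f) z"
    unfolding continuous_at_sequentially comp_def
  proof (intro allI impI)
    fix X assume X: "X \<longlonglongrightarrow> z"
    show "(\<lambda>n. conv \<rho> f (X n)) \<longlonglongrightarrow> conv \<rho> f z"
      unfolding conv_def
    proof (rule integral_dominated_convergence)
      show "integrable lborel (\<lambda>w. L * \<bar>f w\<bar>)" using assms by auto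
      show "AE w in lborel. (\<lambda>n. \<rho> (X n - w) * f w) \<longlonglongrightarrow> \<rho> (z - w) * f w"
      proof (intro AE_I2 tendsto_intros)
        fix w
        have "isCont \<rho> (z - w)" using assms(2) by (simp add: continuous_on_eq_continuous_at)
        then show "(\<lambda>n. \<rho> (X n - w)) \<longlonglongrightarrow> \<rho> (z - w)"
          using X by (intro isCont_tendsto_compose[of _ \<rho>] tendsto_diff tendsto_const)
      qed
      show "AE w in lborel. norm (\<rho> (X n - w) * f w) \<le> L * \<bar>f w\<bar>" for n
        using assms by (auto simp: abs_mult intro!: mult_right_mono)
    qed auto
  qed
qed

text \<open>Only the kernel is differentiated, so integrability of \<open>f\<close> suffices: the
  mean value theorem bounds the difference quotients under the integral by
  \<open>L' * \<bar>f w\<bar>\<close>.\<close>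

lemma conv_partial:
  assumes "integrable lborel f" "continuous_on UNIV \<rho>" "continuous_on UNIV \<rho>'"
    and "\<And>z. has_partial \<rho> e (\<rho>' z) z" "\<And>z. \<bar>\<rho> z\<bar> \<le> L" "\<And>z. \<bar>\<rho>' z\<bar> \<le> L'"
  shows "has_partial (conv \<rho> f) e (conv \<rho>' f z) z"
  unfolding has_partial_def DERIV_def tendsto_at_iff_sequentially comp_def
proof (intro allI impI)
  have [measurable]: "f \<in> borel_measurable borel" "\<rho> \<in> borel_measurable borel" "\<rho>' \<in> borel_measurable borel"
    using assms by (auto dest: borel_measurable_integrable intro: borel_measurable_continuous_onI)
  fix X :: "nat \<Rightarrow> real" assume X: "\<forall>i. X i \<in> UNIV - {0}" "X \<longlonglongrightarrow> 0"
  have I: "integrable lborel (\<lambda>w. \<rho> (z - w) * f w)" for z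
    using conv_kernel_integrable[of f \<rho> L z] assms by simp
  have "(conv \<rho> f (z + (0 + X i) *\<^sub>R e) - conv \<rho> f (z + 0 *\<^sub>R e)) / X i
      = (\<integral>w. (\<rho> (z - w + X i *\<^sub>R e) - \<rho> (z - w)) / X i * f w \<partial>lborel)" for i
  proof -
    have "(\<lambda>w. (\<rho> (z - w + X i *\<^sub>R e) - \<rho> (z - w)) / X i * f w)
        = (\<lambda>w. (\<rho> (z + X i *\<^sub>R e - w) * f w - \<rho> (z - w) * f w) / X i)"
      by (rule ext) (simp add: algebra_simps diff_divide_distrib)
    then show ?thesis
      using Bochner_Integration.integral_diff[OF I[of "z + X i *\<^sub>R e"] I[of z]]
      by (simp add: conv_def)
  qed
  moreover have "(\<lambda>i. \<integral>w. (\<rho> (z - w + X i *\<^sub>R e) - \<rho> (z - w)) / X i * f w \<partial>lborel) \<longlonglongrightarrow> conv \<rho>' f z"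
    unfolding conv_def
  proof (rule integral_dominated_convergence)
    show "integrable lborel (\<lambda>w. L' * \<bar>f w\<bar>)" using assms by auto
    show "AE w in lborel. (\<lambda>i. (\<rho> (z - w + X i *\<^sub>R e) - \<rho> (z - w)) / X i * f w) \<longlonglongrightarrow> \<rho>' (z - w) * f w"
    proof (intro AE_I2 tendsto_intros)
      fix w
      have "((\<lambda>h. (\<rho> (z - w + h *\<^sub>R e) - \<rho> (z - w)) / h) \<longlongrightarrow> \<rho>' (z - w)) (at 0)"
        using assms(4)[of "z - w"] by (simp add: has_partial_def DERIV_def)
      then show "(\<lambda>i. (\<rho> (z - w + X i *\<^sub>R e) - \<rho> (z - w)) / X i) \<longlonglongrightarrow> \<rho>' (z - w)"
        using X unfolding tendsto_at_iff_sequentially comp_def by blast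
    qed
    show "AE w in lborel. norm ((\<rho> (z - w + X i *\<^sub>R e) - \<rho> (z - w)) / X i * f w) \<le> L' * \<bar>f w\<bar>" for i
    proof (rule AE_I2)
      fix w
      have "\<bar>\<rho> (z - w + X i *\<^sub>R e) - \<rho> (z - w)\<bar> \<le> L' * \<bar>X i\<bar>"
        using assms by (intro has_partial_lipschitz)
      then have "\<bar>(\<rho> (z - w + X i *\<^sub>R e) - \<rho> (z - w)) / X i\<bar> \<le> L'"
        using X by (simp add: field_simps)
      then show "norm ((\<rho> (z - w + X i *\<^sub>R e) - \<rho> (z - w)) / X i * f w) \<le> L' * \<bar>f w\<bar>"
        unfolding real_norm_def abs_mult by (intro mult_right_mono) auto
    qed
  qed auto
  ultimately show "(\<lambda>i. (conv \<rho> f (z + (0 + X i) *\<^sub>R e) - conv \<rho> f (z + 0 *\<^sub>R e)) / X i) \<longlonglongrightarrow> conv \<rho>' f z"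
    by presburger
qed

section \<open>Continuity of translations in the mean\<close>

lemma open_translate_L1:
  fixes U :: "'a::euclidean_space set"
  assumes "open U" "emeasure lborel U < \<infinity>" "X \<longlonglongrightarrow> 0"
  shows "(\<lambda>n. \<integral>z. \<bar>indicator U (z + X n) - indicator U z :: real\<bar> \<partial>lborel) \<longlonglongrightarrow> 0"
proof -
  let ?f = "indicator U :: 'a \<Rightarrow> real"
  have f: "integrable lborel ?f" using assms by (simp add: integrable_indicator_iff)
  have [measurable]: "?f \<in> borel_measurable borel" using assms by simp
  have fX: "integrable lborel (\<lambda>z. ?f (z + X n))" "integral\<^sup>L lborel (\<lambda>z. ?f (z + X n)) = integral\<^sup>L lborel ?f" for n
    using f lborel_shift[of ?f "X n"] by auto
  have pos: "integrable lborel (\<lambda>z. max 0 (?f z - ?f (z + X n)))" for n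
    using f fX by (intro Bochner_Integration.integrable_max integrable_zero Bochner_Integration.integrable_diff)
  \<comment> \<open>Scheffe's argument. An indicator and its translate have the same integral, so
    their distance is twice the integral of the part where the translate is the smaller one.
    Openness of \<open>U\<close> makes exactly this part tend to 0 at every point.\<close>
  have eq: "(\<integral>z. \<bar>?f (z + X n) - ?f z\<bar> \<partial>lborel) = 2 * (\<integral>z. max 0 (?f z - ?f (z + X n)) \<partial>lborel)" for n
  proof -
    have "(\<integral>z. \<bar>?f (z + X n) - ?f z\<bar> \<partial>lborel)
       = (\<integral>z. 2 * max 0 (?f z - ?f (z + X n)) - (?f z - ?f (z + X n)) \<partial>lborel)"
      by (intro Bochner_Integration.integral_cong) (auto simp: max_def)
    also have "\<dots> = 2 * (\<integral>z. max 0 (?f z - ?f (z + X n)) \<partial>lborel)"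
      using f fX pos by simp
    finally show ?thesis .
  qed
  have "(\<lambda>n. \<integral>z. max 0 (?f z - ?f (z + X n)) \<partial>lborel) \<longlonglongrightarrow> integral\<^sup>L lborel (\<lambda>_::'a. 0::real)"
  proof (rule integral_dominated_convergence[where w="?f"])
    show "AE z in lborel. (\<lambda>n. max 0 (?f z - ?f (z + X n))) \<longlonglongrightarrow> 0"
    proof (rule AE_I2)
      fix z
      show "(\<lambda>n. max 0 (?f z - ?f (z + X n))) \<longlonglongrightarrow> 0"
      proof (cases "z \<in> U")
        case True
        have "(\<lambda>n. z + X n) \<longlonglongrightarrow> z + 0" using assms(3) by (intro tendsto_intros)
        then have "eventually (\<lambda>n. z + X n \<in> U) sequentially"
          using assms(1) True by (auto dest: topological_tendstoD)
        then show ?thesis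
          by (intro tendsto_eventually) (auto elim: eventually_mono simp: indicator_def)
      next
        case False
        then show ?thesis by (simp add: indicator_def)
      qed
    qed
    show "AE z in lborel. norm (max 0 (?f z - ?f (z + X n))) \<le> ?f z" for n
      by (auto simp: indicator_def)
    show "(\<lambda>z. max 0 (?f z - ?f (z + X n))) \<in> borel_measurable lborel" for n by measurable
  qed (use f in auto)
  then have "(\<lambda>n. 2 * (\<integral>z. max 0 (?f z - ?f (z + X n)) \<partial>lborel)) \<longlonglongrightarrow> 2 * 0"
    by (intro tendsto_intros) simp
  then show ?thesis by (simp add: eq)
qed

lemma translate_diff_integrable:
  fixes f :: "'a::euclidean_space \<Rightarrow> real"
  assumes "integrable lborel f"
  shows "integrable lborel (\<lambda>z. \<bar>f (z + c) - f z\<bar>)"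
proof -
  have "f \<in> borel_measurable borel" using assms by (auto dest: borel_measurable_integrable)
  then have "integrable lborel (\<lambda>z. f (z + c))" using lborel_shift(2) assms by blast
  then show ?thesis using assms by auto
qed

lemma translate_L1_approx:
  fixes f g :: "'a::euclidean_space \<Rightarrow> real"
  assumes "integrable lborel f" "integrable lborel g"
  shows "(\<integral>z. \<bar>f (z + c) - f z\<bar> \<partial>lborel)
    \<le> (\<integral>z. \<bar>g (z + c) - g z\<bar> \<partial>lborel) + 2 * (\<integral>z. \<bar>f z - g z\<bar> \<partial>lborel)"
proof -
  have [measurable]: "f \<in> borel_measurable borel" "g \<in> borel_measurable borel"
    using assms by (auto dest: borel_measurable_integrable)
  have d: "integrable lborel (\<lambda>z. \<bar>f z - g z\<bar>)" using assms by auto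
  have d': "integrable lborel (\<lambda>z. \<bar>f (z + c) - g (z + c)\<bar>)"
    and e: "(\<integral>z. \<bar>f (z + c) - g (z + c)\<bar> \<partial>lborel) = (\<integral>z. \<bar>f z - g z\<bar> \<partial>lborel)"
    using d lborel_shift[of "\<lambda>z. \<bar>f z - g z\<bar>" c] by auto
  have "(\<integral>z. \<bar>f (z + c) - f z\<bar> \<partial>lborel)
    \<le> (\<integral>z. \<bar>g (z + c) - g z\<bar> + (\<bar>f (z + c) - g (z + c)\<bar> + \<bar>f z - g z\<bar>) \<partial>lborel)"
    using d d' translate_diff_integrable[OF assms(1)] translate_diff_integrable[OF assms(2)]
    by (intro integral_mono) (auto intro!: Bochner_Integration.integrable_add)
  also have "\<dots> = (\<integral>z. \<bar>g (z + c) - g z\<bar> \<partial>lborel)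
      + ((\<integral>z. \<bar>f (z + c) - g (z + c)\<bar> \<partial>lborel) + (\<integral>z. \<bar>f z - g z\<bar> \<partial>lborel))"
    using d d' translate_diff_integrable[OF assms(2)]
    by (subst Bochner_Integration.integral_add; (subst Bochner_Integration.integral_add)?)
       (auto intro!: Bochner_Integration.integrable_add)
  finally show ?thesis using e by simp
qed

text \<open>Density argument: outer regularity passes from open sets to Borel sets of finite
  measure, linearity to simple functions, and dominated convergence to all integrable
  functions.\<close>

lemma translate_L1_seq:
  fixes f :: "'a::euclidean_space \<Rightarrow> real"
  assumes "integrable lborel f" "X \<longlonglongrightarrow> 0"
  shows "(\<lambda>n. \<integral>z. \<bar>f (z + X n) - f z\<bar> \<partial>lborel) \<longlonglongrightarrow> 0"
proof -
  \<comment> \<open>The claim is closed under limits in the mean. This is used twice: to go from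
    open sets to Borel sets, and from simple functions to general ones.\<close>
  have approx: "(\<lambda>n. \<integral>z. \<bar>f (z + X n) - f z\<bar> \<partial>lborel) \<longlonglongrightarrow> 0"
    if f: "integrable lborel f" and ap: "\<And>r. r > 0 \<Longrightarrow> \<exists>g. integrable lborel g \<and> (\<integral>z. \<bar>f z - g z\<bar> \<partial>lborel) < r \<and>
        (\<lambda>n. \<integral>z. \<bar>g (z + X n) - g z\<bar> \<partial>lborel) \<longlonglongrightarrow> 0" for f :: "'a \<Rightarrow> real"
  proof (rule LIMSEQ_I)
    fix r :: real assume r: "0 < r"
    obtain g where g: "integrable lborel g" "(\<integral>z. \<bar>f z - g z\<bar> \<partial>lborel) < r/4"
      "(\<lambda>n. \<integral>z. \<bar>g (z + X n) - g z\<bar> \<partial>lborel) \<longlonglongrightarrow> 0"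
      using ap[of "r/4"] r by auto
    obtain N where N: "\<And>n. n \<ge> N \<Longrightarrow> norm ((\<integral>z. \<bar>g (z + X n) - g z\<bar> \<partial>lborel) - 0) < r/2"
      using LIMSEQ_D[OF g(3), of "r/2"] r by auto
    have "norm ((\<integral>z. \<bar>f (z + X n) - f z\<bar> \<partial>lborel) - 0) < r" if "n \<ge> N" for n
    proof -
      have "(\<integral>z. \<bar>f (z + X n) - f z\<bar> \<partial>lborel) \<ge> 0" by (intro integral_nonneg_AE) auto
      then show ?thesis
        using N[OF that] translate_L1_approx[OF f g(1), of "X n"] g(2) by simp
    qed
    then show "\<exists>N. \<forall>n\<ge>N. norm ((\<integral>z. \<bar>f (z + X n) - f z\<bar> \<partial>lborel) - 0) < r" by blast
  qed
  show ?thesis using assms(1)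
  proof (induction f rule: integrable_induct)
    case (base A c)
    then have A: "A \<in> sets borel" "emeasure lborel A < \<infinity>" by auto
    have "(\<lambda>n. \<integral>z. \<bar>indicator A (z + X n) - indicator A z :: real\<bar> \<partial>lborel) \<longlonglongrightarrow> 0"
    proof (rule approx)
      show "integrable lborel (indicator A :: 'a \<Rightarrow> real)" using A by (simp add: integrable_indicator_iff)
      fix r :: real assume r: "r > 0"
      obtain U where U: "open U" "A \<subseteq> U" "emeasure lborel (U - A) < ennreal r"
        using outer_regular_lborel[OF A(1) r] by blast
      have Ub: "U \<in> sets borel" using U by simp
      have "emeasure lborel U \<le> emeasure lborel A + emeasure lborel (U - A)"
        using A U Ub by (subst plus_emeasure) (auto simp: Un_absorb1)
      also have "\<dots> < \<infinity>" using A(2) U(3) by (auto simp: less_top[symmetric])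
      finally have Uf: "emeasure lborel U < \<infinity>" .
      have "(\<integral>z. \<bar>indicator A z - indicator U z :: real\<bar> \<partial>lborel) = (\<integral>z. indicator (U - A) z \<partial>lborel)"
        using U by (intro Bochner_Integration.integral_cong) (auto simp: indicator_def)
      also have "\<dots> = measure lborel (U - A)" using A Ub by simp
      also have "\<dots> < r"
        using U(3) r by (metis emeasure_eq_ennreal_measure ennreal_less_iff less_top[symmetric] measure_nonneg top.not_eq_extremum order.strict_trans1 less_le_trans top_greatest)
      finally show "\<exists>g. integrable lborel g \<and> (\<integral>z. \<bar>indicator A z - g z\<bar> \<partial>lborel) < r \<and>
        (\<lambda>n. \<integral>z. \<bar>g (z + X n) - g z\<bar> \<partial>lborel) \<longlonglongrightarrow> 0"
        using open_translate_L1[OF U(1) Uf assms(2)] Uf Ub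
        by (intro exI[of _ "indicator U"]) (simp add: integrable_indicator_iff)
    qed
    then have "(\<lambda>n. (\<integral>z. \<bar>indicator A (z + X n) - indicator A z :: real\<bar> \<partial>lborel) * \<bar>c\<bar>) \<longlonglongrightarrow> 0 * \<bar>c\<bar>"
      by (intro tendsto_intros)
    moreover have "(\<integral>z. \<bar>indicator A (z + X n) *\<^sub>R c - indicator A z *\<^sub>R c\<bar> \<partial>lborel)
        = (\<integral>z. \<bar>indicator A (z + X n) - indicator A z :: real\<bar> \<partial>lborel) * \<bar>c\<bar>" for n
      by (simp add: abs_mult left_diff_distrib[symmetric] del: Bochner_Integration.integral_mult_left_zero
          flip: Bochner_Integration.integral_mult_left_zero)
    ultimately show ?case by simp
  next
    case (add f g)
    note fi = \<open>integrable lborel f\<close> and gi = \<open>integrable lborel g\<close>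
    have lim: "(\<lambda>n. (\<integral>z. \<bar>f (z + X n) - f z\<bar> \<partial>lborel) + (\<integral>z. \<bar>g (z + X n) - g z\<bar> \<partial>lborel)) \<longlonglongrightarrow> 0 + 0"
      using add by (intro tendsto_intros)
    show ?case
    proof (rule tendsto_sandwich[OF _ _ tendsto_const lim[simplified]]; intro always_eventually allI)
      fix n
      show "0 \<le> (\<integral>z. \<bar>f (z + X n) + g (z + X n) - (f z + g z)\<bar> \<partial>lborel)"
        by (intro integral_nonneg_AE) auto
      have "(\<integral>z. \<bar>f (z + X n) + g (z + X n) - (f z + g z)\<bar> \<partial>lborel)
        \<le> (\<integral>z. \<bar>f (z + X n) - f z\<bar> + \<bar>g (z + X n) - g z\<bar> \<partial>lborel)"
        using translate_diff_integrable[OF fi] translate_diff_integrable[OF gi]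
          translate_diff_integrable[OF Bochner_Integration.integrable_add[OF fi gi]]
        by (intro integral_mono) auto
      then show "(\<integral>z. \<bar>f (z + X n) + g (z + X n) - (f z + g z)\<bar> \<partial>lborel)
        \<le> (\<integral>z. \<bar>f (z + X n) - f z\<bar> \<partial>lborel) + (\<integral>z. \<bar>g (z + X n) - g z\<bar> \<partial>lborel)"
        using translate_diff_integrable[OF fi] translate_diff_integrable[OF gi] by simp
    qed
  next
    case (lim f s)
    show ?case
    proof (rule approx[OF lim.hyps(4)])
      fix r :: real assume r: "r > 0"
      have "(\<lambda>i. \<integral>z. \<bar>f z - s i z\<bar> \<partial>lborel) \<longlonglongrightarrow> integral\<^sup>L lborel (\<lambda>_::'a. 0::real)"
      proof (rule integral_dominated_convergence[where w="\<lambda>z. 3 * \<bar>f z\<bar>"])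
        show "AE z in lborel. (\<lambda>i. \<bar>f z - s i z\<bar>) \<longlonglongrightarrow> 0"
        proof (rule AE_I2)
          fix z
          have "(\<lambda>i. \<bar>f z - s i z\<bar>) \<longlonglongrightarrow> \<bar>f z - f z\<bar>"
            using lim.hyps(2)[of z] by (intro tendsto_intros) auto
          then show "(\<lambda>i. \<bar>f z - s i z\<bar>) \<longlonglongrightarrow> 0" by simp
        qed
        show "AE z in lborel. norm \<bar>f z - s i z\<bar> \<le> 3 * \<bar>f z\<bar>" for i
        proof (rule AE_I2)
          fix z
          show "norm \<bar>f z - s i z\<bar> \<le> 3 * \<bar>f z\<bar>"
            using lim.hyps(3)[of z i] by simp
        qed
        show "(\<lambda>z. \<bar>f z - s i z\<bar>) \<in> borel_measurable lborel" for i
          using lim.hyps(1)[of i] lim.hyps(4) by (auto dest!: borel_measurable_integrable)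
      qed (use lim.hyps(4) in auto)
      then have "eventually (\<lambda>i. (\<integral>z. \<bar>f z - s i z\<bar> \<partial>lborel) < r) sequentially"
        using r by (auto dest!: order_tendstoD(2))
      then obtain i where "(\<integral>z. \<bar>f z - s i z\<bar> \<partial>lborel) < r"
        by (auto simp: eventually_sequentially)
      then show "\<exists>g. integrable lborel g \<and> (\<integral>z. \<bar>f z - g z\<bar> \<partial>lborel) < r \<and>
        (\<lambda>n. \<integral>z. \<bar>g (z + X n) - g z\<bar> \<partial>lborel) \<longlonglongrightarrow> 0"
        using lim.hyps(1) lim.IH by blast
    qed
  qed
qed

lemma translate_L1:
  fixes f :: "'a::euclidean_space \<Rightarrow> real"
  assumes "integrable lborel f" "r > 0"
  shows "\<exists>\<delta>>0. \<forall>c. norm c < \<delta> \<longrightarrow> (\<integral>z. \<bar>f (z + c) - f z\<bar> \<partial>lborel) < r"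
proof -
  have "((\<lambda>c. \<integral>z. \<bar>f (z + c) - f z\<bar> \<partial>lborel) \<longlongrightarrow> 0) (at 0)"
    unfolding tendsto_at_iff_sequentially comp_def using translate_L1_seq[OF assms(1)] by blast
  then have "eventually (\<lambda>c. (\<integral>z. \<bar>f (z + c) - f z\<bar> \<partial>lborel) < r) (at 0)"
    using assms(2) by (rule order_tendstoD(2))
  then obtain \<delta> where "\<delta> > 0" "\<And>c. c \<noteq> 0 \<Longrightarrow> norm c < \<delta> \<Longrightarrow> (\<integral>z. \<bar>f (z + c) - f z\<bar> \<partial>lborel) < r"
    by (auto simp: eventually_at)
  moreover have "(\<integral>z. \<bar>f (z + 0) - f z\<bar> \<partial>lborel) < r" using assms(2) by simp
  ultimately show ?thesis by metis
qed

section \<open>Mollification converges in the mean\<close>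

lemma mollifier_bounded:
  assumes "mollifier \<epsilon> \<rho>"
  obtains L where "\<And>z. \<bar>\<rho> z\<bar> \<le> L"
proof -
  have c: "continuous_on UNIV \<rho>" using assms Ck.simps(1) unfolding mollifier_def by blast
  then have "bounded (\<rho> ` cball 0 \<epsilon>)"
    by (intro compact_imp_bounded compact_continuous_image) (auto intro: continuous_on_subset)
  then obtain L where L: "\<And>z. z \<in> cball 0 \<epsilon> \<Longrightarrow> \<bar>\<rho> z\<bar> \<le> L" unfolding bounded_iff by (metis image_eqI real_norm_def)
  have "\<bar>\<rho> z\<bar> \<le> max L 0" for z
    using assms L[of z] unfolding mollifier_def by (cases "\<rho> z = 0") force+
  then show thesis using that by blast
qed

lemma mollifier_measurable: "mollifier \<epsilon> \<rho> \<Longrightarrow> \<rho> \<in> borel_measurable borel"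
  unfolding mollifier_def by (auto dest: borel_measurable_integrable)

lemma mollifier_integral:
  assumes "mollifier \<epsilon> \<rho>"
  shows "integrable lborel (\<lambda>w. \<rho> (z - w))" "(\<integral>w. \<rho> (z - w) \<partial>lborel) = 1"
  using assms lborel_reflect[OF mollifier_measurable[OF assms], of z] unfolding mollifier_def by auto

text \<open>The error is an average, with weight \<open>\<rho> (-h)\<close>, of the differences
  between \<open>f\<close> and its translates by \<open>h\<close>; Tonelli's theorem moves the
  average outside. Working with nonnegative integrals yields the integrability of the error along
  with the bound.\<close>

lemma mollifier_conv_L1:
  fixes f :: "'a::euclidean_space \<Rightarrow> real"
  assumes f: "integrable lborel f" and \<rho>: "mollifier \<epsilon> \<rho>"
    and r: "\<And>c. norm c < \<epsilon> \<Longrightarrow> (\<integral>z. \<bar>f (z + c) - f z\<bar> \<partial>lborel) \<le> r"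
  shows "integrable lborel (\<lambda>z. conv \<rho> f z - f z)" "(\<integral>z. \<bar>conv \<rho> f z - f z\<bar> \<partial>lborel) \<le> r"
proof -
  have [measurable]: "f \<in> borel_measurable borel" "\<rho> \<in> borel_measurable borel"
    using f mollifier_measurable[OF \<rho>] by (auto dest: borel_measurable_integrable)
  obtain L where L: "\<And>z. \<bar>\<rho> z\<bar> \<le> L" using mollifier_bounded[OF \<rho>] by blast
  have \<rho>0: "\<rho> z \<ge> 0" for z using \<rho> by (simp add: mollifier_def)
  have c: "continuous_on UNIV \<rho>" using \<rho> Ck.simps(1) unfolding mollifier_def by blast
  have [measurable]: "conv \<rho> f \<in> borel_measurable borel"
    by (intro borel_measurable_continuous_onI conv_continuous[OF f c L])
  \<comment> \<open>A mollifier of nonpositive width would vanish identically and could not have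
    mass 1. Hence \<open>c = 0\<close> is an admissible translation, which gives
    \<open>r \<ge> 0\<close>.\<close>
  have "0 < \<epsilon>"
  proof -
    have "\<exists>z. \<rho> z \<noteq> 0" using mollifier_integral(2)[OF \<rho>, of 0] by (metis integral_zero mult_zero_left zero_neq_one Bochner_Integration.integral_cong)
    then show ?thesis using \<rho> unfolding mollifier_def by (meson norm_ge_zero order.strict_trans1)
  qed
  then have r0: "r \<ge> 0" using r[of 0] by simp
  have pt: "ennreal \<bar>conv \<rho> f z - f z\<bar> \<le> (\<integral>\<^sup>+h. ennreal (\<rho> (-h) * \<bar>f (z + h) - f z\<bar>) \<partial>lborel)" for z
  proof -
    have i1: "integrable lborel (\<lambda>w. \<rho> (z - w) * f w)"
      by (rule conv_kernel_integrable[of f \<rho> L]) (use f L in auto)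
    have i2: "integrable lborel (\<lambda>w. \<rho> (z - w) * f z)"
      using mollifier_integral(1)[OF \<rho>] by simp
    have i: "integrable lborel (\<lambda>w. \<rho> (z - w) * (f w - f z))"
      using Bochner_Integration.integrable_diff[OF i1 i2] by (simp add: algebra_simps)
    have "conv \<rho> f z - f z = (\<integral>w. \<rho> (z - w) * (f w - f z) \<partial>lborel)"
      using Bochner_Integration.integral_diff[OF i1 i2] mollifier_integral(2)[OF \<rho>, of z]
      by (simp add: conv_def algebra_simps)
    then have "\<bar>conv \<rho> f z - f z\<bar> \<le> (\<integral>w. \<bar>\<rho> (z - w) * (f w - f z)\<bar> \<partial>lborel)"
      using integral_abs_bound by metis
    also have "\<dots> = (\<integral>w. \<rho> (z - w) * \<bar>f w - f z\<bar> \<partial>lborel)"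
      using \<rho>0 by (simp add: abs_mult)
    also have "\<dots> = (\<integral>h. \<rho> (-h) * \<bar>f (z + h) - f z\<bar> \<partial>lborel)"
      using lborel_shift(1)[of "\<lambda>w. \<rho> (z - w) * \<bar>f w - f z\<bar>" z] by (simp add: add.commute)
    finally have le: "\<bar>conv \<rho> f z - f z\<bar> \<le> (\<integral>h. \<rho> (-h) * \<bar>f (z + h) - f z\<bar> \<partial>lborel)" .
    have "integrable lborel (\<lambda>w. \<rho> (z - w) * \<bar>f w - f z\<bar>)"
      using integrable_abs[OF i] \<rho>0 by (simp add: abs_mult)
    then have "integrable lborel (\<lambda>h. \<rho> (-h) * \<bar>f (z + h) - f z\<bar>)"
      using lborel_shift(2)[of "\<lambda>w. \<rho> (z - w) * \<bar>f w - f z\<bar>" z] by (simp add: add.commute)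
    then have "(\<integral>\<^sup>+h. ennreal (\<rho> (-h) * \<bar>f (z + h) - f z\<bar>) \<partial>lborel) = ennreal (\<integral>h. \<rho> (-h) * \<bar>f (z + h) - f z\<bar> \<partial>lborel)"
      using \<rho>0 by (intro nn_integral_eq_integral) auto
    then show ?thesis using le by (simp add: ennreal_leI)
  qed
  have "(\<integral>\<^sup>+z. ennreal \<bar>conv \<rho> f z - f z\<bar> \<partial>lborel)
      \<le> (\<integral>\<^sup>+z. (\<integral>\<^sup>+h. ennreal (\<rho> (-h) * \<bar>f (z + h) - f z\<bar>) \<partial>lborel) \<partial>lborel)"
    by (intro nn_integral_mono pt)
  also have "\<dots> = (\<integral>\<^sup>+h. (\<integral>\<^sup>+z. ennreal (\<rho> (-h) * \<bar>f (z + h) - f z\<bar>) \<partial>lborel) \<partial>lborel)"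
    by (rule lborel_pair.Fubini') measurable
  also have "\<dots> \<le> (\<integral>\<^sup>+h. ennreal (\<rho> (-h)) * ennreal r \<partial>lborel)"
  proof (rule nn_integral_mono)
    fix h :: 'a
    have "(\<integral>\<^sup>+z. ennreal (\<rho> (-h) * \<bar>f (z + h) - f z\<bar>) \<partial>lborel)
        = ennreal (\<rho> (-h)) * (\<integral>\<^sup>+z. ennreal \<bar>f (z + h) - f z\<bar> \<partial>lborel)"
      using \<rho>0 by (simp add: ennreal_mult nn_integral_cmult)
    also have "(\<integral>\<^sup>+z. ennreal \<bar>f (z + h) - f z\<bar> \<partial>lborel) = ennreal (\<integral>z. \<bar>f (z + h) - f z\<bar> \<partial>lborel)"
      using translate_diff_integrable[OF f] by (intro nn_integral_eq_integral) auto
    also have "ennreal (\<rho> (-h)) * \<dots> \<le> ennreal (\<rho> (-h)) * ennreal r"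
    proof (cases "\<rho> (-h) = 0")
      case False
      then have "norm h < \<epsilon>" using \<rho> unfolding mollifier_def by (metis norm_minus_cancel)
      then show ?thesis using r by (intro mult_left_mono ennreal_leI) auto
    qed simp
    finally show "(\<integral>\<^sup>+z. ennreal (\<rho> (-h) * \<bar>f (z + h) - f z\<bar>) \<partial>lborel) \<le> ennreal (\<rho> (-h)) * ennreal r" .
  qed
  also have "\<dots> = (\<integral>\<^sup>+h. ennreal (\<rho> (0-h)) \<partial>lborel) * ennreal r"
    by (subst nn_integral_multc[symmetric]) auto
  also have "(\<integral>\<^sup>+h. ennreal (\<rho> (0-h)) \<partial>lborel) = ennreal 1"
    using mollifier_integral[OF \<rho>, of 0] \<rho>0 by (subst nn_integral_eq_integral) auto
  finally have le: "(\<integral>\<^sup>+z. ennreal \<bar>conv \<rho> f z - f z\<bar> \<partial>lborel) \<le> ennreal r" by simp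
  show I: "integrable lborel (\<lambda>z. conv \<rho> f z - f z)"
    by (rule integrableI_bounded) (use le in \<open>auto simp: less_top[symmetric] top_unique\<close>)
  have "ennreal (\<integral>z. \<bar>conv \<rho> f z - f z\<bar> \<partial>lborel) \<le> ennreal r"
    using le I by (subst nn_integral_eq_integral[symmetric]) auto
  then show "(\<integral>z. \<bar>conv \<rho> f z - f z\<bar> \<partial>lborel) \<le> r" using r0 by (simp add: ennreal_le_iff)
qed

section \<open>Mollified weak solutions\<close>

definition space_dir :: "'n::finite \<Rightarrow> 'n spacetime" where
  "space_dir i = (axis i 1, 0)"

definition time_dir :: "'n::finite spacetime" where
  "time_dir = (0, 1)"

lemma space_dir_Basis: "space_dir i \<in> Basis"
  by (simp add: space_dir_def Basis_prod_def)

lemma time_dir_Basis: "time_dir \<in> Basis"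
  by (simp add: time_dir_def Basis_prod_def)

lemma frechet_compose_affine:
  fixes \<rho> :: "'a::euclidean_space \<Rightarrow> real" and L :: "'b::euclidean_space \<Rightarrow> 'a"
  assumes "\<rho> differentiable (at (L x + c))" "linear L"
  shows "((\<lambda>x. \<rho> (L x + c)) has_derivative (\<lambda>h. frechet_derivative \<rho> (at (L x + c)) (L h))) (at x)"
proof -
  have "((\<lambda>x. L x + c) has_derivative L) (at x)"
    using assms(2) by (auto intro!: derivative_eq_intros bounded_linear_imp_has_derivative simp: linear_conv_bounded_linear)
  moreover have "(\<rho> has_derivative frechet_derivative \<rho> (at (L x + c))) (at (L x + c))"
    using assms(1) by (simp add: frechet_derivative_works[symmetric])
  ultimately show ?thesis by (rule has_derivative_compose)
qed

lemma grad_slice: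
  fixes \<phi> :: "'n::finite spacetime \<Rightarrow> real"
  assumes "\<phi> differentiable (at (x, t))"
  shows "grad (\<lambda>x. \<phi> (x, t)) x $ i = frechet_derivative \<phi> (at (x, t)) (space_dir i)"
proof -
  have "((\<lambda>x. \<phi> ((x, 0) + (0, t))) has_derivative (\<lambda>h. frechet_derivative \<phi> (at ((x, 0) + (0, t))) (h, 0))) (at x)"
    by (rule frechet_compose_affine[of \<phi> "\<lambda>x. (x, 0)"]) (use assms in \<open>auto simp: linear_iff\<close>)
  then have "((\<lambda>x. \<phi> (x, t)) has_derivative (\<lambda>h. frechet_derivative \<phi> (at (x, t)) (h, 0))) (at x)" by simp
  from frechet_derivative_at[OF this, symmetric] show ?thesis by (simp add: grad_def space_dir_def)
qed

lemma deriv_slice: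
  fixes \<phi> :: "'n::finite spacetime \<Rightarrow> real"
  assumes "\<phi> differentiable (at (x, t))"
  shows "deriv (\<lambda>s. \<phi> (x, s)) t = frechet_derivative \<phi> (at (x, t)) time_dir"
proof -
  have "((\<lambda>s. \<phi> ((x, 0) + s *\<^sub>R time_dir)) has_real_derivative frechet_derivative \<phi> (at (x, t)) time_dir) (at t)"
    using has_partial_line[of \<phi> time_dir "frechet_derivative \<phi> (at (x, t)) time_dir" "(x, 0)" t] has_partial_frechet[OF assms]
    by (simp add: time_dir_def)
  then show ?thesis by (intro DERIV_imp_deriv) (simp add: time_dir_def)
qed

lemma reflect_differentiable:
  fixes \<rho> :: "'a::euclidean_space \<Rightarrow> real"
  assumes "\<rho> differentiable (at (z - w))"
  shows "(\<lambda>w. \<rho> (z - w)) differentiable (at w)"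
    "frechet_derivative (\<lambda>w. \<rho> (z - w)) (at w) e = - frechet_derivative \<rho> (at (z - w)) e"
proof -
  have *: "((\<lambda>w. \<rho> (z - w)) has_derivative (\<lambda>h. frechet_derivative \<rho> (at (z - w)) (- h))) (at w)"
    using frechet_compose_affine[of \<rho> "\<lambda>w. - w" w z] assms by (simp add: linear_iff)
  then show "(\<lambda>w. \<rho> (z - w)) differentiable (at w)" by (auto simp: differentiable_def)
  show "frechet_derivative (\<lambda>w. \<rho> (z - w)) (at w) e = - frechet_derivative \<rho> (at (z - w)) e"
    using frechet_derivative_at[OF *, symmetric] linear_neg[OF linear_frechet_derivative[OF assms]] by simp
qed

section \<open>Reflected translates of a mollifier as test functions\<close>

context
  fixes \<rho> :: "'n::finite spacetime \<Rightarrow> real" and \<epsilon> :: real and z :: "'n spacetime"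
  assumes \<rho>: "mollifier \<epsilon> \<rho>"
begin

lemma mollifier_Ck: "Ck k \<rho>"
  using \<rho> by (simp add: mollifier_def)

lemma mollifier_differentiable: "\<rho> differentiable (at w)"
  using mollifier_Ck[of 1] unfolding One_nat_def Ck.simps by blast

lemma mollifier_support: "\<rho> w \<noteq> 0 \<Longrightarrow> norm w < \<epsilon>"
  using \<rho> unfolding mollifier_def by blast

lemma mollifier_test_function:
  assumes "cball z \<epsilon> \<subseteq> D"
  shows "(\<lambda>w. \<rho> (z - w)) \<in> test_functions D"
proof -
  have "Ck k (\<lambda>w. \<rho> (z - w))" for k
    using Ck_affine[of "\<lambda>w. - w" k \<rho> z] mollifier_Ck by (simp add: linear_iff)
  moreover have "closure {w. \<rho> (z - w) \<noteq> 0} \<subseteq> cball z \<epsilon>"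
    by (rule closure_minimal) (auto dest!: mollifier_support simp: dist_norm less_imp_le)
  then have "compactly_contained {w. \<rho> (z - w) \<noteq> 0} D"
    using assms unfolding compactly_contained_def
    by (meson closed_closure compact_eq_bounded_closed bounded_subset order_trans bounded_cball)
  ultimately show ?thesis by (simp add: test_functions_def)
qed

text \<open>\<open>weak_gradient\<close> grants integrability on compact subsets of \<open>U\<close>
  only; the time slice of the closed ball is the compact set used for this.\<close>

lemma slice_kernel_support:
  assumes "cball z \<epsilon> \<subseteq> U \<times> T" "t \<in> T"
  shows "compact {x. (x, t) \<in> cball z \<epsilon>}" "{x. (x, t) \<in> cball z \<epsilon>} \<subseteq> U"
    "\<rho> (z - (x, t)) \<noteq> 0 \<Longrightarrow> (x, t) \<in> cball z \<epsilon>"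
proof -
  have "{x. (x, t) \<in> cball z \<epsilon>} \<subseteq> fst ` cball z \<epsilon>" by force
  then have "bounded {x. (x, t) \<in> cball z \<epsilon>}"
    using bounded_fst bounded_cball bounded_subset by metis
  moreover have "closed ((\<lambda>x. (x, t)) -` cball z \<epsilon>)"
    by (intro closed_vimage) (auto intro: continuous_intros)
  ultimately show "compact {x. (x, t) \<in> cball z \<epsilon>}"
    by (simp add: compact_eq_bounded_closed vimage_def)
  show "{x. (x, t) \<in> cball z \<epsilon>} \<subseteq> U" using assms by auto
  show "\<rho> (z - (x, t)) \<noteq> 0 \<Longrightarrow> (x, t) \<in> cball z \<epsilon>"
    by (auto dest!: mollifier_support simp: dist_norm less_imp_le)
qed

lemma mollifier_slice_test_function:
  assumes "cball z \<epsilon> \<subseteq> U \<times> T" "t \<in> T"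
  shows "(\<lambda>x. \<rho> (z - (x, t))) \<in> test_functions U"
proof -
  have "Ck k (\<lambda>x. \<rho> (- (x, 0) + (z - (0, t))))" for k
    by (rule Ck_affine[of "\<lambda>x. - (x, 0)"]) (auto simp: linear_iff mollifier_Ck)
  moreover have "- (x, 0) + (z - (0, t)) = z - (x, t)" for x by (simp add: prod_eq_iff)
  ultimately have C: "Ck k (\<lambda>x. \<rho> (z - (x, t)))" for k by (simp only:)
  have "closure {x. \<rho> (z - (x, t)) \<noteq> 0} \<subseteq> {x. (x, t) \<in> cball z \<epsilon>}"
    using slice_kernel_support[OF assms] by (intro closure_minimal compact_imp_closed) auto
  then have "compactly_contained {x. \<rho> (z - (x, t)) \<noteq> 0} U"
    using slice_kernel_support(1,2)[OF assms] unfolding compactly_contained_def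
    by (meson closed_closure compact_eq_bounded_closed bounded_subset order_trans)
  then show ?thesis using C by (simp add: test_functions_def)
qed

lemma mollifier_slice_grad:
  "grad (\<lambda>x. \<rho> (z - (x, t))) x $ i = - frechet_derivative \<rho> (at (z - (x, t))) (space_dir i)"
  using grad_slice[OF reflect_differentiable(1)[OF mollifier_differentiable]]
    reflect_differentiable(2)[OF mollifier_differentiable] by simp

lemma mollifier_slice_deriv:
  "deriv (\<lambda>s. \<rho> (z - (x, s))) t = - frechet_derivative \<rho> (at (z - (x, t))) time_dir"
  using deriv_slice[OF reflect_differentiable(1)[OF mollifier_differentiable]]
    reflect_differentiable(2)[OF mollifier_differentiable] by simp

lemma mollifier_partial_eq_0:
  assumes "\<epsilon> < norm w"
  shows "frechet_derivative \<rho> (at w) e = 0"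
proof (rule has_partial_zeroD[OF has_partial_frechet[OF mollifier_differentiable]])
  show "\<rho> w = 0" if "w \<in> - cball 0 \<epsilon>" for w using mollifier_support[of w] that by fastforce
qed (use assms in \<open>auto simp: open_Compl\<close>)

lemma mollifier_partial:
  assumes "e \<in> Basis"
  shows "has_partial \<rho> e (frechet_derivative \<rho> (at w) e) w"
    "continuous_on UNIV (\<lambda>w. frechet_derivative \<rho> (at w) e)"
    "\<exists>L. \<forall>w. \<bar>frechet_derivative \<rho> (at w) e\<bar> \<le> L"
proof -
  show "has_partial \<rho> e (frechet_derivative \<rho> (at w) e) w"
    by (rule has_partial_frechet[OF mollifier_differentiable])
  show "continuous_on UNIV (\<lambda>w. frechet_derivative \<rho> (at w) e)"
    using mollifier_Ck[of 1] assms by simp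
  then have "bounded ((\<lambda>w. frechet_derivative \<rho> (at w) e) ` cball 0 \<epsilon>)"
    by (intro compact_imp_bounded compact_continuous_image) (auto intro: continuous_on_subset)
  then obtain L where "\<And>w. w \<in> cball 0 \<epsilon> \<Longrightarrow> \<bar>frechet_derivative \<rho> (at w) e\<bar> \<le> L"
    unfolding bounded_iff by (metis image_eqI real_norm_def)
  moreover have "frechet_derivative \<rho> (at w) e = 0" if "w \<notin> cball 0 \<epsilon>" for w
    using that by (intro mollifier_partial_eq_0) simp
  ultimately have "\<bar>frechet_derivative \<rho> (at w) e\<bar> \<le> max L 0" for w
    by (cases "w \<in> cball 0 \<epsilon>") (metis max.coboundedI1, metis abs_zero max.cobounded2)
  then show "\<exists>L. \<forall>w. \<bar>frechet_derivative \<rho> (at w) e\<bar> \<le> L" by blast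
qed

lemma mollifier_conv:
  assumes "integrable lborel f"
  shows "continuous_on UNIV (conv \<rho> f)"
    "e \<in> Basis \<Longrightarrow> has_partial (conv \<rho> f) e (conv (\<lambda>w. frechet_derivative \<rho> (at w) e) f w) w"
    "e \<in> Basis \<Longrightarrow> continuous_on UNIV (conv (\<lambda>w. frechet_derivative \<rho> (at w) e) f)"
    "integrable lborel (\<lambda>w. \<rho> (z - w) * f w)"
    "e \<in> Basis \<Longrightarrow> integrable lborel (\<lambda>w. frechet_derivative \<rho> (at (z - w)) e * f w)"
proof -
  obtain L where L: "\<And>w. \<bar>\<rho> w\<bar> \<le> L" using mollifier_bounded[OF \<rho>] by blast
  have c: "continuous_on UNIV \<rho>" using mollifier_Ck[of 0] by simp
  show "continuous_on UNIV (conv \<rho> f)" by (rule conv_continuous[OF assms c L])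
  show "integrable lborel (\<lambda>w. \<rho> (z - w) * f w)"
    by (rule conv_kernel_integrable[of f \<rho> L]) (use assms c L in \<open>auto intro: borel_measurable_continuous_onI\<close>)
  assume e: "e \<in> Basis"
  obtain L' where L': "\<And>w. \<bar>frechet_derivative \<rho> (at w) e\<bar> \<le> L'" using mollifier_partial(3)[OF e] by blast
  show "has_partial (conv \<rho> f) e (conv (\<lambda>w. frechet_derivative \<rho> (at w) e) f w) w"
    by (rule conv_partial[OF assms c mollifier_partial(2)[OF e] mollifier_partial(1)[OF e] L L'])
  show "continuous_on UNIV (conv (\<lambda>w. frechet_derivative \<rho> (at w) e) f)"
    by (rule conv_continuous[OF assms mollifier_partial(2)[OF e] L'])
  show "integrable lborel (\<lambda>w. frechet_derivative \<rho> (at (z - w)) e * f w)"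
    by (rule conv_kernel_integrable[of f "\<lambda>w. frechet_derivative \<rho> (at w) e" L'])
      (use assms mollifier_partial(2)[OF e] L' in \<open>auto intro: borel_measurable_continuous_onI\<close>)
qed

end

section \<open>Integrability and iterated integrals on bounded cylinders\<close>

lemma le_one_plus_powr:
  fixes a q p :: real
  assumes "0 \<le> a" "0 < q" "q \<le> p"
  shows "a powr q \<le> 1 + a powr p"
proof (cases "a \<le> 1")
  case True
  then have "a powr q \<le> 1" using assms by (intro powr_le1) auto
  then show ?thesis by (smt (verit) powr_ge_zero)
next
  case False
  then have "a powr q \<le> a powr p" using assms by (intro powr_mono) auto
  then show ?thesis by simp
qed

lemma set_integrable_powr_imp:
  fixes f :: "'a::euclidean_space \<Rightarrow> 'b::euclidean_space"
  assumes "open D" "bounded D" "1 \<le> p" "set_borel_measurable lborel D f"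
    and "set_integrable lborel D (\<lambda>x. norm (f x) powr p)"
  shows "set_integrable lborel D f"
proof -
  have "emeasure lborel D < \<infinity>" using emeasure_bounded_finite[OF assms(2)] by simp
  then have "set_integrable lborel D (\<lambda>_. 1::real)"
    using assms(1) by (simp add: set_integrable_def integrable_indicator_iff)
  then have "set_integrable lborel D (\<lambda>x. 1 + norm (f x) powr p)"
    using assms(5) by (intro set_integral_add)
  then show ?thesis
  proof (rule set_integrable_bound)
    show "set_borel_measurable lborel D f" by fact
    show "AE x in lborel. x \<in> D \<longrightarrow> norm (f x) \<le> norm (1 + norm (f x) powr p)"
      using le_one_plus_powr[of "norm (f _)" 1 p] assms(3) by (auto intro: order_trans[OF _ abs_ge_self])
  qed
qed

text \<open>The weak equation is phrased with iterated integrals and the mollification with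
  integrals over the product space; Fubini's theorem connects the two.\<close>

lemma set_integral_iterated:
  fixes f :: "'a::euclidean_space \<times> 'b::euclidean_space \<Rightarrow> real"
  assumes "integrable lborel (\<lambda>w. indicator (U \<times> T) w * f w)"
  shows "(LINT t:T|lborel. LINT x:U|lborel. f (x, t)) = (\<integral>w. indicator (U \<times> T) w * f w \<partial>lborel)"
proof -
  let ?F = "\<lambda>w. indicator (U \<times> T) w * f w"
  have "(LINT t:T|lborel. LINT x:U|lborel. f (x, t)) = (\<integral>t. (\<integral>x. ?F (x, t) \<partial>lborel) \<partial>lborel)"
    unfolding set_lebesgue_integral_def
    by (intro Bochner_Integration.integral_cong refl) (auto simp: indicator_def if_distrib cong: if_cong)
  also have "\<dots> = integral\<^sup>L (lborel \<Otimes>\<^sub>M lborel) (\<lambda>(x, t). ?F (x, t))"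
    using assms by (intro lborel_pair.integral_snd) (simp add: lborel_prod case_prod_beta')
  finally show ?thesis by (simp add: lborel_prod case_prod_beta')
qed

lemma sum_scaleR_axis_nth: "(\<Sum>j\<in>UNIV. c j *\<^sub>R axis j (1::real)) $ k = c k"
proof -
  have "(\<Sum>j\<in>UNIV. c j *\<^sub>R axis j (1::real)) $ k = (\<Sum>j\<in>UNIV. if k = j then c j else 0)"
    unfolding sum_component by (intro sum.cong) (auto simp: axis_def)
  then show ?thesis by simp
qed

text \<open>Weak differentiability in space is known for almost every time only, so identities
  between slices are transferred to space-time in this form.\<close>

lemma AE_iterated_integral_eq:
  fixes f g :: "'a::euclidean_space \<times> 'b::euclidean_space \<Rightarrow> real"
  assumes "integrable lborel f" "integrable lborel g"
    and "AE t in lborel. (\<integral>x. f (x, t) \<partial>lborel) = (\<integral>x. g (x, t) \<partial>lborel)"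
  shows "integral\<^sup>L lborel f = integral\<^sup>L lborel g"
proof -
  have eq: "(\<integral>t. (\<integral>x. k (x, t) \<partial>lborel) \<partial>lborel) = integral\<^sup>L lborel k" "(\<lambda>t. \<integral>x. k (x, t) \<partial>lborel) \<in> borel_measurable lborel"
    if "integrable lborel k" for k :: "'a \<times> 'b \<Rightarrow> real"
    using lborel_pair.integral_snd[of "\<lambda>x t. k (x, t)"] lborel_pair.integrable_snd[of "\<lambda>x t. k (x, t)"] that
    by (auto simp: lborel_prod dest: borel_measurable_integrable)
  show ?thesis
    using integral_cong_AE[OF eq(2)[OF assms(1)] eq(2)[OF assms(2)] assms(3)] eq(1) assms by simp
qed

text \<open>Local integrability becomes integrability on \<open>U\<close> after multiplication by a
  bounded factor that lives on a compact set.\<close>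

lemma set_integrable_bounded_mult:
  fixes g :: "'a::euclidean_space \<Rightarrow> 'b::euclidean_space" and c :: "'a \<Rightarrow> real"
  assumes "set_integrable lborel K g" "K \<subseteq> U" "c \<in> borel_measurable borel" "\<And>x. \<bar>c x\<bar> \<le> L" "\<And>x. x \<notin> K \<Longrightarrow> c x = 0"
  shows "set_integrable lborel U (\<lambda>x. c x *\<^sub>R g x)"
proof -
  have K: "integrable lborel (\<lambda>x. indicator K x *\<^sub>R g x)" using assms(1) by (simp add: set_integrable_def)
  have [measurable]: "c \<in> borel_measurable borel" "(\<lambda>x. indicator K x *\<^sub>R g x) \<in> borel_measurable borel"
    using assms(3) K by (auto dest: borel_measurable_integrable)
  have "integrable lborel (\<lambda>x. c x *\<^sub>R (indicator K x *\<^sub>R g x))"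
  proof (rule Bochner_Integration.integrable_bound[of _ "\<lambda>x. L * norm (indicator K x *\<^sub>R g x)"])
    show "AE x in lborel. norm (c x *\<^sub>R (indicator K x *\<^sub>R g x)) \<le> norm (L * norm (indicator K x *\<^sub>R g x))"
    proof (rule AE_I2)
      fix x
      have "\<bar>c x\<bar> * norm (indicator K x *\<^sub>R g x) \<le> L * norm (indicator K x *\<^sub>R g x)"
        by (intro mult_right_mono assms(4)) simp
      then show "norm (c x *\<^sub>R (indicator K x *\<^sub>R g x)) \<le> norm (L * norm (indicator K x *\<^sub>R g x))"
        using abs_ge_self[of "L * norm (indicator K x *\<^sub>R g x)"] by (simp only: norm_scaleR[of "c x"] real_norm_def)
    qed
  qed (use integrable_norm[OF K] in \<open>simp, measurable\<close>)
  moreover have "(\<lambda>x. c x *\<^sub>R (indicator K x *\<^sub>R g x)) = (\<lambda>x. indicator U x *\<^sub>R (c x *\<^sub>R g x))"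
    using assms(2,5) by (intro ext) (auto simp: indicator_def)
  ultimately show ?thesis by (simp add: set_integrable_def)
qed

lemma set_integral_component:
  fixes f :: "'a::euclidean_space \<Rightarrow> real^'n"
  assumes "set_integrable lborel U f"
  shows "(LINT x:U|lborel. f x) $ i = (LINT x:U|lborel. f x $ i)"
proof -
  have "(LINT x:U|lborel. f x) $ i = (LINT x:U|lborel. f x) \<bullet> axis i 1"
    by (simp add: inner_axis)
  also have "\<dots> = (\<integral>x. (indicator U x *\<^sub>R f x) \<bullet> axis i 1 \<partial>lborel)"
    using assms unfolding set_lebesgue_integral_def set_integrable_def by (intro integral_inner_left[symmetric])
  also have "\<dots> = (LINT x:U|lborel. f x $ i)"
    unfolding set_lebesgue_integral_def by (simp add: inner_axis)
  finally show ?thesis .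
qed

section \<open>The mollified solution on a cylinder: gradient and equation\<close>

context
  fixes p :: real and U :: "(real^'n::finite) set" and s1 s2 :: real
    and h :: "'n spacetime \<Rightarrow> real" and G :: "'n spacetime \<Rightarrow> real^'n"
  assumes p: "1 < p" and U: "open U" and bdd: "bounded (U \<times> {s1<..<s2})"
    and sob: "parabolic_sobolev p U s1 s2 h G"
    and weak: "\<And>\<phi>. \<phi> \<in> test_functions (U \<times> {s1<..<s2}) \<Longrightarrow>
                (LINT t:{s1<..<s2}|lborel. LINT x:U|lborel.
                   (norm (G (x, t)) powr (p - 2) *\<^sub>R G (x, t)) \<bullet> grad (\<lambda>y. \<phi> (y, t)) x)
              - (LINT t:{s1<..<s2}|lborel. LINT x:U|lborel.
                   h (x, t) * deriv (\<lambda>s. \<phi> (x, s)) t) = 0"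
begin

lemma open_D: "open (U \<times> {s1<..<s2})" using U by (intro open_Times) auto

lemma cylinder_solution_integrable: "integrable lborel (\<lambda>w. indicator (U \<times> {s1<..<s2}) w * h w)"
  using set_integrable_powr_imp[OF open_D bdd, of p h] p sob
  by (simp add: parabolic_sobolev_def Lp_def set_integrable_def)

lemma cylinder_gradient_integrable: "integrable lborel (\<lambda>w. indicator (U \<times> {s1<..<s2}) w *\<^sub>R G w)"
  using set_integrable_powr_imp[OF open_D bdd, of p G] p sob
  by (simp add: parabolic_sobolev_def Lp_def set_integrable_def)

lemma cylinder_gradient_component_integrable: "integrable lborel (\<lambda>w. indicator (U \<times> {s1<..<s2}) w * G w $ i)"
proof -
  have "integrable lborel (\<lambda>w. (indicator (U \<times> {s1<..<s2}) w *\<^sub>R G w) \<bullet> axis i 1)"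
    using cylinder_gradient_integrable by (rule integrable_inner_left)
  then show ?thesis by (simp add: inner_axis)
qed

lemma cylinder_energy_integrable: "integrable lborel (\<lambda>w. indicator (U \<times> {s1<..<s2}) w * norm (G w) powr p)"
  using sob by (simp add: parabolic_sobolev_def Lp_def set_integrable_def)

text \<open>The flux is bounded by \<open>|G| powr (p - 1)\<close>, hence by
  \<open>1 + |G| powr p\<close>, which is integrable because the cylinder is bounded.\<close>

lemma cylinder_flux_integrable:
  "integrable lborel (\<lambda>w. indicator (U \<times> {s1<..<s2}) w * (norm (G w) powr (p - 2) * G w $ i))"
proof -
  let ?g = "\<lambda>w. indicator (U \<times> {s1<..<s2}) w *\<^sub>R G w"
  have [measurable]: "?g \<in> borel_measurable borel"
    using cylinder_gradient_integrable by (auto dest: borel_measurable_integrable)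
  have [measurable]: "(\<lambda>w. ?g w \<bullet> axis i 1) \<in> borel_measurable borel" by measurable
  \<comment> \<open>Measurability of \<open>G\<close> is known only after multiplication by the
    indicator, so the truncated flux is rewritten through the truncated gradient. Off the cylinder
    both sides are 0 because the inner product vanishes.\<close>
  have eq: "norm (?g w) powr (p - 2) * (?g w \<bullet> axis i 1) = indicator (U \<times> {s1<..<s2}) w * (norm (G w) powr (p - 2) * G w $ i)" for w
    by (cases "w \<in> (U \<times> {s1<..<s2})") (auto simp: inner_axis)
  have "(\<lambda>w. norm (?g w) powr (p - 2) * (?g w \<bullet> axis i 1)) \<in> borel_measurable borel"
    by measurable
  then have m: "(\<lambda>w. indicator (U \<times> {s1<..<s2}) w * (norm (G w) powr (p - 2) * G w $ i)) \<in> borel_measurable borel"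
    unfolding eq .
  have "emeasure lborel (U \<times> {s1<..<s2}) < \<infinity>" using emeasure_bounded_finite[OF bdd] by simp
  then have "integrable lborel (\<lambda>w. indicator (U \<times> {s1<..<s2}) w + indicator (U \<times> {s1<..<s2}) w * norm (G w) powr p :: real)"
    using open_D cylinder_energy_integrable by (intro Bochner_Integration.integrable_add) (auto simp: integrable_indicator_iff)
  then show ?thesis
  proof (rule Bochner_Integration.integrable_bound)
    show "AE w in lborel. norm (indicator (U \<times> {s1<..<s2}) w * (norm (G w) powr (p - 2) * G w $ i))
        \<le> norm (indicator (U \<times> {s1<..<s2}) w + indicator (U \<times> {s1<..<s2}) w * norm (G w) powr p :: real)"
    proof (rule AE_I2)
      fix w
      have "norm (G w) powr (p - 2) * \<bar>G w $ i\<bar> \<le> norm (G w) powr (p - 2) * norm (G w)"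
        by (intro mult_left_mono component_le_norm_cart) auto
      also have "\<dots> = norm (G w) powr (p - 1)"
        by (cases "G w = 0") (auto simp: powr_mult_base[of "norm (G w)" "p - 2"] mult.commute)
      also have "\<dots> \<le> 1 + norm (G w) powr p" using p by (intro le_one_plus_powr) auto
      finally have "norm (G w) powr (p - 2) * \<bar>G w $ i\<bar> \<le> 1 + norm (G w) powr p" .
      then show "norm (indicator (U \<times> {s1<..<s2}) w * (norm (G w) powr (p - 2) * G w $ i))
        \<le> norm (indicator (U \<times> {s1<..<s2}) w + indicator (U \<times> {s1<..<s2}) w * norm (G w) powr p :: real)"
        by (auto simp: indicator_def abs_mult)
    qed
  qed (use m in auto)
qed

text \<open>For almost every time the kernel slice is a test function for the weak gradient.
  Differentiating \<open>\<rho> (z - w)\<close> in \<open>w\<close> gives a minus sign, which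
  cancels the one in the definition of the weak gradient. The ball condition keeps the kernel inside
  the cylinder.\<close>

lemma mollified_gradient:
  assumes \<rho>: "mollifier \<epsilon> \<rho>" and z: "cball z \<epsilon> \<subseteq> (U \<times> {s1<..<s2})"
  shows "conv (\<lambda>w. frechet_derivative \<rho> (at w) (space_dir i)) (\<lambda>w. indicator (U \<times> {s1<..<s2}) w * h w) z
       = conv \<rho> (\<lambda>w. indicator (U \<times> {s1<..<s2}) w * G w $ i) z"
  unfolding conv_def
proof (rule AE_iterated_integral_eq)
  show "integrable lborel (\<lambda>w. frechet_derivative \<rho> (at (z - w)) (space_dir i) * (indicator (U \<times> {s1<..<s2}) w * h w))"
    by (rule mollifier_conv(5)[OF \<rho> cylinder_solution_integrable space_dir_Basis])
  show "integrable lborel (\<lambda>w. \<rho> (z - w) * (indicator (U \<times> {s1<..<s2}) w * G w $ i))"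
    by (rule mollifier_conv(4)[OF \<rho> cylinder_gradient_component_integrable])
  have "AE t in lborel. t \<in> {s1<..<s2} \<longrightarrow> weak_gradient U (\<lambda>x. h (x, t)) (\<lambda>x. G (x, t))"
    using sob unfolding parabolic_sobolev_def by (auto elim: eventually_mono)
  then show "AE t in lborel.
      (\<integral>x. frechet_derivative \<rho> (at (z - (x, t))) (space_dir i) * (indicator (U \<times> {s1<..<s2}) (x, t) * h (x, t)) \<partial>lborel)
    = (\<integral>x. \<rho> (z - (x, t)) * (indicator (U \<times> {s1<..<s2}) (x, t) * G (x, t) $ i) \<partial>lborel)"
  proof (rule eventually_mono)
    fix t assume wg: "t \<in> {s1<..<s2} \<longrightarrow> weak_gradient U (\<lambda>x. h (x, t)) (\<lambda>x. G (x, t))"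
    show "(\<integral>x. frechet_derivative \<rho> (at (z - (x, t))) (space_dir i) * (indicator (U \<times> {s1<..<s2}) (x, t) * h (x, t)) \<partial>lborel)
      = (\<integral>x. \<rho> (z - (x, t)) * (indicator (U \<times> {s1<..<s2}) (x, t) * G (x, t) $ i) \<partial>lborel)"
    proof (cases "t \<in> {s1<..<s2}")
      case True
      let ?\<psi> = "\<lambda>x. \<rho> (z - (x, t))" and ?K = "{x. (x, t) \<in> cball z \<epsilon>}"
      note K = slice_kernel_support[OF \<rho> z True]
      have \<psi>: "?\<psi> \<in> test_functions U" by (rule mollifier_slice_test_function[OF \<rho> z True])
      then have eq: "(LINT x:U|lborel. h (x, t) *\<^sub>R grad ?\<psi> x) = - (LINT x:U|lborel. ?\<psi> x *\<^sub>R G (x, t))"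
        and hi: "set_integrable lborel ?K (\<lambda>x. h (x, t))" and Gi: "set_integrable lborel ?K (\<lambda>x. G (x, t))"
        using wg True K(1,2) unfolding weak_gradient_def by blast+
      obtain L where L: "\<And>w. \<bar>\<rho> w\<bar> \<le> L" using mollifier_bounded[OF \<rho>] by blast
      have c1: "continuous_on UNIV (\<lambda>x. z - (x, t))" by (intro continuous_intros)
      have m1: "?\<psi> \<in> borel_measurable borel"
        using mollifier_measurable[OF \<rho>] borel_measurable_continuous_onI[OF c1] by (rule measurable_compose[rotated])
      have i1: "set_integrable lborel U (\<lambda>x. ?\<psi> x *\<^sub>R G (x, t))"
        by (rule set_integrable_bounded_mult[OF Gi K(2) m1 L]) (use K(3) in blast)
      have g: "h (x, t) *\<^sub>R grad ?\<psi> x = (\<chi> i. h (x, t) * - frechet_derivative \<rho> (at (z - (x, t))) (space_dir i))" for x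
        by (simp add: vec_eq_iff mollifier_slice_grad[OF \<rho>])
      \<comment> \<open>Integrability of a vector field is assembled from its components; only then
        may a component be taken out of the integral.\<close>
      have i2: "set_integrable lborel U (\<lambda>x. h (x, t) *\<^sub>R grad ?\<psi> x)"
      proof -
        have "set_integrable lborel U (\<lambda>x. (- frechet_derivative \<rho> (at (z - (x, t))) (space_dir j)) *\<^sub>R h (x, t))" for j
        proof -
          obtain L' where L': "\<And>w. \<bar>- frechet_derivative \<rho> (at w) (space_dir j)\<bar> \<le> L'"
            using mollifier_partial(3)[OF \<rho> space_dir_Basis] by (metis abs_minus_cancel)
          have "continuous_on UNIV (\<lambda>x. - frechet_derivative \<rho> (at (z - (x, t))) (space_dir j))"
            by (intro continuous_intros continuous_on_compose2[OF mollifier_partial(2)[OF \<rho> space_dir_Basis]]) auto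
          then show ?thesis
          proof (intro set_integrable_bounded_mult[OF hi K(2) borel_measurable_continuous_onI L'])
            fix x assume x: "x \<notin> ?K"
            have "\<epsilon> < norm (z - (x, t))" using x by (simp add: dist_norm)
            then show "- frechet_derivative \<rho> (at (z - (x, t))) (space_dir j) = 0"
              by (simp only: mollifier_partial_eq_0[OF \<rho>] neg_equal_zero minus_zero)
          qed auto
        qed
        then have "integrable lborel (\<lambda>x. \<Sum>j\<in>UNIV. (indicator U x *\<^sub>R ((- frechet_derivative \<rho> (at (z - (x, t))) (space_dir j)) *\<^sub>R h (x, t))) *\<^sub>R axis j (1::real))"
          unfolding set_integrable_def by (intro Bochner_Integration.integrable_sum integrable_scaleR_left)
        moreover have "(\<Sum>j\<in>UNIV. (indicator U x *\<^sub>R ((- frechet_derivative \<rho> (at (z - (x, t))) (space_dir j)) *\<^sub>R h (x, t))) *\<^sub>R axis j (1::real))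
          = indicator U x *\<^sub>R (h (x, t) *\<^sub>R grad ?\<psi> x)" for x
          unfolding g vec_eq_iff sum_scaleR_axis_nth by simp
        ultimately show ?thesis by (simp add: set_integrable_def)
      qed
      have "(LINT x:U|lborel. h (x, t) *\<^sub>R grad ?\<psi> x) $ i = - (LINT x:U|lborel. ?\<psi> x *\<^sub>R G (x, t)) $ i"
        using eq by simp
      then have e: "(LINT x:U|lborel. h (x, t) * - frechet_derivative \<rho> (at (z - (x, t))) (space_dir i))
          = - (LINT x:U|lborel. ?\<psi> x * G (x, t) $ i)"
        unfolding set_integral_component[OF i1] set_integral_component[OF i2]
        by (simp add: mollifier_slice_grad[OF \<rho>])
      have "(\<integral>x. frechet_derivative \<rho> (at (z - (x, t))) (space_dir i) * (indicator (U \<times> {s1<..<s2}) (x, t) * h (x, t)) \<partial>lborel)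
        = - (LINT x:U|lborel. h (x, t) * - frechet_derivative \<rho> (at (z - (x, t))) (space_dir i))"
        unfolding set_lebesgue_integral_def integral_minus[symmetric]
        using True by (intro Bochner_Integration.integral_cong) (auto simp: indicator_def)
      also have "\<dots> = (LINT x:U|lborel. ?\<psi> x * G (x, t) $ i)" unfolding e by simp
      also have "\<dots> = (\<integral>x. \<rho> (z - (x, t)) * (indicator (U \<times> {s1<..<s2}) (x, t) * G (x, t) $ i) \<partial>lborel)"
        unfolding set_lebesgue_integral_def
        using True by (intro Bochner_Integration.integral_cong) (auto simp: indicator_def)
      finally show ?thesis .
    qed simp
  qed
qed

text \<open>The weak equation tested with \<open>\<rho> (z - w)\<close>: the mollified flux has the
  time derivative of the mollified solution as its divergence, in the classical sense. This flux is
  the mollification of a nonlinear expression, not the flux of the mollified gradient.\<close>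

lemma mollified_equation:
  assumes \<rho>: "mollifier \<epsilon> \<rho>" and z: "cball z \<epsilon> \<subseteq> (U \<times> {s1<..<s2})"
  shows "(\<Sum>i\<in>UNIV. conv (\<lambda>w. frechet_derivative \<rho> (at w) (space_dir i))
            (\<lambda>w. indicator (U \<times> {s1<..<s2}) w * (norm (G w) powr (p - 2) * G w $ i)) z)
       = conv (\<lambda>w. frechet_derivative \<rho> (at w) time_dir) (\<lambda>w. indicator (U \<times> {s1<..<s2}) w * h w) z"
proof -
  let ?\<phi> = "\<lambda>w. \<rho> (z - w)"
  let ?A = "\<lambda>w. \<Sum>i\<in>UNIV. (norm (G w) powr (p - 2) * G w $ i) * - frechet_derivative \<rho> (at (z - w)) (space_dir i)"
  let ?B = "\<lambda>w. h w * - frechet_derivative \<rho> (at (z - w)) time_dir"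
  have iA: "integrable lborel (\<lambda>w. frechet_derivative \<rho> (at (z - w)) (space_dir i) *
      (indicator (U \<times> {s1<..<s2}) w * (norm (G w) powr (p - 2) * G w $ i)))" for i
    by (rule mollifier_conv(5)[OF \<rho> cylinder_flux_integrable space_dir_Basis])
  have iB: "integrable lborel (\<lambda>w. frechet_derivative \<rho> (at (z - w)) time_dir * (indicator (U \<times> {s1<..<s2}) w * h w))"
    by (rule mollifier_conv(5)[OF \<rho> cylinder_solution_integrable time_dir_Basis])
  have eA: "indicator (U \<times> {s1<..<s2}) w * ?A w = - (\<Sum>i\<in>UNIV. frechet_derivative \<rho> (at (z - w)) (space_dir i) *
      (indicator (U \<times> {s1<..<s2}) w * (norm (G w) powr (p - 2) * G w $ i)))" for w
    by (simp add: sum_distrib_left sum_negf algebra_simps)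
  have eB: "indicator (U \<times> {s1<..<s2}) w * ?B w = - (frechet_derivative \<rho> (at (z - w)) time_dir * (indicator (U \<times> {s1<..<s2}) w * h w))" for w
    by simp
  have "(LINT t:{s1<..<s2}|lborel. LINT x:U|lborel.
             (norm (G (x, t)) powr (p - 2) *\<^sub>R G (x, t)) \<bullet> grad (\<lambda>y. ?\<phi> (y, t)) x)
      = (LINT t:{s1<..<s2}|lborel. LINT x:U|lborel. ?A (x, t))"
    by (simp add: inner_vec_def mollifier_slice_grad[OF \<rho>])
  also have "\<dots> = (\<integral>w. indicator (U \<times> {s1<..<s2}) w * ?A w \<partial>lborel)"
    by (rule set_integral_iterated) (use iA in \<open>simp only: eA, intro integrable_minus Bochner_Integration.integrable_sum, simp\<close>)
  also have "\<dots> = - (\<Sum>i\<in>UNIV. conv (\<lambda>w. frechet_derivative \<rho> (at w) (space_dir i))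
            (\<lambda>w. indicator (U \<times> {s1<..<s2}) w * (norm (G w) powr (p - 2) * G w $ i)) z)"
    unfolding eA conv_def using iA by (simp only: integral_minus Bochner_Integration.integral_sum)
  finally have 1: "(LINT t:{s1<..<s2}|lborel. LINT x:U|lborel.
             (norm (G (x, t)) powr (p - 2) *\<^sub>R G (x, t)) \<bullet> grad (\<lambda>y. ?\<phi> (y, t)) x) = \<dots>" .
  have "(LINT t:{s1<..<s2}|lborel. LINT x:U|lborel. h (x, t) * deriv (\<lambda>s. ?\<phi> (x, s)) t)
      = (LINT t:{s1<..<s2}|lborel. LINT x:U|lborel. ?B (x, t))"
    by (simp add: mollifier_slice_deriv[OF \<rho>])
  also have "\<dots> = (\<integral>w. indicator (U \<times> {s1<..<s2}) w * ?B w \<partial>lborel)"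
    by (rule set_integral_iterated) (use iB in \<open>simp only: eB, intro integrable_minus, simp\<close>)
  also have "\<dots> = - conv (\<lambda>w. frechet_derivative \<rho> (at w) time_dir) (\<lambda>w. indicator (U \<times> {s1<..<s2}) w * h w) z"
    unfolding eB conv_def by (simp only: integral_minus)
  finally show ?thesis
    using weak[OF mollifier_test_function[OF \<rho> z]] 1 by simp
qed

end

section \<open>Comparison of weak solutions with classical supersolutions\<close>

text \<open>From exponent 2 on, powers of the positive part are differentiable at 0 as well. The
  energy estimate uses the square and the cube.\<close>

lemma DERIV_max_0_power:
  "((\<lambda>s::real. (max 0 s) ^ (k + 2)) has_real_derivative real (k + 2) * (max 0 s) ^ (k + 1)) (at s)"
proof -
  consider "s > 0" | "s < 0" | "s = 0" by linarith
  then show ?thesis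
  proof cases
    case 1
    have "((\<lambda>s::real. s ^ (k + 2)) has_real_derivative real (k + 2) * (max 0 s) ^ (k + 1)) (at s)"
      using DERIV_pow[of "k + 2" s] 1 by simp
    then show ?thesis
      by (rule DERIV_cong_ev[THEN iffD1, rotated -1])
        (use 1 in \<open>auto intro!: eventually_mono[OF eventually_nhds_in_open[of "{0<..}"]]\<close>)
  next
    case 2
    have "((\<lambda>s::real. 0) has_real_derivative real (k + 2) * (max 0 s) ^ (k + 1)) (at s)"
      using 2 by auto
    then show ?thesis
      by (rule DERIV_cong_ev[THEN iffD1, rotated -1])
        (use 2 in \<open>auto intro!: eventually_mono[OF eventually_nhds_in_open[of "{..<0}"]]\<close>)
  next
    case 3
    have "((\<lambda>h::real. (max 0 h) ^ (k + 1)) \<longlongrightarrow> (max 0 0) ^ (k + 1)) (at 0)"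
      by (intro tendsto_intros)
    then have "((\<lambda>h::real. (max 0 h) ^ (k + 1)) \<longlongrightarrow> 0) (at 0)" by simp
    then have "((\<lambda>h::real. (max 0 h) ^ (k + 2) / h) \<longlongrightarrow> 0) (at 0)"
      by (rule Lim_transform_eventually) (auto simp: eventually_at_filter max_def)
    then show ?thesis using 3 by (simp add: DERIV_def)
  qed
qed

lemma glued_continuous:
  fixes g :: "'a::euclidean_space \<Rightarrow> real"
  assumes "open P" "compact K" "K \<subseteq> P" "continuous_on P g" "\<And>z. z \<in> P - K \<Longrightarrow> g z = 0"
  shows "continuous_on UNIV (\<lambda>z. indicator K z * g z)"
proof -
  have "continuous_on (P \<union> - K) (\<lambda>z. indicator K z * g z)"
  proof (rule continuous_on_open_Un)
    show "continuous_on P (\<lambda>z. indicator K z * g z)"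
      using assms(4) by (rule continuous_on_eq) (use assms(5) in \<open>auto simp: indicator_def\<close>)
    show "continuous_on (- K) (\<lambda>z. indicator K z * g z)"
      by (rule continuous_on_eq[of _ "\<lambda>_. 0"]) (auto simp: indicator_def)
  qed (use assms in \<open>auto simp: compact_imp_closed open_Compl\<close>)
  moreover have "P \<union> - K = UNIV" using assms(3) by auto
  ultimately show ?thesis by simp
qed

text \<open>Integration by parts for a function defined on an open set only: as it vanishes off a
  compact subset, its extension by 0 is differentiable everywhere in the given direction.\<close>

lemma integral_partial_glued:
  fixes f g :: "'a::euclidean_space \<Rightarrow> real"
  assumes "open P" "compact K" "K \<subseteq> P" "continuous_on P f" "continuous_on P g"
    and "\<And>z. z \<in> P - K \<Longrightarrow> f z = 0" "\<And>z. z \<in> P \<Longrightarrow> has_partial f e (g z) z"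
  shows "(\<integral>z. indicator K z * g z \<partial>lborel) = 0"
proof -
  have PK: "open (P - K)" "open (- K)" using assms by (auto simp: compact_imp_closed open_Diff open_Compl)
  have g0: "g z = 0" if "z \<in> P - K" for z
    using that assms(6) by (intro has_partial_zeroD[OF assms(7) PK(1) that]) auto
  show ?thesis
  proof (rule integral_partial_eq_0[where f="\<lambda>z. indicator K z * f z" and K=K and e=e])
    fix z
    show "has_partial (\<lambda>z. indicator K z * f z) e (indicator K z * g z) z"
    proof (cases "z \<in> P")
      case True
      have "has_partial (\<lambda>z. indicator K z * f z) e (g z) z"
        by (rule has_partial_local[OF assms(7)[OF True] assms(1) True]) (use assms(6) in \<open>auto simp: indicator_def\<close>)
      moreover have "indicator K z * g z = g z" using g0[of z] True by (auto simp: indicator_def)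
      ultimately show ?thesis by (simp only:)
    next
      case False
      then have z: "z \<in> - K" using assms(3) by auto
      have "has_partial (\<lambda>_. 0) e 0 z" by (simp add: has_partial_def)
      then have "has_partial (\<lambda>z. indicator K z * f z) e 0 z"
        by (rule has_partial_local[OF _ PK(2) z]) auto
      then show ?thesis using z by simp
    qed
  qed (use glued_continuous[OF assms(1-4)] glued_continuous[OF assms(1-3,5)] g0 assms(2,6) in auto)
qed

section \<open>Bounds and limits for mollified functions\<close>

lemma conv_abs_bound:
  assumes "mollifier \<epsilon> \<rho>" "integrable lborel f" "integrable lborel s" "\<And>w. \<bar>f w\<bar> \<le> c + s w"
  shows "\<bar>conv \<rho> f z\<bar> \<le> c + conv \<rho> s z"
proof -
  obtain L where L: "\<And>w. \<bar>\<rho> w\<bar> \<le> L" using mollifier_bounded[OF assms(1)] by blast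
  have \<rho>0: "\<rho> w \<ge> 0" for w using assms(1) unfolding mollifier_def by blast
  have i: "integrable lborel (\<lambda>w. \<rho> (z - w) * k w)" if "integrable lborel k" for k
    by (rule conv_kernel_integrable[OF that mollifier_measurable[OF assms(1)] L])
  have "\<bar>conv \<rho> f z\<bar> \<le> (\<integral>w. \<bar>\<rho> (z - w) * f w\<bar> \<partial>lborel)"
    unfolding conv_def by (rule integral_abs_bound)
  also have "\<dots> \<le> (\<integral>w. \<rho> (z - w) * c + \<rho> (z - w) * s w \<partial>lborel)"
  proof (rule integral_mono)
    show "integrable lborel (\<lambda>w. \<bar>\<rho> (z - w) * f w\<bar>)" using i[OF assms(2)] by simp
    show "integrable lborel (\<lambda>w. \<rho> (z - w) * c + \<rho> (z - w) * s w)"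
      using i[OF assms(3)] mollifier_integral(1)[OF assms(1), of z] by simp
    fix w
    have "\<rho> (z - w) * \<bar>f w\<bar> \<le> \<rho> (z - w) * (c + s w)" by (intro mult_left_mono assms(4) \<rho>0)
    then show "\<bar>\<rho> (z - w) * f w\<bar> \<le> \<rho> (z - w) * c + \<rho> (z - w) * s w"
      using \<rho>0 by (simp add: abs_mult algebra_simps)
  qed
  also have "\<dots> = (\<integral>w. \<rho> (z - w) \<partial>lborel) * c + conv \<rho> s z"
    unfolding conv_def using i[OF assms(3)] mollifier_integral(1)[OF assms(1), of z]
    by (subst Bochner_Integration.integral_add) auto
  finally show ?thesis using mollifier_integral(2)[OF assms(1)] by simp
qed

text \<open>A pointwise bound on \<open>f * g\<close> says nothing about the product of the two
  mollifications, which pairs values at different points. The inequality in two variables is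
  therefore integrated against the kernel twice. It serves for gradient times flux, where each
  factor alone is only controlled with its own exponent.\<close>

lemma conv_product_bound:
  assumes \<rho>: "mollifier \<epsilon> \<rho>" and i: "integrable lborel f" "integrable lborel g" "integrable lborel s"
    and b: "\<And>w w'. \<bar>f w * g w'\<bar> \<le> s w + s w'"
  shows "\<bar>conv \<rho> f z * conv \<rho> g z\<bar> \<le> 2 * conv \<rho> s z"
proof -
  have scale: "conv \<rho> (\<lambda>w. c * k w) z = c * conv \<rho> k z" for c and k :: "'a \<Rightarrow> real"
    unfolding conv_def by (simp add: mult.left_commute)
  have 1: "\<bar>f w * conv \<rho> g z\<bar> \<le> s w + conv \<rho> s z" for w
    using conv_abs_bound[OF \<rho> _ i(3), of "\<lambda>w'. f w * g w'" "s w" z] i(2) b scale by simp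
  have "\<bar>conv \<rho> (\<lambda>w. conv \<rho> g z * f w) z\<bar> \<le> conv \<rho> s z + conv \<rho> s z"
    by (rule conv_abs_bound[OF \<rho> _ i(3)]) (use i(1) 1 in \<open>auto simp: mult.commute[of "conv \<rho> g z"] add.commute[of "conv \<rho> s z"]\<close>)
  then show ?thesis unfolding scale by (simp add: mult.commute)
qed

lemma conv_uniform_approx:
  assumes \<rho>: "mollifier \<epsilon> \<rho>" and f: "integrable lborel f" and c: "\<And>w. dist z w < \<epsilon> \<Longrightarrow> \<bar>f w - f z\<bar> \<le> \<eta>"
  shows "\<bar>conv \<rho> f z - f z\<bar> \<le> \<eta>"
proof -
  obtain L where L: "\<And>w. \<bar>\<rho> w\<bar> \<le> L" using mollifier_bounded[OF \<rho>] by blast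
  have \<rho>0: "\<rho> w \<ge> 0" for w using \<rho> unfolding mollifier_def by blast
  have i1: "integrable lborel (\<lambda>w. \<rho> (z - w) * f w)"
    by (rule conv_kernel_integrable[OF f mollifier_measurable[OF \<rho>] L])
  have i2: "integrable lborel (\<lambda>w. \<rho> (z - w) * k)" for k
    using mollifier_integral(1)[OF \<rho>] by simp
  have "conv \<rho> f z - f z = (\<integral>w. \<rho> (z - w) * f w - \<rho> (z - w) * f z \<partial>lborel)"
    using Bochner_Integration.integral_diff[OF i1 i2] mollifier_integral(2)[OF \<rho>, of z]
    by (simp add: conv_def)
  then have "\<bar>conv \<rho> f z - f z\<bar> \<le> (\<integral>w. \<bar>\<rho> (z - w) * f w - \<rho> (z - w) * f z\<bar> \<partial>lborel)"
    using integral_abs_bound by metis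
  also have "\<dots> \<le> (\<integral>w. \<rho> (z - w) * \<eta> \<partial>lborel)"
  proof (rule integral_mono)
    fix w
    show "\<bar>\<rho> (z - w) * f w - \<rho> (z - w) * f z\<bar> \<le> \<rho> (z - w) * \<eta>"
    proof (cases "\<rho> (z - w) = 0")
      case False
      then have "dist z w < \<epsilon>" using \<rho> unfolding mollifier_def dist_norm by blast
      then have "\<rho> (z - w) * \<bar>f w - f z\<bar> \<le> \<rho> (z - w) * \<eta>" by (intro mult_left_mono c \<rho>0)
      moreover have "\<rho> (z - w) * f w - \<rho> (z - w) * f z = \<rho> (z - w) * (f w - f z)" by (simp add: algebra_simps)
      ultimately show ?thesis using \<rho>0 by (simp add: abs_mult)
    qed simp
  qed (use i1 i2 in auto)
  also have "\<dots> = \<eta>" using mollifier_integral(2)[OF \<rho>, of z] by simp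
  finally show ?thesis .
qed

lemma open_shrink:
  fixes A S :: "'a::euclidean_space set"
  assumes A: "compact A" "open S" "A \<subseteq> S"
  shows "\<exists>U. open U \<and> A \<subseteq> U \<and> closure U \<subseteq> S \<and> compact (closure U)"
proof -
  obtain e where e: "e > 0" "(\<Union>x\<in>A. cball x e) \<subseteq> S"
    using compact_subset_open_imp_cball_epsilon_subset[OF A] by blast
  have "compact {x + y |x y. x \<in> A \<and> y \<in> cball 0 e}" using A by (intro compact_sums) auto
  moreover have "(\<Union>x\<in>A. ball x e) \<subseteq> {x + y |x y. x \<in> A \<and> y \<in> cball 0 e}"
  proof
    fix w assume "w \<in> (\<Union>x\<in>A. ball x e)"
    then obtain x where "x \<in> A" "dist x w < e" by auto
    then show "w \<in> {x + y |x y. x \<in> A \<and> y \<in> cball 0 e}"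
      by (intro CollectI exI[of _ x] exI[of _ "w - x"]) (auto simp: dist_norm norm_minus_commute)
  qed
  ultimately have c: "closure (\<Union>x\<in>A. ball x e) \<subseteq> {x + y |x y. x \<in> A \<and> y \<in> cball 0 e}"
    by (intro closure_minimal compact_imp_closed)
  moreover have "{x + y |x y. x \<in> A \<and> y \<in> cball 0 e} \<subseteq> S"
  proof clarify
    fix x y :: 'a assume "x \<in> A" "y \<in> cball 0 e"
    then have "x + y \<in> cball x e" by (simp add: dist_norm)
    then show "x + y \<in> S" using e(2) \<open>x \<in> A\<close> by blast
  qed
  moreover have "compact (closure (\<Union>x\<in>A. ball x e))"
    using c \<open>compact {x + y |x y. x \<in> A \<and> y \<in> cball 0 e}\<close>
    by (meson bounded_subset closed_closure compact_eq_bounded_closed)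
  ultimately show ?thesis using e(1)
    by (intro exI[of _ "\<Union>x\<in>A. ball x e"]) (auto intro!: open_UN)
qed

text \<open>The weak equation is available on compactly contained cylinders only; this supplies one
  around a given compact set.\<close>

lemma compact_subset_cylinder:
  fixes K :: "('a::euclidean_space \<times> real) set"
  assumes "compact K" "open Q" "K \<subseteq> Q \<times> {t1<..<t2}"
  obtains U s1 s2 where "open U" "s1 < s2" "compactly_contained (U \<times> {s1<..<s2}) (Q \<times> {t1<..<t2})"
    "K \<subseteq> U \<times> {s1<..<s2}"
proof -
  have "compact (fst ` K)" "compact (snd ` K)"
    using assms(1) by (auto intro!: compact_continuous_image continuous_intros)
  moreover have "fst ` K \<subseteq> Q" "snd ` K \<subseteq> {t1<..<t2}" using assms(3) by auto
  ultimately obtain U where U: "open U" "fst ` K \<subseteq> U" "closure U \<subseteq> Q" "compact (closure U)"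
    using open_shrink[of "fst ` K" Q] assms(2) by metis
  show thesis
  proof (cases "K = {}")
    case True
    \<comment> \<open>With \<open>K\<close> empty there are no extreme times from which to build
      \<open>s1 < s2\<close>; any proper time interval over the empty set will do.\<close>
    show ?thesis by (rule that[of "{}" 0 1]) (auto simp: True compactly_contained_def)
  next
    case False
    have ne: "snd ` K \<noteq> {}" using False by simp
    obtain m where m: "m \<in> snd ` K" "\<And>t. t \<in> snd ` K \<Longrightarrow> m \<le> t"
      using compact_attains_inf[OF \<open>compact (snd ` K)\<close> ne] by blast
    obtain M where M: "M \<in> snd ` K" "\<And>t. t \<in> snd ` K \<Longrightarrow> t \<le> M"
      using compact_attains_sup[OF \<open>compact (snd ` K)\<close> ne] by blast
    have mM: "t1 < m" "M < t2" "m \<le> M" using m M \<open>snd ` K \<subseteq> {t1<..<t2}\<close> by auto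
    let ?s1 = "(t1 + m) / 2" and ?s2 = "(M + t2) / 2"
    have lt: "t1 < ?s1" "?s1 < m" "M < ?s2" "?s2 < t2" using mM by auto
    have cl: "closure {?s1<..<?s2} = {?s1..?s2}" using lt mM by (intro closure_greaterThanLessThan) auto
    show ?thesis
    proof (rule that)
      show "open U" by fact
      show "?s1 < ?s2" using lt mM by auto
      show "compactly_contained (U \<times> {?s1<..<?s2}) (Q \<times> {t1<..<t2})"
        unfolding compactly_contained_def closure_Times cl
        using U lt by (auto intro!: compact_Times)
      show "K \<subseteq> U \<times> {?s1<..<?s2}"
      proof
        fix z assume "z \<in> K"
        then have "fst z \<in> U" "m \<le> snd z" "snd z \<le> M" using U(2) m M by auto
        then show "z \<in> U \<times> {?s1<..<?s2}" using lt by (auto simp: mem_Times_iff)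
      qed
    qed
  qed
qed

text \<open>The Cauchy-Schwarz inequality bounds the expression below by its scalar analogue in
  \<open>norm a\<close> and \<open>norm b\<close>, and \<open>s powr (p - 1)\<close> is
  nondecreasing for \<open>s \<ge> 0\<close>.\<close>

lemma flux_monotone:
  fixes a b :: "'a::real_inner"
  assumes "1 < p"
  shows "0 \<le> (a - b) \<bullet> (norm a powr (p - 2) *\<^sub>R a - norm b powr (p - 2) *\<^sub>R b)"
proof -
  have pw: "norm x powr (p - 2) * norm x = norm x powr (p - 1)" for x :: 'a
    by (cases "x = 0") (auto simp: powr_mult_base[of "norm x" "p - 2"] mult.commute)
  have "0 \<le> (norm a - norm b) * (norm a powr (p - 1) - norm b powr (p - 1))"
  proof (cases "norm b \<le> norm a")
    case True
    then show ?thesis using assms by (intro mult_nonneg_nonneg) (auto intro: powr_mono2)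
  next
    case False
    then have "norm a powr (p - 1) \<le> norm b powr (p - 1)" using assms by (intro powr_mono2) auto
    then show ?thesis using False by (intro mult_nonpos_nonpos) auto
  qed
  also have "\<dots> = (norm a powr (p - 2) * norm a) * norm a + (norm b powr (p - 2) * norm b) * norm b
      - norm a powr (p - 2) * (norm a * norm b) - norm b powr (p - 2) * (norm a * norm b)"
    unfolding pw[symmetric] by (simp add: algebra_simps)
  also have "\<dots> \<le> (norm a powr (p - 2) * norm a) * norm a + (norm b powr (p - 2) * norm b) * norm b
      - norm a powr (p - 2) * (a \<bullet> b) - norm b powr (p - 2) * (a \<bullet> b)"
    using mult_left_mono[OF norm_cauchy_schwarz[of a b], of "norm a powr (p - 2)"]
      mult_left_mono[OF norm_cauchy_schwarz[of a b], of "norm b powr (p - 2)"] by simp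
  also have "\<dots> = (a - b) \<bullet> (norm a powr (p - 2) *\<^sub>R a - norm b powr (p - 2) *\<^sub>R b)"
    by (simp add: inner_diff_left inner_diff_right inner_commute dot_square_norm power2_eq_square algebra_simps)
  finally show ?thesis .
qed

text \<open>A crude form of Young's inequality: both factors are bounded through the larger of the
  two numbers.\<close>

lemma powr_product_bound:
  fixes a b p :: real
  assumes "0 \<le> a" "0 \<le> b" "1 < p"
  shows "a * b powr (p - 1) \<le> a powr p + b powr p"
proof -
  define m where "m = max a b"
  have "a * b powr (p - 1) \<le> m * m powr (p - 1)"
    using assms by (intro mult_mono powr_mono2) (auto simp: m_def)
  also have "\<dots> = m powr p"
    using powr_mult_base[of m "p - 1"] assms by (simp add: m_def)
  also have "\<dots> \<le> a powr p + b powr p" by (simp add: m_def max_def)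
  finally show ?thesis .
qed

lemma mollifier_sequence_L1:
  fixes f :: "'a::euclidean_space \<Rightarrow> real"
  assumes \<rho>: "\<And>n. mollifier (inverse (real (Suc n))) (\<rho> n)" and f: "integrable lborel f"
  shows "integrable lborel (\<lambda>z. conv (\<rho> n) f z - f z)"
    "(\<lambda>n. \<integral>z. \<bar>conv (\<rho> n) f z - f z\<bar> \<partial>lborel) \<longlonglongrightarrow> 0"
proof -
  have bd: "(\<integral>z. \<bar>f (z + c) - f z\<bar> \<partial>lborel) \<le> 2 * (\<integral>z. \<bar>f z\<bar> \<partial>lborel)" for c
    using translate_L1_approx[OF f, of "\<lambda>_. 0" c] by simp
  show "integrable lborel (\<lambda>z. conv (\<rho> n) f z - f z)"
    by (rule mollifier_conv_L1(1)[OF f \<rho> bd])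
  show "(\<lambda>n. \<integral>z. \<bar>conv (\<rho> n) f z - f z\<bar> \<partial>lborel) \<longlonglongrightarrow> 0"
  proof (rule LIMSEQ_I)
    fix r :: real assume r: "0 < r"
    obtain \<delta> where \<delta>: "\<delta> > 0" "\<And>c. norm c < \<delta> \<Longrightarrow> (\<integral>z. \<bar>f (z + c) - f z\<bar> \<partial>lborel) < r/2"
      using translate_L1[OF f, of "r/2"] r by auto
    obtain N where N: "inverse (real (Suc N)) < \<delta>" using reals_Archimedean[OF \<delta>(1)] by blast
    have "norm ((\<integral>z. \<bar>conv (\<rho> n) f z - f z\<bar> \<partial>lborel) - 0) < r" if "n \<ge> N" for n
    proof -
      have "inverse (real (Suc n)) \<le> inverse (real (Suc N))" using that by (intro le_imp_inverse_le) auto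
      then have "(\<integral>z. \<bar>conv (\<rho> n) f z - f z\<bar> \<partial>lborel) \<le> r/2"
        using N by (intro mollifier_conv_L1(2)[OF f \<rho>] less_imp_le \<delta>(2)) (meson less_le_trans less_trans)
      moreover have "0 \<le> (\<integral>z. \<bar>conv (\<rho> n) f z - f z\<bar> \<partial>lborel)" by (intro integral_nonneg_AE) auto
      ultimately show ?thesis using r by simp
    qed
    then show "\<exists>N. \<forall>n\<ge>N. norm ((\<integral>z. \<bar>conv (\<rho> n) f z - f z\<bar> \<partial>lborel) - 0) < r" by blast
  qed
qed

lemma continuous_indicator_measurable:
  fixes f :: "'a::euclidean_space \<Rightarrow> real"
  assumes "compact K" "continuous_on K f"
  shows "(\<lambda>z. indicator K z * f z) \<in> borel_measurable borel"
  using borel_measurable_continuous_on_indicator[of K f] assms by (simp add: borel_compact)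

lemma continuous_indicator_integrable:
  fixes f :: "'a::euclidean_space \<Rightarrow> real"
  assumes "compact K" "continuous_on K f"
  shows "integrable lborel (\<lambda>z. indicator K z * f z)"
  using borel_integrable_compact[OF assms] by simp

lemma continuous_compact_bound:
  fixes f :: "'a::euclidean_space \<Rightarrow> real"
  assumes "compact K" "continuous_on K f"
  obtains B where "B \<ge> 0" "\<And>z. z \<in> K \<Longrightarrow> \<bar>f z\<bar> \<le> B"
proof -
  have "bounded (f ` K)" using assms by (intro compact_imp_bounded compact_continuous_image)
  then obtain B where "\<And>z. z \<in> K \<Longrightarrow> \<bar>f z\<bar> \<le> B"
    unfolding bounded_iff by (metis image_eqI real_norm_def)
  then have "\<And>z. z \<in> K \<Longrightarrow> \<bar>f z\<bar> \<le> max B 0" by (metis max.coboundedI1)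
  then show thesis using that[of "max B 0"] by simp
qed

text \<open>A version of Fatou's lemma for a sequence bounded below by an \<open>L\<^sup>1\<close>-convergent one.\<close>

lemma negative_part_integral_tendsto_0:
  fixes Y g :: "nat \<Rightarrow> 'a \<Rightarrow> real"
  assumes Y: "\<And>n. Y n \<in> borel_measurable M" and g: "\<And>n. integrable M (g n)" "integrable M g0"
    and b: "\<And>n x. - Y n x \<le> g n x" and g_lim: "(\<lambda>n. \<integral>x. \<bar>g n x - g0 x\<bar> \<partial>M) \<longlonglongrightarrow> 0"
    and Y_lim: "AE x in M. (\<lambda>n. Y n x) \<longlonglongrightarrow> Y0 x" and Y0: "AE x in M. 0 \<le> Y0 x" and g0: "\<And>x. 0 \<le> g0 x"
  shows "(\<lambda>n. \<integral>x. min (max 0 (- Y n x)) (g0 x) + \<bar>g n x - g0 x\<bar> \<partial>M) \<longlonglongrightarrow> 0"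
    "\<And>n. integrable M (\<lambda>x. min (max 0 (- Y n x)) (g0 x) + \<bar>g n x - g0 x\<bar>)"
    "\<And>n x. - Y n x \<le> min (max 0 (- Y n x)) (g0 x) + \<bar>g n x - g0 x\<bar>"
proof -
  have [measurable]: "Y n \<in> borel_measurable M" "g0 \<in> borel_measurable M" for n
    using Y g by (auto dest: borel_measurable_integrable)
  have min_i: "integrable M (\<lambda>x. min (max 0 (- Y n x)) (g0 x))" for n
    by (rule Bochner_Integration.integrable_bound[OF g(2)]) (use g0 in \<open>auto intro!: AE_I2\<close>)
  have "(\<lambda>n. \<integral>x. min (max 0 (- Y n x)) (g0 x) \<partial>M) \<longlonglongrightarrow> integral\<^sup>L M (\<lambda>_. 0::real)"
  proof (rule integral_dominated_convergence[where w=g0])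
    show "AE x in M. (\<lambda>n. min (max 0 (- Y n x)) (g0 x)) \<longlonglongrightarrow> 0"
      using Y_lim Y0
    proof eventually_elim
      fix x assume "(\<lambda>n. Y n x) \<longlonglongrightarrow> Y0 x" "0 \<le> Y0 x"
      then have "(\<lambda>n. min (max 0 (- Y n x)) (g0 x)) \<longlonglongrightarrow> min (max 0 (- Y0 x)) (g0 x)"
        by (intro tendsto_intros)
      moreover have "min (max 0 (- Y0 x)) (g0 x) = 0" using \<open>0 \<le> Y0 x\<close> g0[of x] by simp
      ultimately show "(\<lambda>n. min (max 0 (- Y n x)) (g0 x)) \<longlonglongrightarrow> 0" by (simp only:)
    qed
    show "AE x in M. norm (min (max 0 (- Y n x)) (g0 x)) \<le> g0 x" for n
      using g0 by (auto intro!: AE_I2)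
  qed (use g in auto)
  then have "(\<lambda>n. (\<integral>x. min (max 0 (- Y n x)) (g0 x) \<partial>M) + (\<integral>x. \<bar>g n x - g0 x\<bar> \<partial>M)) \<longlonglongrightarrow> 0 + 0"
    using g_lim by (intro tendsto_intros) simp_all
  moreover have "(\<integral>x. min (max 0 (- Y n x)) (g0 x) + \<bar>g n x - g0 x\<bar> \<partial>M)
      = (\<integral>x. min (max 0 (- Y n x)) (g0 x) \<partial>M) + (\<integral>x. \<bar>g n x - g0 x\<bar> \<partial>M)" for n
    using g by (intro Bochner_Integration.integral_add min_i integrable_abs Bochner_Integration.integrable_diff)
  ultimately show "(\<lambda>n. \<integral>x. min (max 0 (- Y n x)) (g0 x) + \<bar>g n x - g0 x\<bar> \<partial>M) \<longlonglongrightarrow> 0" by simp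
  show "integrable M (\<lambda>x. min (max 0 (- Y n x)) (g0 x) + \<bar>g n x - g0 x\<bar>)" for n
    using g by (intro Bochner_Integration.integrable_add min_i integrable_abs Bochner_Integration.integrable_diff)
  \<comment> \<open>\<open>-Y\<close> is at most \<open>g = g0 + (g - g0)\<close>. Cutting
    \<open>-Y\<close> at \<open>g0\<close> costs no more than \<open>|g - g0|\<close>, and the cut
    part is dominated by the fixed function \<open>g0\<close>.\<close>
  show "- Y n x \<le> min (max 0 (- Y n x)) (g0 x) + \<bar>g n x - g0 x\<bar>" for n x
    using b[of n x] g0[of x] by (auto simp: min_def max_def abs_if)
qed

text \<open>Applying the subsequence theorem to the sum of all the errors gives one subsequence for
  all the functions simultaneously.\<close>

lemma AE_subsequence:
  fixes f :: "'i \<Rightarrow> 'a::euclidean_space \<Rightarrow> real"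
  assumes \<rho>: "\<And>n. mollifier (inverse (real (Suc n))) (\<rho> n)" and I: "finite I" and f: "\<And>i. i \<in> I \<Longrightarrow> integrable lborel (f i)"
  obtains r :: "nat \<Rightarrow> nat" where "strict_mono r"
    "AE z in lborel. \<forall>i\<in>I. (\<lambda>n. conv (\<rho> (r n)) (f i) z) \<longlonglongrightarrow> f i z"
proof -
  define u where "u n z = (\<Sum>i\<in>I. \<bar>conv (\<rho> n) (f i) z - f i z\<bar>)" for n z
  have ui: "integrable lborel (u n)" for n
    unfolding u_def using mollifier_sequence_L1(1)[OF \<rho> f]
    by (intro Bochner_Integration.integrable_sum integrable_abs) auto
  have "(\<lambda>n. \<Sum>i\<in>I. \<integral>z. \<bar>conv (\<rho> n) (f i) z - f i z\<bar> \<partial>lborel) \<longlonglongrightarrow> (\<Sum>i\<in>I. 0)"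
    using mollifier_sequence_L1(2)[OF \<rho> f] by (intro tendsto_sum) auto
  moreover have "(\<integral>z. norm (u n z) \<partial>lborel) = (\<Sum>i\<in>I. \<integral>z. \<bar>conv (\<rho> n) (f i) z - f i z\<bar> \<partial>lborel)" for n
  proof -
    have "(\<integral>z. norm (u n z) \<partial>lborel) = (\<integral>z. u n z \<partial>lborel)"
      by (intro Bochner_Integration.integral_cong) (auto simp: u_def intro!: sum_nonneg)
    also have "\<dots> = (\<Sum>i\<in>I. \<integral>z. \<bar>conv (\<rho> n) (f i) z - f i z\<bar> \<partial>lborel)"
      unfolding u_def using mollifier_sequence_L1(1)[OF \<rho> f]
      by (intro Bochner_Integration.integral_sum integrable_abs) auto
    finally show ?thesis .
  qed
  ultimately have "(\<lambda>n. \<integral>z. norm (u n z) \<partial>lborel) \<longlonglongrightarrow> 0" by simp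
  from tendsto_L1_AE_subseq[OF ui this] obtain r :: "nat \<Rightarrow> nat" where r: "strict_mono r"
    "AE z in lborel. (\<lambda>n. u (r n) z) \<longlonglongrightarrow> 0" by blast
  have "AE z in lborel. \<forall>i\<in>I. (\<lambda>n. conv (\<rho> (r n)) (f i) z) \<longlonglongrightarrow> f i z"
    using r(2)
  proof eventually_elim
    fix z assume z: "(\<lambda>n. u (r n) z) \<longlonglongrightarrow> 0"
    show "\<forall>i\<in>I. (\<lambda>n. conv (\<rho> (r n)) (f i) z) \<longlonglongrightarrow> f i z"
    proof
      fix i assume i: "i \<in> I"
      have "(\<lambda>n. conv (\<rho> (r n)) (f i) z - f i z) \<longlonglongrightarrow> 0"
      proof (rule Lim_null_comparison[OF _ z], intro always_eventually allI)
        fix n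
        show "norm (conv (\<rho> (r n)) (f i) z - f i z) \<le> u (r n) z"
          unfolding u_def real_norm_def
          by (rule member_le_sum[OF i, of "\<lambda>i. \<bar>conv (\<rho> (r n)) (f i) z - f i z\<bar>"]) (use I in auto)
      qed
      then show "(\<lambda>n. conv (\<rho> (r n)) (f i) z) \<longlonglongrightarrow> f i z" by (simp add: LIM_zero_iff)
    qed
  qed
  then show thesis using r(1) that by blast
qed

lemma conv_uniform_on_compact:
  fixes h :: "'a::euclidean_space \<Rightarrow> real"
  assumes \<rho>: "\<And>n. mollifier (inverse (real (Suc n))) (\<rho> n)" and i: "integrable lborel (\<lambda>w. indicator D w * h w)"
    and K: "compact K" "K \<subseteq> D" "open D" and D: "compact (closure D)" "continuous_on (closure D) h"
    and "\<eta> > 0"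
  shows "\<exists>N. \<forall>n\<ge>N. \<forall>z\<in>K. cball z (inverse (real (Suc n))) \<subseteq> D \<and> \<bar>conv (\<rho> n) (\<lambda>w. indicator D w * h w) z - h z\<bar> \<le> \<eta>"
proof -
  obtain e where e: "e > 0" "(\<Union>x\<in>K. cball x e) \<subseteq> D"
    using compact_subset_open_imp_cball_epsilon_subset[OF K(1,3,2)] by blast
  have "uniformly_continuous_on (closure D) h"
    using D by (simp add: compact_uniformly_continuous)
  then obtain d where d: "d > 0" "\<And>z w. z \<in> closure D \<Longrightarrow> w \<in> closure D \<Longrightarrow> dist w z < d \<Longrightarrow> dist (h w) (h z) < \<eta>"
    using assms(8) unfolding uniformly_continuous_on_def by metis
  obtain N where N: "inverse (real (Suc N)) < min e d" using reals_Archimedean[of "min e d"] e d by auto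
  have "cball z (inverse (real (Suc n))) \<subseteq> D \<and> \<bar>conv (\<rho> n) (\<lambda>w. indicator D w * h w) z - h z\<bar> \<le> \<eta>"
    if n: "n \<ge> N" and z: "z \<in> K" for n z
  proof -
    have "inverse (real (Suc n)) \<le> inverse (real (Suc N))" using n by (intro le_imp_inverse_le) auto
    then have ne: "inverse (real (Suc n)) < e" "inverse (real (Suc n)) < d" using N by linarith+
    then have "cball z (inverse (real (Suc n))) \<subseteq> cball z e" by (intro subset_cball) simp
    then have sub: "cball z (inverse (real (Suc n))) \<subseteq> D" using e(2) z by blast
    have "\<bar>conv (\<rho> n) (\<lambda>w. indicator D w * h w) z - indicator D z * h z\<bar> \<le> \<eta>"
    proof (rule conv_uniform_approx[OF \<rho> i])
      fix w assume w: "dist z w < inverse (real (Suc n))"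
      then have "w \<in> D" using sub by auto
      moreover have "z \<in> D" using z K(2) by blast
      moreover have "dist (h w) (h z) < \<eta>"
        using w ne \<open>w \<in> D\<close> \<open>z \<in> D\<close> closure_subset[of D] by (intro d(2)) (auto simp: dist_commute)
      ultimately show "\<bar>indicator D w * h w - indicator D z * h z\<bar> \<le> \<eta>" by (simp add: dist_real_def)
    qed
    then show ?thesis using sub z K(2) by (simp add: subset_iff)
  qed
  then show ?thesis by blast
qed

lemma p_parabolicE:
  assumes "p_parabolic p \<Theta> h" "open U" "s1 < s2" "compactly_contained (U \<times> {s1<..<s2}) \<Theta>"
  obtains G where "parabolic_sobolev p U s1 s2 h G"
    "\<And>\<phi>. \<phi> \<in> test_functions (U \<times> {s1<..<s2}) \<Longrightarrow>
                (LINT t:{s1<..<s2}|lborel. LINT x:U|lborel.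
                   (norm (G (x, t)) powr (p - 2) *\<^sub>R G (x, t)) \<bullet> grad (\<lambda>y. \<phi> (y, t)) x)
              - (LINT t:{s1<..<s2}|lborel. LINT x:U|lborel.
                   h (x, t) * deriv (\<lambda>s. \<phi> (x, s)) t) = 0"
proof -
  note assms(1)[unfolded p_parabolic_def, THEN conjunct2, THEN spec, THEN spec, THEN spec, THEN mp,
      OF conjI[OF assms(2) conjI[OF assms(3,4)]]]
  then obtain G where "parabolic_sobolev p U s1 s2 h G" and "\<forall>\<phi>\<in>test_functions (U \<times> {s1<..<s2}).
                (LINT t:{s1<..<s2}|lborel. LINT x:U|lborel.
                   (norm (G (x, t)) powr (p - 2) *\<^sub>R G (x, t)) \<bullet> grad (\<lambda>y. \<phi> (y, t)) x)
              - (LINT t:{s1<..<s2}|lborel. LINT x:U|lborel.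
                   h (x, t) * deriv (\<lambda>s. \<phi> (x, s)) t) = 0" by blast
  then show thesis by (intro that) auto
qed

text \<open>Energy estimate for \<open>W\<close>, the positive part of
  \<open>h - v - \<kappa>\<close>. For the mollified solution, the time derivative of
  \<open>W^3 / 3\<close> and the divergence of \<open>W^2 (a - A)\<close> have integral 0, where
  \<open>a\<close> is the mollified flux. This bounds \<sigma> times the integral of
  \<open>W^2\<close> by that of \<open>- 2 W X\<close>, where \<open>X\<close> is the inner product
  of the gradient difference and the flux difference. Since \<open>a\<close> is not the flux of the
  mollified gradient, \<open>X\<close> acquires its sign only in the limit, by
  \<open>flux_monotone\<close>. Powers 2 and 3 appear because the positive part itself is not
  differentiable.\<close>

lemma weak_comparison:
  fixes h v vt :: "'n::finite spacetime \<Rightarrow> real" and V A :: "'n spacetime \<Rightarrow> real^'n"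
    and dA :: "'n \<Rightarrow> 'n spacetime \<Rightarrow> real" and Q :: "(real^'n) set"
  assumes p: "1 < p" and par: "p_parabolic p (Q \<times> {t1<..<t2}) h" and Q: "open Q"
    and P: "open P" "P \<subseteq> Q \<times> {t1<..<t2}"
    and cpt: "compact {z\<in>P. v z \<le> h z}"
    and cont: "continuous_on P v" "continuous_on P vt" "continuous_on P V" "continuous_on P A" "\<And>i. continuous_on P (dA i)"
    and part: "\<And>i z. z \<in> P \<Longrightarrow> has_partial v (space_dir i) (V z $ i) z"
      "\<And>z. z \<in> P \<Longrightarrow> has_partial v time_dir (vt z) z"
      "\<And>i z. z \<in> P \<Longrightarrow> has_partial (\<lambda>z. A z $ i) (space_dir i) (dA i z) z"
    and A: "\<And>z. z \<in> P \<Longrightarrow> A z = norm (V z) powr (p - 2) *\<^sub>R V z"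
    and \<sigma>: "\<sigma> > 0" "\<And>z. z \<in> P \<Longrightarrow> (\<Sum>i\<in>UNIV. dA i z) + \<sigma> \<le> vt z"
    and z: "z \<in> P"
  shows "h z \<le> v z"
proof (rule ccontr)
  assume "\<not> h z \<le> v z"
  \<comment> \<open>Half the excess at \<open>z\<close>: lowering by \<kappa> leaves a positive
    excess at \<open>z\<close> and moves the support of \<open>W\<close> into the interior of the
    contact set.\<close>
  define \<kappa> where "\<kappa> = (h z - v z) / 2"
  have \<kappa>: "\<kappa> > 0" "h z - v z - \<kappa> = \<kappa>" using \<open>\<not> h z \<le> v z\<close> by (auto simp: \<kappa>_def field_simps)
  have hc: "continuous_on (Q \<times> {t1<..<t2}) h" using par by (simp add: p_parabolic_def)
  then have hP: "continuous_on P h" using P(2) continuous_on_subset by blast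
  define K0 where "K0 = {z\<in>P. v z \<le> h z}"
  have K0: "compact K0" "K0 \<subseteq> P" using cpt by (auto simp: K0_def)
  \<comment> \<open>The mollification error will be at most \<open>\<kappa>/2\<close>. Where the
    true excess is below \<open>\<kappa>/2\<close>, the mollified excess is then below \<kappa>, so
    the mollified \<open>W\<close> vanishes off \<open>K\<close>.\<close>
  define K where "K = {z\<in>K0. \<kappa>/2 \<le> h z - v z}"
  have "closed K"
  proof -
    have "continuous_on K0 (\<lambda>z. h z - v z)"
      using hP cont(1) K0(2) by (intro continuous_intros) (auto intro: continuous_on_subset)
    then have "closed (K0 \<inter> (\<lambda>z. h z - v z) -` {\<kappa>/2..})"
      using compact_imp_closed[OF K0(1)] by (intro continuous_closed_preimage) auto
    moreover have "K0 \<inter> (\<lambda>z. h z - v z) -` {\<kappa>/2..} = K" by (auto simp: K_def)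
    ultimately show ?thesis by simp
  qed
  then have K: "compact K" "K \<subseteq> K0" "K \<subseteq> P"
    using K0 compact_Int_closed[of K0 K] by (auto simp: K_def Int_absorb1)
  \<comment> \<open>The gluing needs an open neighbourhood of \<open>K\<close> on which the
    mollification is controlled. \<open>P0\<close> is open and lies in the compact set
    \<open>K0\<close>, which keeps a positive distance from the complement of
    \<open>D\<close>.\<close>
  define P0 where "P0 = {z\<in>P. 0 < h z - v z}"
  have P0: "open P0"
  proof -
    have "open (P \<inter> (\<lambda>z. h z - v z) -` {0<..})"
      using hP cont(1) P(1) by (intro continuous_open_preimage continuous_intros) auto
    moreover have "P \<inter> (\<lambda>z. h z - v z) -` {0<..} = P0" by (auto simp: P0_def)
    ultimately show ?thesis by simp
  qed
  have P0s: "P0 \<subseteq> K0" "P0 \<subseteq> P" "K \<subseteq> P0" using \<kappa> by (auto simp: P0_def K0_def K_def)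
  have K0Q: "K0 \<subseteq> Q \<times> {t1<..<t2}" using K0(2) P(2) by (rule order_trans)
  obtain U s1 s2 where U: "open U" "s1 < s2" "compactly_contained (U \<times> {s1<..<s2}) (Q \<times> {t1<..<t2})"
    "K0 \<subseteq> U \<times> {s1<..<s2}"
    by (rule compact_subset_cylinder[OF K0(1) Q K0Q])
  obtain G where G: "parabolic_sobolev p U s1 s2 h G"
    and weak: "\<And>\<phi>. \<phi> \<in> test_functions (U \<times> {s1<..<s2}) \<Longrightarrow>
                (LINT t:{s1<..<s2}|lborel. LINT x:U|lborel.
                   (norm (G (x, t)) powr (p - 2) *\<^sub>R G (x, t)) \<bullet> grad (\<lambda>y. \<phi> (y, t)) x)
              - (LINT t:{s1<..<s2}|lborel. LINT x:U|lborel.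
                   h (x, t) * deriv (\<lambda>s. \<phi> (x, s)) t) = 0"
    by (rule p_parabolicE[OF par U(1-3)]) blast
  define D where "D = U \<times> {s1<..<s2}"
  have D: "open D" "compact (closure D)" "closure D \<subseteq> Q \<times> {t1<..<t2}" "K0 \<subseteq> D"
    using U by (auto simp: D_def compactly_contained_def open_Times)
  have bdd: "bounded (U \<times> {s1<..<s2})"
    using D(2) closure_subset[of D] by (metis D_def bounded_subset compact_imp_bounded)
  note ctx = p U(1) bdd G weak
  define hh where "hh w = indicator D w * h w" for w
  define GG where "GG i w = indicator D w * G w $ i" for i w
  define aa where "aa i w = indicator D w * (norm (G w) powr (p - 2) * G w $ i)" for i w
  define S where "S w = indicator D w * norm (G w) powr p" for w
  have int: "integrable lborel hh" "\<And>i. integrable lborel (GG i)" "\<And>i. integrable lborel (aa i)" "integrable lborel S"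
    unfolding hh_def GG_def aa_def S_def D_def
    using cylinder_solution_integrable[OF ctx] cylinder_gradient_component_integrable[OF ctx]
      cylinder_flux_integrable[OF ctx] cylinder_energy_integrable[OF ctx] by blast+
  have S0: "S w \<ge> 0" for w by (simp add: S_def)
  have nG: "norm (G w) powr (p - 2) * norm (G w) = norm (G w) powr (p - 1)" for w
    by (cases "G w = 0") (auto simp: powr_mult_base[of "norm (G w)" "p - 2"] mult.commute)
  have GGle: "\<bar>GG i w\<bar> \<le> indicator D w * norm (G w)" for i w
    by (auto simp: GG_def indicator_def component_le_norm_cart)
  have aale: "\<bar>aa i w\<bar> \<le> indicator D w * norm (G w) powr (p - 1)" for i w
  proof -
    have "norm (G w) powr (p - 2) * \<bar>G w $ i\<bar> \<le> norm (G w) powr (p - 2) * norm (G w)"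
      by (intro mult_left_mono component_le_norm_cart) auto
    then show ?thesis unfolding nG by (auto simp: aa_def indicator_def abs_mult)
  qed
  have GG1: "\<bar>GG i w\<bar> \<le> 1 + S w" for i w
    using GGle[of i w] le_one_plus_powr[of "norm (G w)" 1 p] p by (auto simp: S_def indicator_def)
  have aa1: "\<bar>aa i w\<bar> \<le> 1 + S w" for i w
    using aale[of i w] le_one_plus_powr[of "norm (G w)" "p - 1" p] p by (auto simp: S_def indicator_def)
  \<comment> \<open>The two-point inequality required by \<open>conv_product_bound\<close>, with the
    energy density \<open>S\<close> as majorant.\<close>
  have GGaa: "\<bar>GG i w * aa i w'\<bar> \<le> S w + S w'" for i w w'
  proof -
    have "\<bar>GG i w * aa i w'\<bar> \<le> (indicator D w * norm (G w)) * (indicator D w' * norm (G w') powr (p - 1))"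
      unfolding abs_mult by (intro mult_mono GGle aale) auto
    also have "\<dots> \<le> S w + S w'"
      using powr_product_bound[of "norm (G w)" "norm (G w')" p] p by (auto simp: S_def indicator_def)
    finally show ?thesis .
  qed
  have "\<exists>\<rho>::'n spacetime \<Rightarrow> real. mollifier (inverse (real (Suc n))) \<rho>" for n
    by (intro mollifier_exists) simp
  then obtain \<rho> :: "nat \<Rightarrow> 'n spacetime \<Rightarrow> real" where \<rho>: "\<And>n. mollifier (inverse (real (Suc n))) (\<rho> n)" by metis
  obtain N where N: "\<And>n z. n \<ge> N \<Longrightarrow> z \<in> K0 \<Longrightarrow> cball z (inverse (real (Suc n))) \<subseteq> D"
    "\<And>n z. n \<ge> N \<Longrightarrow> z \<in> K0 \<Longrightarrow> \<bar>conv (\<rho> n) hh z - h z\<bar> \<le> \<kappa>/2"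
    using conv_uniform_on_compact[OF \<rho> int(1)[unfolded hh_def] K0(1) D(4,1,2) continuous_on_subset[OF hc D(3)], of "\<kappa>/2"] \<kappa>(1)
    unfolding hh_def[symmetric] by auto
  define Wm where "Wm n w = max 0 (conv (\<rho> n) hh w - v w - \<kappa>)" for n w
  \<comment> \<open>The factor with a hoped-for sign: its limit is the monotone expression of
    \<open>flux_monotone\<close>.\<close>
  define X where "X n w = (\<Sum>i\<in>UNIV. (conv (\<rho> n) (GG i) w - V w $ i) * (conv (\<rho> n) (aa i) w - A w $ i))" for n w
  have Wm0: "Wm n w = 0" if "n \<ge> N" "w \<in> P0 - K" for n w
  proof -
    have "w \<in> K0" "h w - v w < \<kappa>/2" using that P0s by (auto simp: K_def)
    then have "conv (\<rho> n) hh w - v w - \<kappa> \<le> 0" using N(2)[OF that(1), of w] \<kappa>(1) unfolding abs_le_iff by linarith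
    then show ?thesis by (simp add: Wm_def)
  qed
  have cP: "continuous_on P0 f" if "continuous_on P f" for f :: "'n spacetime \<Rightarrow> real"
    using that P0s(2) continuous_on_subset by blast
  have cc: "continuous_on B (conv (\<rho> n) f)" if "integrable lborel f" for n f B
    using mollifier_conv(1)[OF \<rho> that] continuous_on_subset by blast
  have Wmc: "continuous_on P (Wm n)" for n
    unfolding Wm_def using cont(1) by (intro continuous_intros cc int)
  have Xc: "continuous_on P (X n)" for n
    unfolding X_def by (intro continuous_intros cont cc int)
  define ht where "ht n = conv (\<lambda>w. frechet_derivative (\<rho> n) (at w) time_dir) hh" for n
  define da where "da n i = conv (\<lambda>w. frechet_derivative (\<rho> n) (at w) (space_dir i)) (aa i)" for n i
  have htc: "continuous_on P (ht n)" for n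
    unfolding ht_def using mollifier_conv(3)[OF \<rho> int(1) time_dir_Basis] continuous_on_subset by blast
  have dac: "continuous_on P (da n i)" for n i
    unfolding da_def using mollifier_conv(3)[OF \<rho> int(3) space_dir_Basis] continuous_on_subset by blast
  have sq: "((\<lambda>s::real. (max 0 s)^2) has_real_derivative 2 * max 0 s) (at s)" for s
    using DERIV_max_0_power[of 0 s] by (simp add: numeral_2_eq_2)
  have cb: "((\<lambda>s::real. (max 0 s)^3 / 3) has_real_derivative (max 0 s)^2) (at s)" for s
    using DERIV_cdivide[OF DERIV_max_0_power[of 1 s], of 3] by (simp add: numeral_2_eq_2 numeral_3_eq_3)
  \<comment> \<open>The spatial identities are summed over \<open>i\<close>, and the mollified
    equation replaces the divergence of the mollified flux by \<open>ht\<close>. What is left is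
    \<open>W^2 (ht - div A)\<close>. By strictness it is at least
    \<open>W^2 (ht - vt) + \<sigma> W^2\<close>, and the first summand integrates to 0 by the time
    identity.\<close>
  have energy: "\<sigma> * (\<integral>w. indicator K w * (Wm n w)^2 \<partial>lborel) \<le> (\<integral>w. - (indicator K w * (2 * Wm n w * X n w)) \<partial>lborel)"
    if n: "n \<ge> N" for n
  proof -
    have time: "(\<integral>w. indicator K w * ((Wm n w)^2 * (ht n w - vt w)) \<partial>lborel) = 0"
    proof (rule integral_partial_glued[OF P0 K(1) P0s(3), where f="\<lambda>w. (Wm n w)^3/3" and e=time_dir])
      show "continuous_on P0 (\<lambda>w. (Wm n w)^3/3)" "continuous_on P0 (\<lambda>w. (Wm n w)^2 * (ht n w - vt w))"
        by (intro cP continuous_intros Wmc htc cont; simp)+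
      show "(Wm n w)^3/3 = 0" if "w \<in> P0 - K" for w using Wm0[OF n that] by simp
      fix w assume w: "w \<in> P0"
      have "has_partial (\<lambda>w. conv (\<rho> n) hh w - v w) time_dir (ht n w - vt w) w"
        unfolding ht_def using w P0s(2) by (intro has_partial_diff part mollifier_conv(2)[OF \<rho> int(1) time_dir_Basis]) auto
      then have "has_partial (\<lambda>w. conv (\<rho> n) hh w - v w - \<kappa>) time_dir (ht n w - vt w - 0) w"
        by (rule has_partial_diff) (simp add: has_partial_def)
      from has_partial_compose[OF this cb] show "has_partial (\<lambda>w. (Wm n w)^3/3) time_dir ((Wm n w)^2 * (ht n w - vt w)) w"
        by (simp add: Wm_def)
    qed
    have space: "(\<integral>w. indicator K w * ((2 * Wm n w * (conv (\<rho> n) (GG i) w - V w $ i)) * (conv (\<rho> n) (aa i) w - A w $ i)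
        + (Wm n w)^2 * (da n i w - dA i w)) \<partial>lborel) = 0" for i
    proof (rule integral_partial_glued[OF P0 K(1) P0s(3), where f="\<lambda>w. (Wm n w)^2 * (conv (\<rho> n) (aa i) w - A w $ i)" and e="space_dir i"])
      show "continuous_on P0 (\<lambda>w. (Wm n w)^2 * (conv (\<rho> n) (aa i) w - A w $ i))"
        by (intro cP continuous_intros Wmc cont cc int)
      show "continuous_on P0 (\<lambda>w. (2 * Wm n w * (conv (\<rho> n) (GG i) w - V w $ i)) * (conv (\<rho> n) (aa i) w - A w $ i)
        + (Wm n w)^2 * (da n i w - dA i w))"
        by (intro cP continuous_intros Wmc cont cc int dac)
      show "(Wm n w)^2 * (conv (\<rho> n) (aa i) w - A w $ i) = 0" if "w \<in> P0 - K" for w using Wm0[OF n that] by simp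
      fix w assume w: "w \<in> P0"
      show "has_partial (\<lambda>w. (Wm n w)^2 * (conv (\<rho> n) (aa i) w - A w $ i)) (space_dir i)
          ((2 * Wm n w * (conv (\<rho> n) (GG i) w - V w $ i)) * (conv (\<rho> n) (aa i) w - A w $ i)
        + (Wm n w)^2 * (da n i w - dA i w)) w"
      proof (rule has_partial_mult)
        have "conv (\<lambda>w. frechet_derivative (\<rho> n) (at w) (space_dir i)) hh w = conv (\<rho> n) (GG i) w"
          unfolding hh_def GG_def D_def
          by (rule mollified_gradient[OF ctx \<rho>]) (use N(1)[OF n, of w] w P0s(1) in \<open>auto simp: D_def\<close>)
        then have "has_partial (conv (\<rho> n) hh) (space_dir i) (conv (\<rho> n) (GG i) w) w"
          using mollifier_conv(2)[OF \<rho> int(1) space_dir_Basis] by metis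
        then have "has_partial (\<lambda>w. conv (\<rho> n) hh w - v w) (space_dir i) (conv (\<rho> n) (GG i) w - V w $ i) w"
          using w P0s(2) by (intro has_partial_diff part) auto
        then have "has_partial (\<lambda>w. conv (\<rho> n) hh w - v w - \<kappa>) (space_dir i) (conv (\<rho> n) (GG i) w - V w $ i - 0) w"
          by (rule has_partial_diff) (simp add: has_partial_def)
        from has_partial_compose[OF this sq]
        show "has_partial (\<lambda>w. (Wm n w)^2) (space_dir i) (2 * Wm n w * (conv (\<rho> n) (GG i) w - V w $ i)) w"
          by (simp add: Wm_def)
        show "has_partial (\<lambda>w. conv (\<rho> n) (aa i) w - A w $ i) (space_dir i) (da n i w - dA i w) w"
          unfolding da_def using w P0s(2) by (intro has_partial_diff part mollifier_conv(2)[OF \<rho> int(3) space_dir_Basis]) auto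
      qed
    qed
    have iK: "integrable lborel (\<lambda>w. indicator K w * f w)" if "continuous_on P f" for f :: "'n spacetime \<Rightarrow> real"
      using that K(3) by (intro continuous_indicator_integrable[OF K(1)]) (auto intro: continuous_on_subset)
    have "0 = (\<Sum>i\<in>UNIV. \<integral>w. indicator K w * ((2 * Wm n w * (conv (\<rho> n) (GG i) w - V w $ i)) * (conv (\<rho> n) (aa i) w - A w $ i)
        + (Wm n w)^2 * (da n i w - dA i w)) \<partial>lborel)" using space by simp
    also have "\<dots> = (\<integral>w. (\<Sum>i\<in>UNIV. indicator K w * ((2 * Wm n w * (conv (\<rho> n) (GG i) w - V w $ i)) * (conv (\<rho> n) (aa i) w - A w $ i)
        + (Wm n w)^2 * (da n i w - dA i w))) \<partial>lborel)"
      by (intro Bochner_Integration.integral_sum[symmetric] iK continuous_intros Wmc cont cc int dac)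
    also have "\<dots> = (\<integral>w. indicator K w * (2 * Wm n w * X n w) + indicator K w * ((Wm n w)^2 * (ht n w - (\<Sum>i\<in>UNIV. dA i w))) \<partial>lborel)"
    proof (intro Bochner_Integration.integral_cong refl)
      fix w
      show "(\<Sum>i\<in>UNIV. indicator K w * ((2 * Wm n w * (conv (\<rho> n) (GG i) w - V w $ i)) * (conv (\<rho> n) (aa i) w - A w $ i)
        + (Wm n w)^2 * (da n i w - dA i w)))
        = indicator K w * (2 * Wm n w * X n w) + indicator K w * ((Wm n w)^2 * (ht n w - (\<Sum>i\<in>UNIV. dA i w)))"
      proof (cases "w \<in> K")
        case True
        have "(\<Sum>i\<in>UNIV. da n i w) = ht n w"
          unfolding da_def ht_def aa_def hh_def D_def
          by (rule mollified_equation[OF ctx \<rho>]) (use N(1)[OF n, of w] True K(2) in \<open>auto simp: D_def\<close>)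
        moreover have "(\<Sum>i\<in>UNIV. (2 * Wm n w * (conv (\<rho> n) (GG i) w - V w $ i)) * (conv (\<rho> n) (aa i) w - A w $ i)
            + (Wm n w)^2 * (da n i w - dA i w)) = 2 * Wm n w * X n w + (Wm n w)^2 * ((\<Sum>i\<in>UNIV. da n i w) - (\<Sum>i\<in>UNIV. dA i w))"
          unfolding X_def mult.assoc[of "2 * Wm n w"]
          by (simp only: sum.distrib sum_distrib_left[symmetric] sum_subtractf)
        ultimately show ?thesis using True by simp
      qed simp
    qed
    also have "\<dots> = (\<integral>w. indicator K w * (2 * Wm n w * X n w) \<partial>lborel)
        + (\<integral>w. indicator K w * ((Wm n w)^2 * (ht n w - (\<Sum>i\<in>UNIV. dA i w))) \<partial>lborel)"
      by (intro Bochner_Integration.integral_add iK continuous_intros Wmc Xc htc cont)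
    finally have e: "(\<integral>w. - (indicator K w * (2 * Wm n w * X n w)) \<partial>lborel)
        = (\<integral>w. indicator K w * ((Wm n w)^2 * (ht n w - (\<Sum>i\<in>UNIV. dA i w))) \<partial>lborel)" by simp
    have "\<sigma> * (\<integral>w. indicator K w * (Wm n w)^2 \<partial>lborel)
        = (\<integral>w. \<sigma> * (indicator K w * (Wm n w)^2) + indicator K w * ((Wm n w)^2 * (ht n w - vt w)) \<partial>lborel)"
      using time by (subst Bochner_Integration.integral_add)
        (auto intro!: integrable_mult_right iK continuous_intros Wmc htc cont)
    also have "\<dots> \<le> (\<integral>w. indicator K w * ((Wm n w)^2 * (ht n w - (\<Sum>i\<in>UNIV. dA i w))) \<partial>lborel)"
    proof (rule integral_mono)
      show "integrable lborel (\<lambda>w. \<sigma> * (indicator K w * (Wm n w)^2) + indicator K w * ((Wm n w)^2 * (ht n w - vt w)))"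
        by (intro Bochner_Integration.integrable_add integrable_mult_right iK continuous_intros Wmc htc cont)
      show "integrable lborel (\<lambda>w. indicator K w * ((Wm n w)^2 * (ht n w - (\<Sum>i\<in>UNIV. dA i w))))"
        by (intro iK continuous_intros Wmc htc cont)
      fix w
      show "\<sigma> * (indicator K w * (Wm n w)^2) + indicator K w * ((Wm n w)^2 * (ht n w - vt w))
          \<le> indicator K w * ((Wm n w)^2 * (ht n w - (\<Sum>i\<in>UNIV. dA i w)))"
      proof (cases "w \<in> K")
        case True
        then have "(Wm n w)^2 * (\<sigma> + (ht n w - vt w)) \<le> (Wm n w)^2 * (ht n w - (\<Sum>i\<in>UNIV. dA i w))"
          using \<sigma>(2)[of w] K(3) by (intro mult_left_mono) auto
        then show ?thesis using True by (simp add: algebra_simps)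
      qed simp
    qed
    finally show ?thesis using e by simp
  qed
  obtain B where B: "B \<ge> 0" "\<And>w i. w \<in> K \<Longrightarrow> \<bar>V w $ i\<bar> \<le> B" "\<And>w i. w \<in> K \<Longrightarrow> \<bar>A w $ i\<bar> \<le> B"
      "\<And>w. w \<in> K \<Longrightarrow> \<bar>h w - v w\<bar> \<le> B"
  proof -
    have "continuous_on K (\<lambda>w. (\<Sum>i\<in>UNIV. \<bar>V w $ i\<bar>) + (\<Sum>i\<in>UNIV. \<bar>A w $ i\<bar>) + \<bar>h w - v w\<bar>)"
      by (rule continuous_on_subset[OF _ K(3)]) (intro continuous_intros cont hP)
    then obtain B where B: "B \<ge> 0" "\<And>w. w \<in> K \<Longrightarrow> \<bar>(\<Sum>i\<in>UNIV. \<bar>V w $ i\<bar>) + (\<Sum>i\<in>UNIV. \<bar>A w $ i\<bar>) + \<bar>h w - v w\<bar>\<bar> \<le> B"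
      using continuous_compact_bound[OF K(1)] by blast
    have V: "\<bar>V w $ j\<bar> \<le> (\<Sum>i\<in>UNIV. \<bar>V w $ i\<bar>)" and A: "\<bar>A w $ j\<bar> \<le> (\<Sum>i\<in>UNIV. \<bar>A w $ i\<bar>)" for w j
      by (rule member_le_sum; simp)+
    have s0: "0 \<le> (\<Sum>i\<in>UNIV. \<bar>V w $ i\<bar>)" "0 \<le> (\<Sum>i\<in>UNIV. \<bar>A w $ i\<bar>)" for w
      by (simp_all add: sum_nonneg)
    have le: "(\<Sum>i\<in>UNIV. \<bar>V w $ i\<bar>) + (\<Sum>i\<in>UNIV. \<bar>A w $ i\<bar>) + \<bar>h w - v w\<bar> \<le> B" if "w \<in> K" for w
      using B(2)[OF that] by (simp only: abs_le_iff)
    show thesis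
    proof (rule that[of B])
      fix w i assume w: "w \<in> K"
      show "\<bar>V w $ i\<bar> \<le> B" using V[of w i] s0[of w] le[OF w] abs_ge_zero[of "h w - v w"] by linarith
      show "\<bar>A w $ i\<bar> \<le> B" using A[of w i] s0[of w] le[OF w] abs_ge_zero[of "h w - v w"] by linarith
      show "\<bar>h w - v w\<bar> \<le> B" using s0[of w] le[OF w] by linarith
    qed (rule B(1))
  qed
  have Wm_bound: "Wm n w \<le> B + \<kappa>" "0 \<le> Wm n w" if n: "n \<ge> N" and w: "w \<in> K" for n w
  proof -
    have "conv (\<rho> n) hh w - v w - \<kappa> \<le> B + \<kappa>"
      using N(2)[OF n subsetD[OF K(2) w]] B(4)[OF w] B(1) \<kappa>(1) unfolding abs_le_iff by linarith
    then show "Wm n w \<le> B + \<kappa>" using B(1) \<kappa>(1) by (simp add: Wm_def)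
  qed (simp add: Wm_def)
  \<comment> \<open>Comes from multiplying out each of the \<open>CARD('n)\<close> products in
    \<open>X\<close>: the four terms are bounded by \<open>2 s\<close>, twice
    \<open>B (1 + s)\<close>, and \<open>B * B\<close>, where \<open>s\<close> is the mollified
    energy density. The outer factor bounds \<open>2 * Wm\<close>.\<close>
  define C where "C = 2 * (B + \<kappa>) * (real CARD('n) * (2 + 2 * B + B * B))"
  have C0: "C \<ge> 0" using B(1) \<kappa>(1) by (simp add: C_def)
  have bound: "\<bar>2 * Wm n w * X n w\<bar> \<le> C * (1 + conv (\<rho> n) S w)" if n: "n \<ge> N" and w: "w \<in> K" for n w
  proof -
    define s where "s = conv (\<rho> n) S w"
    have s0: "s \<ge> 0"
      using \<rho>[of n] S0 unfolding s_def conv_def mollifier_def by (intro integral_nonneg_AE AE_I2 mult_nonneg_nonneg) blast+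
    have "\<bar>(conv (\<rho> n) (GG i) w - V w $ i) * (conv (\<rho> n) (aa i) w - A w $ i)\<bar> \<le> (2 + 2 * B + B * B) * (1 + s)" for i
    proof -
      let ?g = "conv (\<rho> n) (GG i) w" and ?a = "conv (\<rho> n) (aa i) w"
      have 1: "\<bar>?g\<bar> \<le> 1 + s" "\<bar>?a\<bar> \<le> 1 + s" "\<bar>?g * ?a\<bar> \<le> 2 * s"
        unfolding s_def using conv_abs_bound[OF \<rho> int(2) int(4) GG1] conv_abs_bound[OF \<rho> int(3) int(4) aa1]
          conv_product_bound[OF \<rho> int(2) int(3) int(4) GGaa] by blast+
      have "\<bar>?g * A w $ i\<bar> \<le> (1 + s) * B" "\<bar>V w $ i * ?a\<bar> \<le> B * (1 + s)" "\<bar>V w $ i * A w $ i\<bar> \<le> B * B"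
        unfolding abs_mult using 1 B w s0 by (intro mult_mono; simp)+
      moreover have "(?g - V w $ i) * (?a - A w $ i) = ?g * ?a - ?g * A w $ i - V w $ i * ?a + V w $ i * A w $ i"
        by (simp add: algebra_simps)
      ultimately have "\<bar>(?g - V w $ i) * (?a - A w $ i)\<bar> \<le> 2 * s + (1 + s) * B + B * (1 + s) + B * B"
        using 1(3) by linarith
      also have "\<dots> \<le> (2 + 2 * B + B * B) * (1 + s)"
        using s0 B(1) by (simp add: algebra_simps mult_nonneg_nonneg)
      finally show ?thesis .
    qed
    then have "\<bar>X n w\<bar> \<le> (\<Sum>i\<in>(UNIV::'n set). (2 + 2 * B + B * B) * (1 + s))"
      unfolding X_def by (intro order_trans[OF sum_abs] sum_mono)
    then have X: "\<bar>X n w\<bar> \<le> real CARD('n) * ((2 + 2 * B + B * B) * (1 + s))" by simp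
    have "\<bar>2 * Wm n w\<bar> \<le> 2 * (B + \<kappa>)" using Wm_bound[OF n w] by simp
    then have "\<bar>2 * Wm n w * X n w\<bar> \<le> (2 * (B + \<kappa>)) * (real CARD('n) * ((2 + 2 * B + B * B) * (1 + s)))"
      unfolding abs_mult[of "2 * Wm n w"] using X B(1) \<kappa>(1) by (intro mult_mono) auto
    then show ?thesis by (simp add: C_def s_def mult.assoc)
  qed
  \<comment> \<open>All functions whose mollifications must converge almost everywhere along one
    subsequence.\<close>
  define I :: "('n spacetime \<Rightarrow> real) set" where "I = range GG \<union> range aa \<union> {S}"
  have Ii: "integrable lborel f" if "f \<in> I" for f using that int by (auto simp: I_def)
  have If: "finite I" by (simp add: I_def)
  obtain r0 :: "nat \<Rightarrow> nat" where r0: "strict_mono r0"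
    "AE w in lborel. \<forall>f\<in>I. (\<lambda>n. conv (\<rho> (r0 n)) f w) \<longlonglongrightarrow> f w"
    using AE_subsequence[OF \<rho> If, of "\<lambda>f. f"] Ii by blast
  \<comment> \<open>Shifted by \<open>N\<close> so that every member of the subsequence satisfies
    the estimates valid from \<open>N\<close> on.\<close>
  define r where "r n = r0 (n + N)" for n
  have rN: "r n \<ge> N" for n using seq_suble[OF r0(1), of "n + N"] by (simp add: r_def)
  have r: "strict_mono r" using r0(1) by (auto simp: strict_mono_def r_def)
  have r_lim: "AE w in lborel. \<forall>f\<in>I. (\<lambda>n. conv (\<rho> (r n)) f w) \<longlonglongrightarrow> f w"
    using r0(2)
  proof eventually_elim
    fix w assume "\<forall>f\<in>I. (\<lambda>n. conv (\<rho> (r0 n)) f w) \<longlonglongrightarrow> f w"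
    then show "\<forall>f\<in>I. (\<lambda>n. conv (\<rho> (r n)) f w) \<longlonglongrightarrow> f w"
      unfolding r_def by (auto intro: LIMSEQ_ignore_initial_segment)
  qed
  have h_lim: "(\<lambda>n. conv (\<rho> (r n)) hh w) \<longlonglongrightarrow> h w" if w: "w \<in> K0" for w
  proof (rule LIMSEQ_I)
    fix e :: real assume e: "0 < e"
    obtain M where M: "\<And>n z. n \<ge> M \<Longrightarrow> z \<in> K0 \<Longrightarrow> \<bar>conv (\<rho> n) hh z - h z\<bar> \<le> e/2"
      using conv_uniform_on_compact[OF \<rho> int(1)[unfolded hh_def] K0(1) D(4,1,2) continuous_on_subset[OF hc D(3)], of "e/2"] e
      unfolding hh_def[symmetric] by auto
    have "norm (conv (\<rho> (r n)) hh w - h w) < e" if "n \<ge> M" for n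
      using M[of "r n" w] seq_suble[OF r, of n] that w e by force
    then show "\<exists>no. \<forall>n\<ge>no. norm (conv (\<rho> (r n)) hh w - h w) < e" by blast
  qed
  define W where "W w = max 0 (h w - v w - \<kappa>)" for w
  have Wm_lim: "(\<lambda>n. Wm (r n) w) \<longlonglongrightarrow> W w" if "w \<in> K" for w
    unfolding Wm_def W_def using h_lim[of w] that K(2) by (intro tendsto_intros) auto
  define Y where "Y n w = indicator K w * (2 * Wm (r n) w * X (r n) w)" for n w
  define Y0 where "Y0 w = indicator K w * (2 * W w * ((G w - V w) \<bullet> (norm (G w) powr (p - 2) *\<^sub>R G w - A w)))" for w
  define g where "g n w = C * (indicator K w + indicator K w * conv (\<rho> (r n)) S w)" for n w
  define g0 where "g0 w = C * (indicator K w + indicator K w * S w)" for w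
  have Ki: "integrable lborel (indicator K :: 'n spacetime \<Rightarrow> real)"
    using emeasure_compact_finite[OF K(1)] K(1) by (simp add: integrable_indicator_iff borel_compact)
  have KS: "integrable lborel (\<lambda>w. indicator K w * S w)"
    using integrable_mult_indicator[OF _ int(4), of K] K(1) by (simp add: borel_compact)
  have Ym: "Y n \<in> borel_measurable lborel" for n
    unfolding Y_def using K(3)
    by (simp, intro continuous_indicator_measurable[OF K(1)] continuous_on_subset[OF _ K(3)] continuous_intros Wmc Xc)
  have gi: "integrable lborel (g n)" for n
    unfolding g_def using Ki continuous_indicator_integrable[OF K(1) cc[OF int(4)]]
    by (intro integrable_mult_right Bochner_Integration.integrable_add)
  have g0i: "integrable lborel g0"
    unfolding g0_def using Ki KS by (intro integrable_mult_right Bochner_Integration.integrable_add)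
  have Yb: "- Y n w \<le> g n w" for n w
  proof (cases "w \<in> K")
    case True
    then show ?thesis using bound[OF rN True, of n] by (simp add: Y_def g_def)
  qed (simp add: Y_def g_def)
  have g_lim: "(\<lambda>n. \<integral>w. \<bar>g n w - g0 w\<bar> \<partial>lborel) \<longlonglongrightarrow> 0"
  proof (rule tendsto_sandwich[OF _ _ tendsto_const])
    show "(\<lambda>n. C * (\<integral>w. \<bar>conv (\<rho> (r n)) S w - S w\<bar> \<partial>lborel)) \<longlonglongrightarrow> 0"
      using tendsto_mult_left[OF LIMSEQ_subseq_LIMSEQ[OF mollifier_sequence_L1(2)[OF \<rho> int(4)] r], of C]
      by (simp add: comp_def)
    show "\<forall>\<^sub>F n in sequentially. 0 \<le> (\<integral>w. \<bar>g n w - g0 w\<bar> \<partial>lborel)"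
      by (intro always_eventually allI integral_nonneg_AE) auto
    show "\<forall>\<^sub>F n in sequentially. (\<integral>w. \<bar>g n w - g0 w\<bar> \<partial>lborel) \<le> C * (\<integral>w. \<bar>conv (\<rho> (r n)) S w - S w\<bar> \<partial>lborel)"
    proof (intro always_eventually allI)
      fix n
      have "(\<integral>w. \<bar>g n w - g0 w\<bar> \<partial>lborel) \<le> (\<integral>w. C * \<bar>conv (\<rho> (r n)) S w - S w\<bar> \<partial>lborel)"
      proof (rule integral_mono)
        show "integrable lborel (\<lambda>w. \<bar>g n w - g0 w\<bar>)" using gi g0i by auto
        show "integrable lborel (\<lambda>w. C * \<bar>conv (\<rho> (r n)) S w - S w\<bar>)"
          using mollifier_sequence_L1(1)[OF \<rho> int(4)] by auto
        fix w
        have "\<bar>C * (conv (\<rho> (r n)) S w - S w)\<bar> = C * \<bar>conv (\<rho> (r n)) S w - S w\<bar>"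
          using C0 by (simp add: abs_mult)
        then show "\<bar>g n w - g0 w\<bar> \<le> C * \<bar>conv (\<rho> (r n)) S w - S w\<bar>"
          using C0 by (auto simp: g_def g0_def indicator_def algebra_simps)
      qed
      then show "(\<integral>w. \<bar>g n w - g0 w\<bar> \<partial>lborel) \<le> C * (\<integral>w. \<bar>conv (\<rho> (r n)) S w - S w\<bar> \<partial>lborel)" by simp
    qed
  qed
  have Y_lim: "AE w in lborel. (\<lambda>n. Y n w) \<longlonglongrightarrow> Y0 w"
    using r_lim
  proof eventually_elim
    fix w assume lim: "\<forall>f\<in>I. (\<lambda>n. conv (\<rho> (r n)) f w) \<longlonglongrightarrow> f w"
    show "(\<lambda>n. Y n w) \<longlonglongrightarrow> Y0 w"
    proof (cases "w \<in> K")
      case True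
      then have wD: "w \<in> D" using K(2) D(4) by auto
      have "(\<lambda>n. X (r n) w) \<longlonglongrightarrow> (\<Sum>i\<in>UNIV. (GG i w - V w $ i) * (aa i w - A w $ i))"
        unfolding X_def using lim by (intro tendsto_intros) (auto simp: I_def)
      also have "(\<Sum>i\<in>UNIV. (GG i w - V w $ i) * (aa i w - A w $ i)) = (G w - V w) \<bullet> (norm (G w) powr (p - 2) *\<^sub>R G w - A w)"
        using wD by (simp add: GG_def aa_def inner_vec_def)
      finally show ?thesis unfolding Y_def Y0_def using Wm_lim[OF True] by (intro tendsto_intros)
    qed (simp add: Y_def Y0_def)
  qed
  have Y0_nonneg: "0 \<le> Y0 w" for w
  proof (cases "w \<in> K")
    case True
    then show ?thesis using flux_monotone[OF p, of "G w" "V w"] A[of w] K(3)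
      by (auto simp: Y0_def W_def intro!: mult_nonneg_nonneg)
  qed (simp add: Y0_def)
  have g0_nonneg: "0 \<le> g0 w" for w using C0 S0 by (simp add: g0_def)
  \<comment> \<open>\<open>Y\<close> has no fixed integrable majorant, since gradients are merely in
    \<open>Lp\<close>. Its bound \<open>g\<close> is a mollified energy density, which converges in
    the mean; the limit of \<open>Y\<close> is nonnegative.\<close>
  note neg = negative_part_integral_tendsto_0[of Y lborel g g0 Y0, OF Ym gi g0i Yb g_lim Y_lim AE_I2[OF Y0_nonneg] g0_nonneg]
  have Yi: "integrable lborel (Y n)" for n
    unfolding Y_def by (intro continuous_indicator_integrable[OF K(1)] continuous_on_subset[OF _ K(3)] continuous_intros Wmc Xc)
  have lim0: "(\<lambda>n. \<sigma> * (\<integral>w. indicator K w * (Wm (r n) w)^2 \<partial>lborel)) \<longlonglongrightarrow> 0"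
  proof (rule tendsto_sandwich[OF _ _ tendsto_const neg(1)])
    show "\<forall>\<^sub>F n in sequentially. 0 \<le> \<sigma> * (\<integral>w. indicator K w * (Wm (r n) w)^2 \<partial>lborel)"
      using \<sigma>(1) by (intro always_eventually allI mult_nonneg_nonneg integral_nonneg_AE) auto
    show "\<forall>\<^sub>F n in sequentially. \<sigma> * (\<integral>w. indicator K w * (Wm (r n) w)^2 \<partial>lborel)
        \<le> (\<integral>w. min (max 0 (- Y n w)) (g0 w) + \<bar>g n w - g0 w\<bar> \<partial>lborel)"
    proof (intro always_eventually allI)
      fix n
      have "\<sigma> * (\<integral>w. indicator K w * (Wm (r n) w)^2 \<partial>lborel) \<le> (\<integral>w. - Y n w \<partial>lborel)"
        unfolding Y_def by (rule energy[OF rN])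
      also have "\<dots> \<le> (\<integral>w. min (max 0 (- Y n w)) (g0 w) + \<bar>g n w - g0 w\<bar> \<partial>lborel)"
        using Yi neg(2) neg(3) by (intro integral_mono) auto
      finally show "\<sigma> * (\<integral>w. indicator K w * (Wm (r n) w)^2 \<partial>lborel)
        \<le> (\<integral>w. min (max 0 (- Y n w)) (g0 w) + \<bar>g n w - g0 w\<bar> \<partial>lborel)" .
    qed
  qed
  have "(\<lambda>n. \<integral>w. indicator K w * (Wm (r n) w)^2 \<partial>lborel) \<longlonglongrightarrow> (\<integral>w. indicator K w * (W w)^2 \<partial>lborel)"
  proof (rule integral_dominated_convergence[where w="\<lambda>w. indicator K w * (B + \<kappa>)^2"])
    show "(\<lambda>w. indicator K w * (W w)^2) \<in> borel_measurable lborel"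
      unfolding W_def by (simp, intro continuous_indicator_measurable[OF K(1)] continuous_on_subset[OF _ K(3)] continuous_intros hP cont)
    show "(\<lambda>w. indicator K w * (Wm (r n) w)^2) \<in> borel_measurable lborel" for n
      by (simp, intro continuous_indicator_measurable[OF K(1)] continuous_on_subset[OF _ K(3)] continuous_intros Wmc)
    show "integrable lborel (\<lambda>w. indicator K w * (B + \<kappa>)^2)" using Ki by (rule integrable_mult_left)
    show "AE w in lborel. (\<lambda>n. indicator K w * (Wm (r n) w)^2) \<longlonglongrightarrow> indicator K w * (W w)^2"
    proof (rule AE_I2)
      fix w
      show "(\<lambda>n. indicator K w * (Wm (r n) w)^2) \<longlonglongrightarrow> indicator K w * (W w)^2"
        using Wm_lim[of w] by (cases "w \<in> K") (auto intro: tendsto_intros)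
    qed
    show "AE w in lborel. norm (indicator K w * (Wm (r n) w)^2) \<le> indicator K w * (B + \<kappa>)^2" for n
    proof (rule AE_I2)
      fix w
      show "norm (indicator K w * (Wm (r n) w)^2) \<le> indicator K w * (B + \<kappa>)^2"
      proof (cases "w \<in> K")
        case True
        then show ?thesis using Wm_bound[OF rN True, of n] by (simp add: power_mono)
      qed simp
    qed
  qed
  then have "(\<lambda>n. \<sigma> * (\<integral>w. indicator K w * (Wm (r n) w)^2 \<partial>lborel)) \<longlonglongrightarrow> \<sigma> * (\<integral>w. indicator K w * (W w)^2 \<partial>lborel)"
    by (rule tendsto_mult_left)
  then have "\<sigma> * (\<integral>w. indicator K w * (W w)^2 \<partial>lborel) = 0" using lim0 LIMSEQ_unique by blast
  then have i0: "(\<integral>w. indicator K w * (W w)^2 \<partial>lborel) = 0" using \<sigma>(1) by simp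
  have Wc: "continuous_on P (\<lambda>w. (W w)^2)" unfolding W_def by (intro continuous_intros hP cont)
  \<comment> \<open>The integral of \<open>W^2\<close> has been shown to be 0. Continuity turns this
    into vanishing everywhere, contradicting \<open>W z = \<kappa>\<close>.\<close>
  have "continuous_on UNIV (\<lambda>w. indicator K w * (W w)^2)"
  proof (rule glued_continuous[OF P0 K(1) P0s(3) cP[OF Wc]])
    fix w assume "w \<in> P0 - K"
    then have "h w - v w < \<kappa>/2" using P0s(1) by (auto simp: K_def)
    then show "(W w)^2 = 0" using \<kappa>(1) by (simp add: W_def)
  qed
  moreover have "AE w in lborel. indicator K w * (W w)^2 = 0"
    using integral_nonneg_eq_0_iff_AE[of lborel "\<lambda>w. indicator K w * (W w)^2"] i0
      continuous_indicator_integrable[OF K(1) continuous_on_subset[OF Wc K(3)]] by simp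
  ultimately have "indicator K z * (W z)^2 = 0" by (rule continuous_AE_eq_0)
  moreover have "z \<in> K" "W z = \<kappa>" using z \<kappa> by (auto simp: K_def K0_def W_def)
  ultimately show False using \<kappa>(1) by simp
qed

section \<open>Comparison on space-time boxes\<close>

lemma closure_box_cylinder:
  fixes a b :: "real^'n" and t1 t2 :: real
  assumes "\<And>i. a $ i < b $ i" "t1 < t2"
  shows "closure (box a b \<times> {t1<..<t2}) = cbox a b \<times> {t1..t2}"
proof -
  have "box a b \<noteq> {}" using assms(1) by (simp add: interval_ne_empty_cart)
  then show ?thesis using assms(2) by (simp add: closure_Times closure_box closure_greaterThanLessThan)
qed

lemma parabolic_boundary_memI:
  fixes a b :: "real^'n"
  assumes "\<And>i. a $ i < b $ i" "x \<in> cbox a b" "t1 \<le> t" "t \<le> t2" "t = t1 \<or> x \<notin> box a b"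
  shows "(x, t) \<in> parabolic_boundary (box a b) t1 t2"
proof -
  have ne: "box a b \<noteq> {}" using assms(1) by (simp add: interval_ne_empty_cart)
  show ?thesis using assms(2-5) ne
    by (cases "t = t1") (auto simp: parabolic_boundary_def closure_box frontier_box)
qed

text \<open>The term \<open>\<kappa> / (T - t)\<close> added below to the supersolution blows up at the final time; this makes the contact
  set compact and the supersolution strict.\<close>

lemma box_comparison:
  fixes h bar vt \<phi> :: "'n::finite spacetime \<Rightarrow> real" and V A :: "'n spacetime \<Rightarrow> real^'n"
    and dA :: "'n \<Rightarrow> 'n spacetime \<Rightarrow> real" and a b :: "real^'n"
  assumes p: "1 < p" and ab: "\<And>i. a $ i < b $ i" and t12: "t1 < t2"
    and par: "p_parabolic p (box a b \<times> {t1<..<t2}) h"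
    and hc: "continuous_on (closure (box a b \<times> {t1<..<t2})) h"
    and \<phi>c: "continuous_on UNIV \<phi>" and v0c: "continuous_on UNIV bar"
    and P': "P' = {z \<in> box a b \<times> {t1<..<t2}. \<phi> z < m}"
    and cont: "continuous_on P' vt" "continuous_on P' V" "continuous_on P' A" "\<And>i. continuous_on P' (dA i)"
    and part: "\<And>i z. z \<in> P' \<Longrightarrow> has_partial bar (space_dir i) (V z $ i) z"
      "\<And>z. z \<in> P' \<Longrightarrow> has_partial bar time_dir (vt z) z"
      "\<And>i z. z \<in> P' \<Longrightarrow> has_partial (\<lambda>z. A z $ i) (space_dir i) (dA i z) z"
    and A: "\<And>z. z \<in> P' \<Longrightarrow> A z = norm (V z) powr (p - 2) *\<^sub>R V z"
    and super: "\<And>z. z \<in> P' \<Longrightarrow> (\<Sum>i\<in>UNIV. dA i z) \<le> vt z"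
    and bdry: "\<And>z. z \<in> parabolic_boundary (box a b) t1 t2 \<Longrightarrow> \<phi> z \<le> m \<Longrightarrow> h z \<le> bar z"
      "\<And>z. z \<in> cbox a b \<times> {t1..t2} \<Longrightarrow> \<phi> z = m \<Longrightarrow> h z \<le> bar z"
    and z: "z \<in> P'"
  shows "h z \<le> bar z"
proof -
  note cl = closure_box_cylinder[of a b, OF ab t12]
  have P'o: "open P'"
  proof -
    have "open ((box a b \<times> {t1<..<t2}) \<inter> \<phi> -` {..<m})"
      using \<phi>c by (intro continuous_open_preimage open_Times) (auto intro: continuous_on_subset)
    moreover have "(box a b \<times> {t1<..<t2}) \<inter> \<phi> -` {..<m} = P'" by (auto simp: P')
    ultimately show ?thesis by simp
  qed
  \<comment> \<open>An auxiliary final time strictly between that of \<open>z\<close> and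
    \<open>t2\<close>; the penalty blows up at \<open>T\<close>.\<close>
  define T where "T = (snd z + t2) / 2"
  have zt: "t1 < snd z" "snd z < t2" using z by (auto simp: P')
  have T: "snd z < T" "T < t2" "t1 < T" using zt by (auto simp: T_def)
  have approx: "h z \<le> bar z + \<kappa> + \<kappa> / (T - snd z)" if \<kappa>: "\<kappa> > 0" for \<kappa>
  proof -
    define P where "P = P' \<inter> {w. snd w < T}"
    define v where "v w = bar w + (\<kappa> + \<kappa> / (T - snd w))" for w
    have PP': "P \<subseteq> P'" by (simp add: P_def)
    have tP: "t1 < snd w \<and> snd w < T" if "w \<in> P" for w using that by (auto simp: P_def P')
    \<comment> \<open>The contact condition multiplied by \<open>T - snd w\<close>, which makes it
      meaningful and closed up to time \<open>T\<close>. At time \<open>T\<close> the product is 0,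
      less than \<kappa>, so this closed set avoids the final time by itself. The assumptions
      \<open>bdry\<close> keep it off the parabolic boundary and off the level
      \<open>\<phi> = m\<close>.\<close>
    define K where "K = (cbox a b \<times> {t1..T}) \<inter> {w. \<phi> w \<le> m} \<inter> {w \<in> cbox a b \<times> {t1..t2}. \<kappa> \<le> (h w - bar w - \<kappa>) * (T - snd w)}"
    have "closed {w \<in> cbox a b \<times> {t1..t2}. \<kappa> \<le> (h w - bar w - \<kappa>) * (T - snd w)}"
    proof -
      have "continuous_on (cbox a b \<times> {t1..t2}) (\<lambda>w. (h w - bar w - \<kappa>) * (T - snd w))"
        using hc[unfolded cl] v0c by (intro continuous_intros) (auto intro: continuous_on_subset)
      then have "closed ((cbox a b \<times> {t1..t2}) \<inter> (\<lambda>w. (h w - bar w - \<kappa>) * (T - snd w)) -` {\<kappa>..})"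
        by (intro continuous_closed_preimage closed_Times) auto
      moreover have "(cbox a b \<times> {t1..t2}) \<inter> (\<lambda>w. (h w - bar w - \<kappa>) * (T - snd w)) -` {\<kappa>..}
          = {w \<in> cbox a b \<times> {t1..t2}. \<kappa> \<le> (h w - bar w - \<kappa>) * (T - snd w)}" by auto
      ultimately show ?thesis by simp
    qed
    moreover have "closed {w. \<phi> w \<le> m}" using \<phi>c by (intro closed_Collect_le continuous_intros)
    ultimately have cK: "compact K" unfolding K_def by (intro compact_Int_closed compact_Times) auto
    have "{w\<in>P. v w \<le> h w} = K"
    proof (intro equalityI subsetI)
      fix w assume "w \<in> {w\<in>P. v w \<le> h w}"
      then have w: "w \<in> P" "v w \<le> h w" by auto
      then have "\<kappa> / (T - snd w) \<le> h w - bar w - \<kappa>" "T - snd w > 0" using tP[of w] by (auto simp: v_def)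
      then have "\<kappa> \<le> (h w - bar w - \<kappa>) * (T - snd w)" by (simp add: pos_divide_le_eq)
      moreover have "w \<in> cbox a b \<times> {t1..t2}" "w \<in> cbox a b \<times> {t1..T}" "\<phi> w \<le> m"
        using w(1) T(2) box_subset_cbox[of a b] by (auto simp: P_def P' mem_Times_iff)
      ultimately show "w \<in> K" by (simp add: K_def)
    next
      fix w assume "w \<in> K"
      then have w: "w \<in> cbox a b \<times> {t1..T}" "\<phi> w \<le> m" "w \<in> cbox a b \<times> {t1..t2}"
        and k: "\<kappa> \<le> (h w - bar w - \<kappa>) * (T - snd w)" by (auto simp: K_def)
      have "T - snd w \<ge> 0" using w(1) by (auto simp: mem_Times_iff)
      moreover have "T - snd w \<noteq> 0" using k \<kappa> by auto
      ultimately have Tw: "T - snd w > 0" by simp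
      then have "h w - bar w - \<kappa> > 0" using k \<kappa> by (smt (verit) mult_nonpos_nonneg)
      then have gt: "h w > bar w" using \<kappa> by simp
      have "w \<notin> parabolic_boundary (box a b) t1 t2" using bdry(1)[of w] w(2) gt by force
      then have "\<not> (snd w = t1 \<or> fst w \<notin> box a b)"
        using parabolic_boundary_memI[OF ab, of "fst w" t1 "snd w" t2] w(3) by (auto simp: mem_Times_iff)
      moreover have "\<phi> w \<noteq> m" using bdry(2)[OF w(3)] gt by force
      ultimately have "w \<in> P" using w Tw T by (auto simp: P_def P' mem_Times_iff)
      moreover have "\<kappa> / (T - snd w) \<le> h w - bar w - \<kappa>" using k Tw by (simp add: pos_divide_le_eq)
      then have "v w \<le> h w" by (simp add: v_def)
      ultimately show "w \<in> {w\<in>P. v w \<le> h w}" by simp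
    qed
    then have cpt: "compact {w\<in>P. v w \<le> h w}" using cK by simp
    have open_P: "open P"
    proof -
      have "open {w :: 'n spacetime. snd w < T}" by (intro open_Collect_less continuous_intros)
      then show ?thesis unfolding P_def using P'o by (rule open_Int[rotated])
    qed
    have pt: "has_partial (\<lambda>w. \<kappa> + \<kappa> / (T - snd w)) time_dir (\<kappa> / (T - snd w)^2) w"
      "has_partial (\<lambda>w. \<kappa> + \<kappa> / (T - snd w)) (space_dir i) 0 w" if "w \<in> P" for w :: "'n spacetime" and i
      using tP[OF that] unfolding has_partial_def time_dir_def space_dir_def
      by (auto intro!: derivative_eq_intros simp: power2_eq_square)
    have add: "has_partial (\<lambda>w. f w + g w) e (d + d') w" if "has_partial f e d w" "has_partial g e d' w"
      for f g :: "'n spacetime \<Rightarrow> real" and e d d' w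
      using that unfolding has_partial_def by (rule DERIV_add)
    have "h z \<le> v z"
    \<comment> \<open>The penalty has time derivative \<open>\<kappa> / (T - t)^2\<close>, at least
      \<open>\<kappa> / (T - t1)^2\<close>; this is the strictness \<sigma>.\<close>
    proof (rule weak_comparison[OF p par open_box open_P _ cpt, where V=V and A=A and dA=dA and vt="\<lambda>w. vt w + \<kappa> / (T - snd w)^2" and \<sigma>="\<kappa> / (T - t1)^2"])
      show "P \<subseteq> box a b \<times> {t1<..<t2}" by (auto simp: P_def P')
      show "continuous_on P v" "continuous_on P (\<lambda>w. vt w + \<kappa> / (T - snd w)^2)"
        unfolding v_def using v0c cont(1) PP' tP
        by (auto intro!: continuous_intros intro: continuous_on_subset) (force intro: continuous_on_subset)+
      show "continuous_on P V" "continuous_on P A" "\<And>i. continuous_on P (dA i)"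
        using cont PP' continuous_on_subset by blast+
      show "has_partial v (space_dir i) (V w $ i) w" if "w \<in> P" for i w
        using add[OF part(1)[of w i] pt(2)[OF that]] PP' that unfolding v_def by auto
      show "has_partial v time_dir (vt w + \<kappa> / (T - snd w)^2) w" if "w \<in> P" for w
        using add[OF part(2)[of w] pt(1)[OF that]] PP' that unfolding v_def by auto
      show "has_partial (\<lambda>z. A z $ i) (space_dir i) (dA i w) w" if "w \<in> P" for i w
        using part(3) PP' that by blast
      show "A w = norm (V w) powr (p - 2) *\<^sub>R V w" if "w \<in> P" for w using A PP' that by blast
      show "\<kappa> / (T - t1)^2 > 0" using \<kappa> T by simp
      show "(\<Sum>i\<in>UNIV. dA i w) + \<kappa> / (T - t1)^2 \<le> vt w + \<kappa> / (T - snd w)^2" if w: "w \<in> P" for w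
      proof -
        have "(T - snd w)^2 \<le> (T - t1)^2" using tP[OF w] by (intro power_mono) auto
        then have "\<kappa> / (T - t1)^2 \<le> \<kappa> / (T - snd w)^2"
          using \<kappa> tP[OF w] by (intro divide_left_mono) auto
        then show ?thesis using super[of w] w PP' by auto
      qed
      show "z \<in> P" using z T by (simp add: P_def)
    qed
    then show ?thesis by (simp add: v_def)
  qed
  show ?thesis
  proof (rule field_le_epsilon)
    fix e :: real assume e: "0 < e"
    \<comment> \<open>The total error in \<open>approx\<close> is \<kappa> times \<open>k\<close>,
      so \<open>\<kappa> = e / k\<close> makes it \<open>e\<close>.\<close>
    define k where "k = 1 + 1 / (T - snd z)"
    have k: "k > 0" using T by (simp add: k_def add_pos_pos)
    have "h z \<le> bar z + e / k + e / k / (T - snd z)" using approx[of "e / k"] e k by simp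
    also have "\<dots> = bar z + (e / k) * k" by (simp add: k_def algebra_simps add_divide_distrib)
    finally show "h z \<le> bar z + e" using k by simp
  qed
qed

section \<open>The Gaussian barrier\<close>

definition gauss :: "real \<Rightarrow> real \<Rightarrow> 'n::finite spacetime \<Rightarrow> 'n spacetime \<Rightarrow> real" where
  "gauss B \<gamma> \<zeta> z = B * exp (- \<gamma> * (norm (z - \<zeta>))^2)"

text \<open>With \<open>E\<close> the Gaussian and \<open>r\<close> the spatial distance to the
  centre, the spatial gradient has length \<open>2 * \<gamma> * E * r\<close> and the time
  derivative has size \<open>2 * \<gamma> * E\<close> times the time distance. Dividing the latter
  by the factor \<open>(2 * \<gamma> * E) powr (p - 1) * r powr (p - 2)\<close> of the divergence
  leaves this expression.\<close>

definition slope_ratio :: "real \<Rightarrow> real \<Rightarrow> real \<Rightarrow> 'n::finite spacetime \<Rightarrow> 'n spacetime \<Rightarrow> real" where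
  "slope_ratio p B \<gamma> \<zeta> z = (2 * \<gamma> * gauss B \<gamma> \<zeta> z * norm (fst z - fst \<zeta>)) powr (2 - p) * \<bar>snd z - snd \<zeta>\<bar>"

lemma gauss_continuous: "continuous_on S (gauss B \<gamma> \<zeta>)"
  unfolding gauss_def by (intro continuous_intros)

lemma gauss_partial:
  "has_partial (gauss B \<gamma> \<zeta>) e (- (2 * \<gamma> * ((z - \<zeta>) \<bullet> e)) * gauss B \<gamma> \<zeta> z) z"
proof -
  have eq: "(norm (z + s *\<^sub>R e - \<zeta>))^2 = (norm (z - \<zeta>))^2 + 2 * s * ((z - \<zeta>) \<bullet> e) + s^2 * (norm e)^2" for s
    unfolding power2_norm_eq_inner by (simp add: inner_simps inner_commute power2_eq_square algebra_simps)
  show ?thesis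
    unfolding has_partial_def gauss_def eq by (auto intro!: derivative_eq_intros simp: algebra_simps)
qed

lemma inner_space_dir: "z \<bullet> space_dir i = fst z $ i"
  by (simp add: space_dir_def inner_prod_def inner_axis)

lemma inner_time_dir: "z \<bullet> time_dir = snd z"
  by (simp add: time_dir_def inner_prod_def)

text \<open>The norm is written through its square, which is a polynomial along lines.\<close>

lemma radial_powr_partial:
  fixes y :: "real^'n::finite"
  assumes "fst z \<noteq> y"
  shows "has_partial (\<lambda>z. norm (fst z - y) powr q) (space_dir i)
    (q * norm (fst z - y) powr (q - 2) * (fst z $ i - y $ i)) z"
proof -
  let ?r = "norm (fst z - y)"
  have r: "?r > 0" using assms by simp
  have eq: "(norm (fst (z + s *\<^sub>R space_dir i) - y))^2 = ?r^2 + 2 * s * (fst z $ i - y $ i) + s^2" for s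
  proof -
    define w where "w = fst z - y"
    have "fst (z + s *\<^sub>R space_dir i) - y = w + s *\<^sub>R axis i 1" by (simp add: space_dir_def w_def)
    moreover have "fst z $ i - y $ i = w $ i" by (simp add: w_def)
    moreover have "(norm (w + s *\<^sub>R axis i 1))^2 = (norm w)^2 + 2 * s * w $ i + s^2"
      unfolding power2_norm_eq_inner
      by (simp add: inner_add_left inner_add_right inner_axis inner_axis' inner_axis_axis power2_eq_square algebra_simps)
    ultimately show ?thesis by (simp only: w_def)
  qed
  have sq: "(x^2) powr c = x powr (2 * c)" if "x \<ge> 0" for x c :: real
  proof (cases "x = 0")
    case False
    then have "x^2 = x powr 2" using that by simp
    then show ?thesis by (simp only: powr_powr)
  qed simp
  have pw: "norm w powr q = ((norm w)^2) powr (q / 2)" for w :: "real^'n"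
    using sq[of "norm w" "q / 2"] by simp
  have "((\<lambda>s. (?r^2 + 2 * s * (fst z $ i - y $ i) + s^2) powr (q / 2)) has_real_derivative
      (q / 2) * (?r^2) powr (q / 2 - 1) * (2 * (fst z $ i - y $ i))) (at 0)"
    using r by (auto intro!: derivative_eq_intros)
  also have "(q / 2) * (?r^2) powr (q / 2 - 1) * (2 * (fst z $ i - y $ i)) = q * ?r powr (q - 2) * (fst z $ i - y $ i)"
    using sq[of ?r "q / 2 - 1"] by (simp add: right_diff_distrib)
  finally show ?thesis unfolding has_partial_def pw eq .
qed

text \<open>For a constant minus the Gaussian. The flux is a scalar function times
  \<open>x - y\<close>, \<open>y\<close> being the spatial centre. Summing the diagonal derivatives
  replaces each squared coordinate sum by \<open>r^2\<close>, so the divergence is the factor times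
  \<open>n + p - 2 - 2 * \<gamma> * (p - 1) * r^2\<close>, and \<open>cond\<close> compares this
  with \<open>slope_ratio\<close>.\<close>

lemma gauss_supersolution:
  fixes \<zeta> z :: "'n::finite spacetime"
  assumes p: "1 < p" and B: "B > 0" "\<gamma> > 0"
    and x: "fst z \<noteq> fst \<zeta>"
    and cond: "slope_ratio p B \<gamma> \<zeta> z + real CARD('n) + p - 2 < \<gamma> * (p - 1) * (norm (fst z - fst \<zeta>))^2"
  defines "E \<equiv> gauss B \<gamma> \<zeta>" and "r \<equiv> \<lambda>z. norm (fst z - fst \<zeta>)"
  defines "dA \<equiv> \<lambda>i z. (2 * \<gamma> * E z) powr (p - 1) * r z powr (p - 2) *
      (1 + (p - 2) * (fst z $ i - fst \<zeta> $ i)^2 / (r z)^2 - 2 * \<gamma> * (p - 1) * (fst z $ i - fst \<zeta> $ i)^2)"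
  shows "has_partial (\<lambda>z. ((2 * \<gamma> * E z) powr (p - 1) * r z powr (p - 2)) *\<^sub>R (fst z - fst \<zeta>) $ i) (space_dir i) (dA i z) z"
    "((2 * \<gamma> * E z) powr (p - 1) * r z powr (p - 2)) *\<^sub>R (fst z - fst \<zeta>)
      = norm ((2 * \<gamma> * E z) *\<^sub>R (fst z - fst \<zeta>)) powr (p - 2) *\<^sub>R ((2 * \<gamma> * E z) *\<^sub>R (fst z - fst \<zeta>))"
    "(\<Sum>i\<in>UNIV. dA i z) \<le> 2 * \<gamma> * E z * (snd z - snd \<zeta>)"
proof -
  have E: "E w > 0" for w using B by (simp add: E_def gauss_def)
  have r: "r z > 0" using x by (simp add: r_def)
  define g where "g = 2 * \<gamma> * E z"
  have g: "g > 0" using E[of z] B by (simp add: g_def)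
  have gp: "g powr (p - 1) = g * g powr (p - 2)" using powr_mult_base[of g "p - 2"] g by simp
  show "((2 * \<gamma> * E z) powr (p - 1) * r z powr (p - 2)) *\<^sub>R (fst z - fst \<zeta>)
      = norm ((2 * \<gamma> * E z) *\<^sub>R (fst z - fst \<zeta>)) powr (p - 2) *\<^sub>R ((2 * \<gamma> * E z) *\<^sub>R (fst z - fst \<zeta>))"
    unfolding g_def[symmetric] gp using g by (simp add: powr_mult r_def mult_ac)
  have 1: "has_partial (\<lambda>z. (2 * \<gamma> * E z) powr (p - 1)) (space_dir i)
      (- (2 * \<gamma> * (p - 1) * (fst z $ i - fst \<zeta> $ i)) * g powr (p - 1)) z"
  proof -
    have "has_partial E (space_dir i) (- (2 * \<gamma> * (fst z $ i - fst \<zeta> $ i)) * E z) z"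
      using gauss_partial[of B \<gamma> \<zeta> "space_dir i" z] by (simp add: E_def inner_space_dir)
    moreover have "((\<lambda>e. (2 * \<gamma> * e) powr (p - 1)) has_real_derivative (p - 1) * g powr (p - 1 - 1) * (2 * \<gamma>)) (at (E z))"
      using g unfolding g_def by (auto intro!: derivative_eq_intros)
    ultimately have "has_partial (\<lambda>z. (2 * \<gamma> * E z) powr (p - 1)) (space_dir i)
        ((p - 1) * g powr (p - 1 - 1) * (2 * \<gamma>) * (- (2 * \<gamma> * (fst z $ i - fst \<zeta> $ i)) * E z)) z"
      by (rule has_partial_compose)
    also have "(p - 1) * g powr (p - 1 - 1) * (2 * \<gamma>) * (- (2 * \<gamma> * (fst z $ i - fst \<zeta> $ i)) * E z)
        = - (2 * \<gamma> * (p - 1) * (fst z $ i - fst \<zeta> $ i)) * (g * g powr (p - 2))"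
      by (simp add: g_def)
    finally show ?thesis unfolding gp .
  qed
  have 2: "has_partial (\<lambda>z. r z powr (p - 2)) (space_dir i) ((p - 2) * r z powr (p - 4) * (fst z $ i - fst \<zeta> $ i)) z"
    using radial_powr_partial[OF x, of "p - 2" i] by (simp add: r_def)
  have 3: "has_partial (\<lambda>z. fst z $ i - fst \<zeta> $ i) (space_dir i) 1 z"
    unfolding has_partial_def space_dir_def by (auto intro!: derivative_eq_intros)
  have r4: "r z powr (p - 4) = r z powr (p - 2) / (r z)^2"
  proof -
    have "r z powr (p - 2 - 2) = r z powr (p - 2) / r z powr 2" by (rule powr_diff)
    then show ?thesis using r by simp
  qed
  have "has_partial (\<lambda>z. (2 * \<gamma> * E z) powr (p - 1) * r z powr (p - 2) * (fst z $ i - fst \<zeta> $ i)) (space_dir i)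
     ((- (2 * \<gamma> * (p - 1) * (fst z $ i - fst \<zeta> $ i)) * g powr (p - 1) * r z powr (p - 2)
       + (2 * \<gamma> * E z) powr (p - 1) * ((p - 2) * r z powr (p - 4) * (fst z $ i - fst \<zeta> $ i))) * (fst z $ i - fst \<zeta> $ i)
       + (2 * \<gamma> * E z) powr (p - 1) * r z powr (p - 2) * 1) z"
    by (intro has_partial_mult 1 2 3)
  then show "has_partial (\<lambda>z. ((2 * \<gamma> * E z) powr (p - 1) * r z powr (p - 2)) *\<^sub>R (fst z - fst \<zeta>) $ i) (space_dir i) (dA i z) z"
    unfolding r4 by (simp add: dA_def g_def power2_eq_square algebra_simps)
  have sq: "(\<Sum>i\<in>UNIV. (fst z $ i - fst \<zeta> $ i)^2) = (r z)^2"
    unfolding r_def power2_norm_eq_inner inner_vec_def by (simp add: power2_eq_square)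
  let ?F = "g powr (p - 1) * r z powr (p - 2)"
  have "(\<Sum>i\<in>UNIV. dA i z) = ?F * (real CARD('n) + (p - 2) / (r z)^2 * (\<Sum>i\<in>UNIV. (fst z $ i - fst \<zeta> $ i)^2)
      - 2 * \<gamma> * (p - 1) * (\<Sum>i\<in>UNIV. (fst z $ i - fst \<zeta> $ i)^2))"
    unfolding dA_def g_def[symmetric] sum_distrib_left[symmetric] sum_subtractf sum.distrib
    by (simp add: sum_distrib_left)
  also have "\<dots> = ?F * (real CARD('n) + p - 2 - 2 * \<gamma> * (p - 1) * (r z)^2)"
    unfolding sq using r by simp
  also have "\<dots> \<le> ?F * (- slope_ratio p B \<gamma> \<zeta> z)"
  proof (rule mult_left_mono)
    \<comment> \<open>The divergence offers \<open>\<gamma> * (p - 1) * r^2\<close> twice, while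
      \<open>cond\<close> counts it once. One copy is given away here, so that the same condition
      also fits the touching argument for the lower bound.\<close>
    have "0 \<le> \<gamma> * (p - 1) * (r z)^2" using p B by simp
    moreover have "real CARD('n) + p - 2 < \<gamma> * (p - 1) * (r z)^2 - slope_ratio p B \<gamma> \<zeta> z"
      using cond by (simp add: r_def)
    ultimately show "real CARD('n) + p - 2 - 2 * \<gamma> * (p - 1) * (r z)^2 \<le> - slope_ratio p B \<gamma> \<zeta> z"
      by (simp add: mult.assoc)
  qed (simp add: mult_nonneg_nonneg)
  also have "\<dots> = - (g * \<bar>snd z - snd \<zeta>\<bar>)"
  proof -
    have "slope_ratio p B \<gamma> \<zeta> z = (g * r z) powr (2 - p) * \<bar>snd z - snd \<zeta>\<bar>"
      by (simp add: slope_ratio_def g_def E_def r_def)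
    moreover have "?F * (g * r z) powr (2 - p) = g"
      unfolding gp using g r by (simp add: powr_mult powr_add[symmetric] mult_ac)
    ultimately show ?thesis by (metis mult.assoc mult_minus_right)
  qed
  also have "\<dots> \<le> g * (snd z - snd \<zeta>)" using g abs_ge_minus_self[of "snd z - snd \<zeta>"]
    by (metis minus_le_iff mult_left_mono mult_minus_right less_imp_le)
  finally show "(\<Sum>i\<in>UNIV. dA i z) \<le> 2 * \<gamma> * E z * (snd z - snd \<zeta>)" by (simp add: g_def)
qed

section \<open>The truncated barrier is superparabolic\<close>

lemma continuous_superparabolicI:
  assumes "continuous_on UNIV w"
    and "\<And>a b t1 t2 h. (\<And>i. a $ i < b $ i) \<Longrightarrow> t1 < t2 \<Longrightarrow> cbox a b \<times> {t1..t2} \<subseteq> \<Theta> \<Longrightarrow>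
          p_parabolic p (box a b \<times> {t1<..<t2}) h \<Longrightarrow> continuous_on (closure (box a b \<times> {t1<..<t2})) h \<Longrightarrow>
          (\<And>\<xi>. \<xi> \<in> parabolic_boundary (box a b) t1 t2 \<Longrightarrow> h \<xi> \<le> w \<xi>) \<Longrightarrow>
          (\<And>\<xi>. \<xi> \<in> box a b \<times> {t1<..<t2} \<Longrightarrow> h \<xi> \<le> w \<xi>)"
  shows "p_superparabolic p \<Theta> (\<lambda>z. ereal (w z))"
  unfolding p_superparabolic_def
proof (intro conjI allI impI)
  show "\<forall>\<xi>\<in>\<Theta>. ereal (w \<xi>) \<noteq> - \<infinity>" by simp
  show "lower_semicontinuous_on \<Theta> (\<lambda>z. ereal (w z))"
    unfolding lower_semicontinuous_on_def
  proof
    fix \<xi> assume "\<xi> \<in> \<Theta>"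
    have "(w \<longlongrightarrow> w \<xi>) (at \<xi> within \<Theta>)"
      using assms(1) continuous_on_eq_continuous_at[OF open_UNIV] continuous_at_imp_continuous_at_within
      unfolding continuous_within by blast
    then have "((\<lambda>z. ereal (w z)) \<longlongrightarrow> ereal (w \<xi>)) (at \<xi> within \<Theta>)" by (rule tendsto_ereal)
    then show "ereal (w \<xi>) \<le> Liminf (at \<xi> within \<Theta>) (\<lambda>z. ereal (w z))"
      unfolding le_Liminf_iff using order_tendstoD(1) by blast
  qed
  show "\<Theta> \<subseteq> closure {\<xi> \<in> \<Theta>. ereal (w \<xi>) < \<infinity>}" using closure_subset by auto
next
  fix a b :: "real^'a" and t1 t2 h
  assume *: "(\<forall>i. a $ i < b $ i) \<and> t1 < t2 \<and> compactly_contained (box a b \<times> {t1<..<t2}) \<Theta>"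
    and h: "p_parabolic p (box a b \<times> {t1<..<t2}) h \<and>
             continuous_on (closure (box a b \<times> {t1<..<t2})) h \<and>
             (\<forall>\<xi>\<in>parabolic_boundary (box a b) t1 t2. ereal (h \<xi>) \<le> ereal (w \<xi>))"
  have "cbox a b \<times> {t1..t2} \<subseteq> \<Theta>"
    using * closure_box_cylinder[of a b t1 t2] by (simp add: compactly_contained_def)
  then show "\<forall>\<xi>\<in>box a b \<times> {t1<..<t2}. ereal (h \<xi>) \<le> ereal (w \<xi>)"
    using assms(2)[of a b t1 t2 h] * h by auto
qed

text \<open>A constant is a supersolution with vanishing flux; taking \<open>\<phi> = 0\<close>
  below the level 1 makes the comparison region the whole box.\<close>

lemma p_parabolic_le_const:
  fixes a b :: "real^'n::finite"
  assumes p: "1 < p" and ab: "\<And>i. a $ i < b $ i" and t12: "t1 < t2"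
    and par: "p_parabolic p (box a b \<times> {t1<..<t2}) h"
    and hc: "continuous_on (closure (box a b \<times> {t1<..<t2})) h"
    and bdry: "\<And>z. z \<in> parabolic_boundary (box a b) t1 t2 \<Longrightarrow> h z \<le> c"
    and z: "z \<in> closure (box a b \<times> {t1<..<t2})"
  shows "h z \<le> c"
proof (rule continuous_le_on_closure[OF hc z])
  fix w assume w: "w \<in> box a b \<times> {t1<..<t2}"
  show "h w \<le> c"
    by (rule box_comparison[OF p ab t12 par hc, where \<phi>="\<lambda>_. 0" and m=1 and bar="\<lambda>_. c" and vt="\<lambda>_. 0"
          and V="\<lambda>_. 0" and A="\<lambda>_. 0" and dA="\<lambda>_ _. 0" and P'="box a b \<times> {t1<..<t2}"])
      (use w bdry in \<open>auto simp: has_partial_def\<close>)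
qed

text \<open>\<open>K - gauss\<close> is a supersolution only below the level \<open>M\<close>, so
  the comparison takes place in that sublevel set. The inequality on the rest of its boundary, the
  level set itself, comes from the maximum principle.\<close>

lemma barrier_superparabolic:
  fixes \<Theta> :: "'n::finite spacetime set"
  assumes p: "1 < p" and B: "B > 0" "\<gamma> > 0"
    and cond: "\<And>z. z \<in> \<Theta> \<Longrightarrow> K - gauss B \<gamma> \<zeta> z < M \<Longrightarrow> fst z \<noteq> fst \<zeta> \<and>
      slope_ratio p B \<gamma> \<zeta> z + real CARD('n) + p - 2 < \<gamma> * (p - 1) * (norm (fst z - fst \<zeta>))^2"
  shows "p_superparabolic p \<Theta> (\<lambda>z. ereal (c + min (K - gauss B \<gamma> \<zeta> z) M))"
proof (rule continuous_superparabolicI)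
  show "continuous_on UNIV (\<lambda>z. c + min (K - gauss B \<gamma> \<zeta> z) M)"
    by (intro continuous_intros gauss_continuous)
  fix a b :: "real^'n" and t1 t2 h \<xi>
  assume ab: "\<And>i. a $ i < b $ i" and t12: "t1 < t2" and sub: "cbox a b \<times> {t1..t2} \<subseteq> \<Theta>"
    and par: "p_parabolic p (box a b \<times> {t1<..<t2}) h" and hc: "continuous_on (closure (box a b \<times> {t1<..<t2})) h"
    and bdry: "\<And>\<xi>. \<xi> \<in> parabolic_boundary (box a b) t1 t2 \<Longrightarrow> h \<xi> \<le> c + min (K - gauss B \<gamma> \<zeta> \<xi>) M"
    and \<xi>: "\<xi> \<in> box a b \<times> {t1<..<t2}"
  \<comment> \<open>On the parabolic boundary \<open>h\<close> is at most \<open>c + M\<close>,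
    hence on the whole closed box. Where the barrier equals \<open>M\<close> this is the inequality
    needed there.\<close>
  have le_M: "h z \<le> c + M" if "z \<in> cbox a b \<times> {t1..t2}" for z
    by (rule p_parabolic_le_const[OF p ab t12 par hc])
      (use bdry that closure_box_cylinder[of a b, OF ab t12] in force)+
  show "h \<xi> \<le> c + min (K - gauss B \<gamma> \<zeta> \<xi>) M"
  proof (cases "K - gauss B \<gamma> \<zeta> \<xi> < M")
    case False
    then show ?thesis using le_M[of \<xi>] \<xi> box_subset_cbox[of a b] by (force simp: mem_Times_iff)
  next
    case True
    let ?E = "gauss B \<gamma> \<zeta>" and ?r = "\<lambda>z::'n spacetime. norm (fst z - fst \<zeta>)"
    let ?V = "\<lambda>z. (2 * \<gamma> * ?E z) *\<^sub>R (fst z - fst \<zeta>)"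
    let ?A = "\<lambda>z. ((2 * \<gamma> * ?E z) powr (p - 1) * ?r z powr (p - 2)) *\<^sub>R (fst z - fst \<zeta>)"
    let ?dA = "\<lambda>i z. (2 * \<gamma> * ?E z) powr (p - 1) * ?r z powr (p - 2) *
      (1 + (p - 2) * (fst z $ i - fst \<zeta> $ i)^2 / (?r z)^2 - 2 * \<gamma> * (p - 1) * (fst z $ i - fst \<zeta> $ i)^2)"
    define P' where "P' = {z \<in> box a b \<times> {t1<..<t2}. K - ?E z < M}"
    have P': "fst z \<noteq> fst \<zeta>" "slope_ratio p B \<gamma> \<zeta> z + real CARD('n) + p - 2 < \<gamma> * (p - 1) * (?r z)^2"
      if "z \<in> P'" for z
    proof -
      have "z \<in> cbox a b \<times> {t1..t2}" using that box_subset_cbox[of a b] by (auto simp: P'_def mem_Times_iff)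
      then have "z \<in> \<Theta>" using sub by blast
      then show "fst z \<noteq> fst \<zeta>" "slope_ratio p B \<gamma> \<zeta> z + real CARD('n) + p - 2 < \<gamma> * (p - 1) * (?r z)^2"
        using cond[of z] that by (auto simp: P'_def)
    qed
    have Epos: "?E z > 0" for z using B by (simp add: gauss_def)
    have "h \<xi> \<le> c + (K - ?E \<xi>)"
    proof (rule box_comparison[OF p ab t12 par hc, where \<phi>="\<lambda>z. K - ?E z" and m=M and bar="\<lambda>z. c + (K - ?E z)"
          and vt="\<lambda>z. 2 * \<gamma> * ?E z * (snd z - snd \<zeta>)" and V="?V" and A="?A" and dA="?dA" and P'=P'])
      show "P' = {z \<in> box a b \<times> {t1<..<t2}. K - ?E z < M}" by (simp add: P'_def)
      show "continuous_on UNIV (\<lambda>z. K - ?E z)" "continuous_on UNIV (\<lambda>z. c + (K - ?E z))"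
        "continuous_on P' (\<lambda>z. 2 * \<gamma> * ?E z * (snd z - snd \<zeta>))" "continuous_on P' ?V"
        by (intro continuous_intros gauss_continuous)+
      show "continuous_on P' ?A" "continuous_on P' (?dA i)" for i
        using P'(1) Epos B by (auto intro!: continuous_intros gauss_continuous simp: less_imp_neq[symmetric] less_imp_le)
      show "\<xi> \<in> P'" using \<xi> True by (simp add: P'_def)
      show "h z \<le> c + (K - ?E z)" if "z \<in> parabolic_boundary (box a b) t1 t2" for z
        using bdry[OF that] by simp
      show "h z \<le> c + (K - ?E z)" if "z \<in> cbox a b \<times> {t1..t2}" "K - ?E z = M" for z
        using le_M[OF that(1)] that(2) by simp
      have part: "has_partial (\<lambda>z. c + (K - ?E z)) e (2 * \<gamma> * ((z - \<zeta>) \<bullet> e) * ?E z) z" for e z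
        using gauss_partial[of B \<gamma> \<zeta> e z] unfolding has_partial_def by (auto intro!: derivative_eq_intros)
      show "has_partial (\<lambda>z. c + (K - ?E z)) (space_dir i) (?V z $ i) z" for i z
        using part[of "space_dir i" z] by (simp add: inner_space_dir algebra_simps)
      show "has_partial (\<lambda>z. c + (K - ?E z)) time_dir (2 * \<gamma> * ?E z * (snd z - snd \<zeta>)) z" for z
        using part[of time_dir z] by (simp add: inner_time_dir algebra_simps)
      show "has_partial (\<lambda>z. ?A z $ i) (space_dir i) (?dA i z) z" if "z \<in> P'" for i z
        using gauss_supersolution(1)[OF p B P'[OF that], of i] by simp
      show "?A z = norm (?V z) powr (p - 2) *\<^sub>R ?V z" if "z \<in> P'" for z
        by (rule gauss_supersolution(2)[OF p B P'[OF that]])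
      show "(\<Sum>i\<in>UNIV. ?dA i z) \<le> 2 * \<gamma> * ?E z * (snd z - snd \<zeta>)" if "z \<in> P'" for z
        by (rule gauss_supersolution(3)[OF p B P'[OF that]])
    qed
    then show ?thesis using True by simp
  qed
qed

section \<open>Explicit solutions\<close>

lemma test_functions_D:
  assumes "\<phi> \<in> test_functions D"
  shows "\<phi> differentiable (at z)" "continuous_on UNIV \<phi>"
    "e \<in> Basis \<Longrightarrow> continuous_on UNIV (\<lambda>z. frechet_derivative \<phi> (at z) e)"
    "compact (closure {z. \<phi> z \<noteq> 0})" "closure {z. \<phi> z \<noteq> 0} \<subseteq> D"
    "z \<notin> closure {z. \<phi> z \<noteq> 0} \<Longrightarrow> \<phi> z = 0"
    "z \<notin> closure {z. \<phi> z \<noteq> 0} \<Longrightarrow> frechet_derivative \<phi> (at z) e = 0"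
proof -
  have k: "Ck 1 \<phi>" "Ck 0 \<phi>" using assms unfolding test_functions_def by blast+
  show d: "\<phi> differentiable (at z)" for z using k(1) unfolding One_nat_def Ck.simps by blast
  show "continuous_on UNIV \<phi>" using k(2) by simp
  show "e \<in> Basis \<Longrightarrow> continuous_on UNIV (\<lambda>z. frechet_derivative \<phi> (at z) e)"
    using k(1) unfolding One_nat_def Ck.simps by blast
  show "compact (closure {z. \<phi> z \<noteq> 0})" "closure {z. \<phi> z \<noteq> 0} \<subseteq> D"
    using assms unfolding test_functions_def compactly_contained_def by blast+
  show z0: "z \<notin> closure {z. \<phi> z \<noteq> 0} \<Longrightarrow> \<phi> z = 0" for z
    using closure_subset[of "{z. \<phi> z \<noteq> 0}"] by blast
  assume z: "z \<notin> closure {z. \<phi> z \<noteq> 0}"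
  show "frechet_derivative \<phi> (at z) e = 0"
    by (rule has_partial_zeroD[OF has_partial_frechet[OF d], of "- closure {z. \<phi> z \<noteq> 0}"])
      (rule open_Compl[OF closed_closure], use z in simp, intro z0, simp)
qed

lemma continuous_closure_Lp:
  fixes f :: "'a::euclidean_space \<Rightarrow> 'b::euclidean_space"
  assumes "open D" "compact (closure D)" "continuous_on (closure D) f" "0 < p"
  shows "f \<in> Lp p D" "set_integrable lborel D f"
proof -
  have D: "D \<in> sets borel" "D \<subseteq> closure D" using assms(1) closure_subset by auto
  have n: "continuous_on (closure D) (\<lambda>x. norm (f x) powr p)"
    using assms by (intro continuous_on_powr') (auto intro!: continuous_intros)
  have "set_integrable lborel D (\<lambda>x. norm (f x) powr p)"
  proof (rule set_integrable_subset[of lborel "closure D"])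
    show "set_integrable lborel (closure D) (\<lambda>x. norm (f x) powr p)"
      using borel_integrable_compact[OF assms(2) n] by (simp add: set_integrable_def)
  qed (use D in auto)
  moreover show "set_integrable lborel D f"
  proof (rule set_integrable_subset[of lborel "closure D"])
    show "set_integrable lborel (closure D) f"
      using borel_integrable_compact[OF assms(2,3)] by (simp add: set_integrable_def)
  qed (use D in auto)
  ultimately show "f \<in> Lp p D"
    by (auto simp: Lp_def set_borel_measurable_def set_integrable_def dest: borel_measurable_integrable)
qed

lemma classical_weak_gradient:
  fixes \<eta> :: "real^'n::finite \<Rightarrow> real" and g :: "real^'n \<Rightarrow> real^'n"
  assumes U: "open U" and \<eta>: "continuous_on U \<eta>" "continuous_on U g"
    and part: "\<And>x i. x \<in> U \<Longrightarrow> has_partial \<eta> (axis i 1) (g x $ i) x"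
  shows "weak_gradient U \<eta> g"
  unfolding weak_gradient_def
proof (intro conjI allI ballI impI)
  fix K assume K: "compact K \<and> K \<subseteq> U"
  show "set_integrable lborel K \<eta>" "set_integrable lborel K g"
    unfolding set_integrable_def using K \<eta> continuous_on_subset by (blast intro: borel_integrable_compact)+
next
  fix \<psi> assume \<psi>: "\<psi> \<in> test_functions U"
  let ?K = "closure {x. \<psi> x \<noteq> 0}"
  note t = test_functions_D[OF \<psi>]
  have gr: "grad \<psi> x $ i = frechet_derivative \<psi> (at x) (axis i 1)" for x i by (simp add: grad_def)
  have fc: "continuous_on S (\<lambda>x. frechet_derivative \<psi> (at x) (axis i 1))" for S i
    by (rule continuous_on_subset[OF t(3) subset_UNIV]) (simp add: axis_in_Basis_iff)
  have gc: "continuous_on S (grad \<psi>)" for S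
    unfolding grad_def by (intro continuous_on_vec_lambda fc)
  have zero: "grad \<psi> x = 0" "\<psi> x = 0" if "x \<notin> ?K" for x
    using t(6,7)[OF that] by (auto simp: vec_eq_iff gr)
  have vec: "integrable lborel (\<lambda>x. indicator ?K x *\<^sub>R f x)" if "continuous_on U f" for f :: "real^'n \<Rightarrow> real^'n"
    using that t(4,5) by (intro borel_integrable_compact) (auto intro: continuous_on_subset)
  have ind: "indicator U x *\<^sub>R k = indicator ?K x *\<^sub>R k" if "x \<notin> ?K \<Longrightarrow> k = 0" for x and k :: "real^'n"
    using that t(5) by (cases "x \<in> ?K") auto
  have 1: "(\<lambda>x. indicator U x *\<^sub>R (\<eta> x *\<^sub>R grad \<psi> x)) = (\<lambda>x. indicator ?K x *\<^sub>R (\<eta> x *\<^sub>R grad \<psi> x))"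
    "(\<lambda>x. indicator U x *\<^sub>R (\<psi> x *\<^sub>R g x)) = (\<lambda>x. indicator ?K x *\<^sub>R (\<psi> x *\<^sub>R g x))"
    by (rule ext, rule ind, drule zero(1), simp, rule ext, rule ind, drule zero(2), simp)
  have c\<psi>: "continuous_on U \<psi>" using t(2) by (rule continuous_on_subset) simp
  have i1: "set_integrable lborel U (\<lambda>x. \<eta> x *\<^sub>R grad \<psi> x)" "set_integrable lborel U (\<lambda>x. \<psi> x *\<^sub>R g x)"
    unfolding set_integrable_def 1 by (intro vec continuous_intros \<eta> gc c\<psi>)+
  show "(LINT x:U|lborel. \<eta> x *\<^sub>R grad \<psi> x) = - (LINT x:U|lborel. \<psi> x *\<^sub>R g x)"
    unfolding vec_eq_iff
  proof
    fix i
    have gi: "continuous_on U (\<lambda>x. g x $ i)" using \<eta>(2) by (intro continuous_intros)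
    have "(\<integral>x. indicator ?K x * (g x $ i * \<psi> x + \<eta> x * frechet_derivative \<psi> (at x) (axis i 1)) \<partial>lborel) = 0"
    proof (rule integral_partial_glued[OF U t(4,5), where f="\<lambda>x. \<eta> x * \<psi> x" and e="axis i 1"])
      show "continuous_on U (\<lambda>x. \<eta> x * \<psi> x)"
        "continuous_on U (\<lambda>x. g x $ i * \<psi> x + \<eta> x * frechet_derivative \<psi> (at x) (axis i 1))"
        by (intro continuous_on_mult continuous_on_add \<eta>(1) gi c\<psi> fc)+
      show "\<eta> x * \<psi> x = 0" if "x \<in> U - ?K" for x using zero(2)[of x] that by simp
      show "has_partial (\<lambda>x. \<eta> x * \<psi> x) (axis i 1) (g x $ i * \<psi> x + \<eta> x * frechet_derivative \<psi> (at x) (axis i 1)) x"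
        if "x \<in> U" for x
        using that by (intro has_partial_mult part has_partial_frechet t(1))
    qed
    moreover have "(\<integral>x. indicator ?K x * (g x $ i * \<psi> x + \<eta> x * frechet_derivative \<psi> (at x) (axis i 1)) \<partial>lborel)
      = (\<integral>x. indicator ?K x * (g x $ i * \<psi> x) \<partial>lborel) + (\<integral>x. indicator ?K x * (\<eta> x * frechet_derivative \<psi> (at x) (axis i 1)) \<partial>lborel)"
      unfolding distrib_left
      by (intro Bochner_Integration.integral_add continuous_indicator_integrable[OF t(4)] continuous_on_subset[OF _ t(5)]
          continuous_intros \<eta>(1) gi c\<psi> fc)
    moreover have "(LINT x:U|lborel. \<eta> x *\<^sub>R grad \<psi> x) $ i = (\<integral>x. indicator ?K x * (\<eta> x * frechet_derivative \<psi> (at x) (axis i 1)) \<partial>lborel)"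
      unfolding set_integral_component[OF i1(1)] unfolding set_lebesgue_integral_def
    proof (intro Bochner_Integration.integral_cong refl)
      fix x
      show "indicator U x *\<^sub>R (\<eta> x *\<^sub>R grad \<psi> x) $ i = indicator ?K x * (\<eta> x * frechet_derivative \<psi> (at x) (axis i 1))"
        using zero(1)[of x] t(5) gr[of x i] by (cases "x \<in> ?K") auto
    qed
    moreover have "(LINT x:U|lborel. \<psi> x *\<^sub>R g x) $ i = (\<integral>x. indicator ?K x * (g x $ i * \<psi> x) \<partial>lborel)"
      unfolding set_integral_component[OF i1(2)] unfolding set_lebesgue_integral_def
    proof (intro Bochner_Integration.integral_cong refl)
      fix x
      show "indicator U x *\<^sub>R (\<psi> x *\<^sub>R g x) $ i = indicator ?K x * (g x $ i * \<psi> x)"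
        using zero(2)[of x] t(5) by (cases "x \<in> ?K") auto
    qed
    ultimately show "(LINT x:U|lborel. \<eta> x *\<^sub>R grad \<psi> x) $ i = (- (LINT x:U|lborel. \<psi> x *\<^sub>R g x)) $ i" by simp
  qed
qed

text \<open>For a function affine in time with slope \<open>c\<close>, the equation says that the
  flux has divergence \<open>c\<close>. The flux is supplied as a field \<open>a\<close> with its
  own partial derivatives, so no power of the gradient is differentiated here. Integrating by parts
  in space and in time yields the same term, the integral of \<open>c * \<phi>\<close>, which
  cancels.\<close>

lemma classical_p_parabolic:
  fixes \<eta> :: "real^'n::finite \<Rightarrow> real" and g a :: "real^'n \<Rightarrow> real^'n" and da :: "'n \<Rightarrow> real^'n \<Rightarrow> real"
  assumes p: "1 < p"
    and cont: "continuous_on W \<eta>" "continuous_on W g" "continuous_on W a" "\<And>i. continuous_on W (da i)"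
    and part: "\<And>x i. x \<in> W \<Longrightarrow> has_partial \<eta> (axis i 1) (g x $ i) x"
      "\<And>x i. x \<in> W \<Longrightarrow> has_partial (\<lambda>x. a x $ i) (axis i 1) (da i x) x"
    and flux: "\<And>x. x \<in> W \<Longrightarrow> norm (g x) powr (p - 2) *\<^sub>R g x = a x"
    and div: "\<And>x. x \<in> W \<Longrightarrow> (\<Sum>i\<in>UNIV. da i x) = c"
  shows "p_parabolic p (W \<times> {t1<..<t2}) (\<lambda>z. \<eta> (fst z) + c * snd z)"
  unfolding p_parabolic_def
proof (intro conjI allI impI)
  let ?h = "\<lambda>z::'n spacetime. \<eta> (fst z) + c * snd z"
  have hc: "continuous_on (W \<times> T) ?h" for T
    by (intro continuous_intros continuous_on_compose2[OF cont(1)]) auto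
  then show "continuous_on (W \<times> {t1<..<t2}) ?h" .
  fix U s1 s2 assume *: "open U \<and> s1 < s2 \<and> compactly_contained (U \<times> {s1<..<s2}) (W \<times> {t1<..<t2})"
  define D where "D = U \<times> {s1<..<s2}"
  have U: "open U" "s1 < s2" and cD: "closure D = closure U \<times> {s1..s2}"
    using * by (auto simp: D_def closure_Times closure_greaterThanLessThan)
  have D: "open D" "compact (closure D)" "closure D \<subseteq> W \<times> {t1<..<t2}"
    using * by (auto simp: D_def compactly_contained_def open_Times)
  have Ub: "compact (closure U)" "closure U \<subseteq> W"
  proof -
    \<comment> \<open>Compact containment is stated for the cylinder; projecting its closure
      recovers it for \<open>U\<close>. The time interval is nonempty, so nothing is lost.\<close>
    have "fst ` closure D = closure U" using U(2) unfolding cD by (auto simp: image_iff)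
    then show "compact (closure U)" "closure U \<subseteq> W"
      using image_mono[OF D(3), of fst] compact_continuous_image[OF continuous_on_fst[OF continuous_on_id] D(2)]
      by (auto split: if_splits)
  qed
  have UW: "U \<subseteq> W" using Ub(2) closure_subset by blast
  have DW: "closure D \<subseteq> W \<times> UNIV" using D(3) by blast
  define G where "G z = g (fst z)" for z :: "'n spacetime"
  have Gc: "continuous_on (closure D) G"
    unfolding G_def using DW by (intro continuous_on_compose2[OF cont(2)] continuous_intros) auto
  have hcD: "continuous_on (closure D) ?h" using hc[of UNIV] DW continuous_on_subset by blast
  have p0: "0 < p" using p by simp
  have slice: "(\<lambda>x. ?h (x, t)) \<in> sobolev p U \<and> weak_gradient U (\<lambda>x. ?h (x, t)) (\<lambda>x. G (x, t))" for t
  proof -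
    have c: "continuous_on W (\<lambda>x. ?h (x, t))" by (simp, intro continuous_intros cont)
    have "weak_gradient U (\<lambda>x. ?h (x, t)) g"
    proof (rule classical_weak_gradient[OF U(1)])
      show "continuous_on U (\<lambda>x. ?h (x, t))" "continuous_on U g" using c cont(2) UW continuous_on_subset by blast+
      fix x i assume "x \<in> U"
      then have "has_partial \<eta> (axis i 1) (g x $ i) x" using part(1) UW by blast
      then show "has_partial (\<lambda>x. ?h (x, t)) (axis i 1) (g x $ i) x"
        unfolding has_partial_def by (auto intro!: derivative_eq_intros)
    qed
    moreover have "(\<lambda>x. ?h (x, t)) \<in> Lp p U" "g \<in> Lp p U"
      using continuous_closure_Lp(1)[OF U(1) Ub(1) _ p0] c cont(2) Ub(2) continuous_on_subset by blast+
    ultimately show ?thesis unfolding sobolev_def G_def by auto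
  qed
  have sob: "parabolic_sobolev p U s1 s2 ?h G"
    unfolding parabolic_sobolev_def D_def[symmetric]
    using continuous_closure_Lp(1)[OF D(1,2) hcD p0] continuous_closure_Lp(1)[OF D(1,2) Gc p0] slice by auto
  have i0: "set_integrable lborel U (\<lambda>_. 1::real)" "set_integrable lborel U \<eta>" "set_integrable lborel U (\<lambda>x. (\<eta> x)^2)"
    using cont(1) Ub by (auto intro!: continuous_closure_Lp(2)[OF U(1) Ub(1) _ p0] continuous_intros intro: continuous_on_subset)
  \<comment> \<open>The squared norm of a slice is a quadratic polynomial in \<open>t\<close>, hence
    continuous.\<close>
  have "(LINT x:U|lborel. \<bar>?h (x, t)\<bar>^2) = (LINT x:U|lborel. (\<eta> x)^2) + 2 * c * t * (LINT x:U|lborel. \<eta> x) + (c * t)^2 * (LINT x:U|lborel. 1)" for t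
  proof -
    have "(LINT x:U|lborel. \<bar>?h (x, t)\<bar>^2) = (LINT x:U|lborel. ((\<eta> x)^2 + (2 * c * t) * \<eta> x) + (c * t)^2 * 1)"
      by (simp add: power2_eq_square algebra_simps)
    also have "\<dots> = (LINT x:U|lborel. (\<eta> x)^2 + (2 * c * t) * \<eta> x) + (LINT x:U|lborel. (c * t)^2 * 1)"
      by (intro set_integral_add(2) set_integral_add(1) set_integrable_mult_right i0)
    also have "(LINT x:U|lborel. (\<eta> x)^2 + (2 * c * t) * \<eta> x) = (LINT x:U|lborel. (\<eta> x)^2) + (LINT x:U|lborel. (2 * c * t) * \<eta> x)"
      by (intro set_integral_add(2) set_integrable_mult_right i0)
    finally have "(LINT x:U|lborel. \<bar>?h (x, t)\<bar>^2) = (LINT x:U|lborel. (\<eta> x)^2) + (2 * c * t) * (LINT x:U|lborel. \<eta> x) + (c * t)^2 * (LINT x:U|lborel. 1)"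
      unfolding set_integral_mult_right .
    then show ?thesis .
  qed
  then have ct: "continuous_on {s1..s2} (\<lambda>t. LINT x:U|lborel. \<bar>?h (x, t)\<bar>^2)"
    by (simp only:) (intro continuous_intros)
  have weak: "(LINT t:{s1<..<s2}|lborel. LINT x:U|lborel. (norm (G (x, t)) powr (p - 2) *\<^sub>R G (x, t)) \<bullet> grad (\<lambda>y. \<phi> (y, t)) x)
      - (LINT t:{s1<..<s2}|lborel. LINT x:U|lborel. ?h (x, t) * deriv (\<lambda>s. \<phi> (x, s)) t) = 0"
    if \<phi>: "\<phi> \<in> test_functions (U \<times> {s1<..<s2})" for \<phi>
  proof -
    let ?K = "closure {z. \<phi> z \<noteq> 0}"
    note t = test_functions_D[OF \<phi>[folded D_def]]
    let ?f = "\<lambda>e z. frechet_derivative \<phi> (at z) e"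
    have DW': "D \<subseteq> W \<times> UNIV" using DW closure_subset by blast
    have lift: "continuous_on D (\<lambda>z. k (fst z))" if "continuous_on W k" for k :: "real^'n \<Rightarrow> real"
      using DW' by (intro continuous_on_compose2[OF that] continuous_intros) auto
    have ac: "continuous_on W (\<lambda>x. a x $ i)" for i using cont(3) by (intro continuous_intros)
    have c\<phi>: "continuous_on D \<phi>" "\<And>e. e \<in> Basis \<Longrightarrow> continuous_on D (?f e)"
      using t(2,3) continuous_on_subset by blast+
    note cs = space_dir_Basis time_dir_Basis
    have K: "integrable lborel (\<lambda>z. indicator ?K z * k z)" if "continuous_on D k" for k :: "'n spacetime \<Rightarrow> real"
      by (intro continuous_indicator_integrable[OF t(4)] continuous_on_subset[OF that t(5)])
    have hD: "continuous_on D ?h" using hcD closure_subset continuous_on_subset by blast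
    have space: "(\<integral>z. indicator ?K z * (da i (fst z) * \<phi> z + a (fst z) $ i * ?f (space_dir i) z) \<partial>lborel) = 0" for i
    proof (rule integral_partial_glued[OF D(1) t(4,5), where f="\<lambda>z. a (fst z) $ i * \<phi> z" and e="space_dir i"])
      show "continuous_on D (\<lambda>z. a (fst z) $ i * \<phi> z)"
        by (intro continuous_on_mult c\<phi> lift[OF ac])
      show "continuous_on D (\<lambda>z. da i (fst z) * \<phi> z + a (fst z) $ i * ?f (space_dir i) z)"
        by (intro continuous_on_add continuous_on_mult c\<phi> cs lift[OF ac] lift[OF cont(4)])
      show "a (fst z) $ i * \<phi> z = 0" if "z \<in> D - ?K" for z using t(6)[of z] that by simp
      fix z assume "z \<in> D"
      then have "fst z \<in> W" using DW' by auto
      then have "has_partial (\<lambda>z. a (fst z) $ i) (space_dir i) (da i (fst z)) z"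
        using part(2)[of "fst z" i] by (simp add: has_partial_def space_dir_def)
      then show "has_partial (\<lambda>z. a (fst z) $ i * \<phi> z) (space_dir i) (da i (fst z) * \<phi> z + a (fst z) $ i * ?f (space_dir i) z) z"
        by (intro has_partial_mult has_partial_frechet t(1))
    qed
    have time: "(\<integral>z. indicator ?K z * (c * \<phi> z + ?h z * ?f time_dir z) \<partial>lborel) = 0"
    proof (rule integral_partial_glued[OF D(1) t(4,5), where f="\<lambda>z. ?h z * \<phi> z" and e=time_dir])
      show "continuous_on D (\<lambda>z. ?h z * \<phi> z)" "continuous_on D (\<lambda>z. c * \<phi> z + ?h z * ?f time_dir z)"
        by (intro continuous_on_add continuous_on_mult continuous_on_const c\<phi> cs hD)+
      show "?h z * \<phi> z = 0" if "z \<in> D - ?K" for z using t(6)[of z] that by simp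
      show "has_partial (\<lambda>z. ?h z * \<phi> z) time_dir (c * \<phi> z + ?h z * ?f time_dir z) z" for z
      proof (rule has_partial_mult)
        show "has_partial ?h time_dir c z"
          unfolding has_partial_def time_dir_def by (auto intro!: derivative_eq_intros)
      qed (intro has_partial_frechet t(1))
    qed
    have ind: "indicator D z * k z = indicator ?K z * k z" if "z \<notin> ?K \<Longrightarrow> k z = 0" for z and k :: "'n spacetime \<Rightarrow> real"
      using that t(5) by (auto simp: indicator_def)
    let ?A = "\<lambda>z. \<Sum>i\<in>UNIV. a (fst z) $ i * ?f (space_dir i) z"
    let ?B = "\<lambda>z. ?h z * ?f time_dir z"
    have A0: "?A z = 0" "?B z = 0" if "z \<notin> ?K" for z using t(7)[OF that] by simp_all
    have cA: "continuous_on D ?A" "continuous_on D ?B"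
      by (intro continuous_on_sum continuous_on_mult c\<phi> cs lift[OF ac] hD)+
    have eA: "(\<lambda>z. indicator D z * ?A z) = (\<lambda>z. indicator ?K z * ?A z)" by (rule ext, rule ind, rule A0)
    have eB: "(\<lambda>z. indicator D z * ?B z) = (\<lambda>z. indicator ?K z * ?B z)" by (rule ext, rule ind, rule A0)
    have IA: "integrable lborel (\<lambda>z. indicator D z * ?A z)" "integrable lborel (\<lambda>z. indicator D z * ?B z)"
      unfolding eA eB by (intro K cA)+
    have fl: "indicator U x *\<^sub>R ((norm (G (x, t)) powr (p - 2) *\<^sub>R G (x, t)) \<bullet> grad (\<lambda>y. \<phi> (y, t)) x) = indicator U x *\<^sub>R ?A (x, t)" for x t
      using flux[of x] UW by (cases "x \<in> U") (auto simp: G_def inner_vec_def grad_slice[OF test_functions_D(1)[OF \<phi>]] subset_iff)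
    have "(LINT t:{s1<..<s2}|lborel. LINT x:U|lborel. (norm (G (x, t)) powr (p - 2) *\<^sub>R G (x, t)) \<bullet> grad (\<lambda>y. \<phi> (y, t)) x)
       = (LINT t:{s1<..<s2}|lborel. LINT x:U|lborel. ?A (x, t))"
      by (simp only: set_lebesgue_integral_def fl)
    also have "\<dots> = (\<integral>z. indicator ?K z * ?A z \<partial>lborel)"
      using set_integral_iterated[OF IA(1)[unfolded D_def]] unfolding D_def[symmetric] eA .
    finally have 1: "(LINT t:{s1<..<s2}|lborel. LINT x:U|lborel. (norm (G (x, t)) powr (p - 2) *\<^sub>R G (x, t)) \<bullet> grad (\<lambda>y. \<phi> (y, t)) x)
       = (\<integral>z. indicator ?K z * ?A z \<partial>lborel)" .
    have "(LINT t:{s1<..<s2}|lborel. LINT x:U|lborel. ?h (x, t) * deriv (\<lambda>s. \<phi> (x, s)) t)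
       = (LINT t:{s1<..<s2}|lborel. LINT x:U|lborel. ?B (x, t))"
      by (simp add: deriv_slice[OF test_functions_D(1)[OF \<phi>]])
    also have "\<dots> = (\<integral>z. indicator ?K z * ?B z \<partial>lborel)"
      using set_integral_iterated[OF IA(2)[unfolded D_def]] unfolding D_def[symmetric] eB .
    finally have 2: "(LINT t:{s1<..<s2}|lborel. LINT x:U|lborel. ?h (x, t) * deriv (\<lambda>s. \<phi> (x, s)) t)
       = (\<integral>z. indicator ?K z * ?B z \<partial>lborel)" .
    have "0 = (\<Sum>i\<in>UNIV. \<integral>z. indicator ?K z * (da i (fst z) * \<phi> z + a (fst z) $ i * ?f (space_dir i) z) \<partial>lborel)"
      using space by simp
    also have "\<dots> = (\<integral>z. (\<Sum>i\<in>UNIV. indicator ?K z * (da i (fst z) * \<phi> z + a (fst z) $ i * ?f (space_dir i) z)) \<partial>lborel)"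
      by (intro Bochner_Integration.integral_sum[symmetric] K continuous_on_add continuous_on_mult c\<phi> cs lift[OF ac] lift[OF cont(4)])
    also have "\<dots> = (\<integral>z. indicator ?K z * (c * \<phi> z) + indicator ?K z * ?A z \<partial>lborel)"
    proof (intro Bochner_Integration.integral_cong refl)
      fix z
      show "(\<Sum>i\<in>UNIV. indicator ?K z * (da i (fst z) * \<phi> z + a (fst z) $ i * ?f (space_dir i) z))
          = indicator ?K z * (c * \<phi> z) + indicator ?K z * ?A z"
      proof (cases "z \<in> ?K")
        case True
        then have "fst z \<in> W" using t(5) DW' by auto
        then have "c * \<phi> z = (\<Sum>i\<in>UNIV. da i (fst z) * \<phi> z)" using div by (simp add: sum_distrib_right[symmetric])
        then show ?thesis using True by (simp add: sum.distrib)
      qed simp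
    qed
    also have "\<dots> = (\<integral>z. indicator ?K z * (c * \<phi> z) \<partial>lborel) + (\<integral>z. indicator ?K z * ?A z \<partial>lborel)"
      by (intro Bochner_Integration.integral_add K cA continuous_on_mult continuous_on_const c\<phi>)
    finally have 3: "(\<integral>z. indicator ?K z * (c * \<phi> z) \<partial>lborel) + (\<integral>z. indicator ?K z * ?A z \<partial>lborel) = 0" by simp
    have "(\<integral>z. indicator ?K z * (c * \<phi> z + ?h z * ?f time_dir z) \<partial>lborel)
        = (\<integral>z. indicator ?K z * (c * \<phi> z) \<partial>lborel) + (\<integral>z. indicator ?K z * ?B z \<partial>lborel)"
      unfolding distrib_left[of "indicator ?K _"]
      by (intro Bochner_Integration.integral_add K cA continuous_on_mult continuous_on_const c\<phi>)
    then show ?thesis using time 1 2 3 by simp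
  qed
  show "\<exists>G. parabolic_sobolev p U s1 s2 ?h G \<and> continuous_on {s1..s2} (\<lambda>t. LINT x:U|lborel. \<bar>?h (x, t)\<bar>^2) \<and>
      (\<forall>\<phi>\<in>test_functions (U \<times> {s1<..<s2}).
         (LINT t:{s1<..<s2}|lborel. LINT x:U|lborel. (norm (G (x, t)) powr (p - 2) *\<^sub>R G (x, t)) \<bullet> grad (\<lambda>y. \<phi> (y, t)) x)
       - (LINT t:{s1<..<s2}|lborel. LINT x:U|lborel. ?h (x, t) * deriv (\<lambda>s. \<phi> (x, s)) t) = 0)"
    using sob ct weak by blast
qed

section \<open>Radial solutions that are affine in time\<close>

lemma sqnorm_partial: "has_partial (\<lambda>x. (norm (x - y))^2) e (2 * ((x - y) \<bullet> e)) x"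
proof -
  have eq: "(norm (x + s *\<^sub>R e - y))^2 = (norm (x - y))^2 + 2 * s * ((x - y) \<bullet> e) + s^2 * (norm e)^2" for s
    unfolding power2_norm_eq_inner by (simp add: inner_simps inner_commute power2_eq_square algebra_simps)
  show ?thesis unfolding has_partial_def eq by (auto intro!: derivative_eq_intros)
qed

lemma radial_partial:
  fixes x y :: "real^'n::finite"
  assumes "(F has_real_derivative d) (at ((norm (x - y))^2))"
  shows "has_partial (\<lambda>x. F ((norm (x - y))^2)) (axis i 1) (2 * d * (x $ i - y $ i)) x"
  using has_partial_compose[OF sqnorm_partial assms, of "axis i 1"] by (simp add: inner_axis mult_ac)

lemma continuous_antiderivative:
  fixes f :: "real \<Rightarrow> real"
  assumes "continuous_on {a..b} f"
  obtains F where "\<And>x. a < x \<Longrightarrow> x < b \<Longrightarrow> (F has_real_derivative f x) (at x)"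
proof
  fix x assume x: "a < x" "x < b"
  have "((\<lambda>u. integral {a..u} f) has_real_derivative f x) (at x within {a..b})"
    using assms x by (intro integral_has_real_derivative) auto
  then show "((\<lambda>u. integral {a..u} f) has_real_derivative f x) (at x)"
    using x by (simp add: at_within_Icc_at)
qed

text \<open>The solutions \<open>H (|x - y|\<^sup>2) + c t\<close>: the flux of such a function is \<open>- \<mu> (x - y)\<close> with
  \<open>\<mu> (\<tau>) = C \<tau> powr (- n / 2) - c / n\<close>, whose divergence is \<open>c\<close>. The constant \<open>C\<close> is fixed by the prescribed
  slope \<open>H' (\<tau>\<^sub>0) = - \<kappa>\<close>.\<close>

lemma radial_solution:
  fixes p c \<kappa> \<tau>0 :: real
  defines "n \<equiv> real CARD('n::finite)"
  assumes p: "1 < p" and pos: "\<tau>0 > 0" "\<kappa> > 0"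
  obtains \<delta> H K where "\<delta> > 0" "\<delta> < \<tau>0" "\<And>\<tau>. \<bar>\<tau> - \<tau>0\<bar> < \<delta> \<Longrightarrow> K \<tau> > 0"
    "\<And>\<tau>. \<bar>\<tau> - \<tau>0\<bar> < \<delta> \<Longrightarrow> (H has_real_derivative - K \<tau>) (at \<tau>)" "K \<tau>0 = \<kappa>"
    "(K has_real_derivative - \<kappa> / (2 * \<tau>0 * (p - 1)) * (n + p - 2 + c / ((2 * \<kappa>) powr (p - 1) * \<tau>0 powr ((p - 2) / 2)))) (at \<tau>0)"
    "\<And>W (y::real^'n) t1 t2 d. (\<And>x. x \<in> W \<Longrightarrow> \<bar>(norm (x - y))^2 - \<tau>0\<bar> < \<delta>) \<Longrightarrow>
        p_parabolic p (W \<times> {t1<..<t2}) (\<lambda>z. H ((norm (fst z - y))^2) + d + c * snd z)"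
proof -
  have n: "n \<ge> 1" by (simp add: n_def Suc_leI)
  \<comment> \<open>With \<open>H' = - \<kappa>\<close> the gradient is
    \<open>- 2 * \<kappa> (x - y)\<close> and has length \<open>2 * \<kappa> * sqrt \<tau>0\<close>
    on the sphere. Thus \<open>- \<mu>0 (x - y)\<close> is the flux there.\<close>
  define \<mu>0 where "\<mu>0 = (2 * \<kappa>) powr (p - 1) * \<tau>0 powr ((p - 2) / 2)"
  have \<mu>0: "\<mu>0 > 0" using pos by (simp add: \<mu>0_def)
  define C where "C = (\<mu>0 + c / n) * \<tau>0 powr (n / 2)"
  define \<mu> where "\<mu> \<tau> = C * \<tau> powr (- n / 2) - c / n" for \<tau>
  define \<mu>1 where "\<mu>1 \<tau> = - (n / 2) * C * \<tau> powr (- n / 2 - 1)" for \<tau>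
  \<comment> \<open>Solves the flux relation
    \<open>\<mu> = (2 * K) powr (p - 1) * \<tau> powr ((p - 2) / 2)\<close> for the slope.\<close>
  define K where "K \<tau> = (\<mu> \<tau> * \<tau> powr ((2 - p) / 2)) powr (1 / (p - 1)) / 2" for \<tau>
  have \<mu>_\<tau>0: "\<mu> \<tau>0 = \<mu>0"
    using pos by (simp add: \<mu>_def C_def powr_minus field_simps)
  have \<mu>_deriv: "(\<mu> has_real_derivative \<mu>1 \<tau>) (at \<tau>)" if "\<tau> > 0" for \<tau>
    unfolding \<mu>_def \<mu>1_def using that by (auto intro!: derivative_eq_intros)
  \<comment> \<open>The differential equation \<open>2 \<tau> \<mu>' + n \<mu> = - c\<close>, which
    says that \<open>- \<mu> (x - y)\<close> has divergence \<open>c\<close>.\<close>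
  have \<mu>1_\<tau>: "2 * \<tau> * \<mu>1 \<tau> = - n * (\<mu> \<tau> + c / n)" if "\<tau> > 0" for \<tau>
  proof -
    have "\<tau> powr (- n / 2 - 1) = \<tau> powr (- n / 2) / \<tau>" using that powr_diff[of \<tau> "- n / 2" 1] by simp
    then show ?thesis using that by (simp add: \<mu>_def \<mu>1_def)
  qed
  have "isCont \<mu> \<tau>0" using \<mu>_deriv pos(1) DERIV_isCont by blast
  then have "eventually (\<lambda>\<tau>. \<mu> \<tau> > 0) (nhds \<tau>0)"
    using \<mu>_\<tau>0 \<mu>0 by (intro order_tendstoD(1)[of \<mu> "\<mu> \<tau>0"]) (auto simp: isCont_def tendsto_at_iff_tendsto_nhds)
  then obtain \<delta>0 where \<delta>0: "\<delta>0 > 0" "\<And>\<tau>. \<bar>\<tau> - \<tau>0\<bar> < \<delta>0 \<Longrightarrow> \<mu> \<tau> > 0"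
    by (auto simp: eventually_nhds_metric dist_real_def)
  \<comment> \<open>Halved so that \<tau> and \<mu> stay positive on the closed interval, where
    continuity of the slope is needed for the antiderivative.\<close>
  define \<delta> where "\<delta> = min \<delta>0 \<tau>0 / 2"
  have \<delta>: "\<delta> > 0" "\<delta> < \<tau>0" "\<delta> < \<delta>0" using \<delta>0(1) pos by (auto simp: \<delta>_def min_def)
  have near: "\<tau> > 0" "\<mu> \<tau> > 0" if "\<bar>\<tau> - \<tau>0\<bar> \<le> \<delta>" for \<tau>
    using that \<delta> \<delta>0(2)[of \<tau>] by auto
  have K_pos: "K \<tau> > 0" if "\<bar>\<tau> - \<tau>0\<bar> \<le> \<delta>" for \<tau> using near[OF that] by (simp add: K_def)
  have K_pow: "(2 * K \<tau>) powr (p - 1) = \<mu> \<tau> * \<tau> powr ((2 - p) / 2)" if "\<bar>\<tau> - \<tau>0\<bar> \<le> \<delta>" for \<tau>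
    using near[OF that] p by (simp add: K_def powr_powr)
  \<comment> \<open>Logarithmic differentiation: \<open>K\<close> is half the power
    \<open>1 / (p - 1)\<close> of a product.\<close>
  have K_deriv: "(K has_real_derivative
      K \<tau> * (1 / (p - 1)) * (\<mu>1 \<tau> / \<mu> \<tau> + (2 - p) / (2 * \<tau>))) (at \<tau>)" if "\<bar>\<tau> - \<tau>0\<bar> \<le> \<delta>" for \<tau>
  proof -
    note np = near[OF that]
    let ?w = "\<mu> \<tau> * \<tau> powr ((2 - p) / 2)"
    have w: "?w > 0" using np by simp
    have 1: "((\<lambda>\<tau>. \<mu> \<tau> * \<tau> powr ((2 - p) / 2)) has_real_derivative ?w * (\<mu>1 \<tau> / \<mu> \<tau> + (2 - p) / (2 * \<tau>))) (at \<tau>)"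
    proof -
      have "((\<lambda>\<tau>. \<mu> \<tau> * \<tau> powr ((2 - p) / 2)) has_real_derivative
          \<mu>1 \<tau> * \<tau> powr ((2 - p) / 2) + ((2 - p) / 2 * \<tau> powr ((2 - p) / 2 - 1)) * \<mu> \<tau>) (at \<tau>)"
        by (rule DERIV_mult[OF \<mu>_deriv]) (use np in \<open>auto intro!: derivative_eq_intros\<close>)
      moreover have e: "\<tau> powr ((2 - p) / 2 - 1) = \<tau> powr ((2 - p) / 2) / \<tau>" using np powr_diff[of \<tau> "(2 - p) / 2" 1] by simp
      have "m1 * X + (q * (X / \<tau>)) * m = (m * X) * (m1 / m + q / \<tau>)" if "m > 0" for m1 X q m :: real
        using that np(1) by (simp add: field_simps)
      from this[OF np(2), of "\<mu>1 \<tau>" "\<tau> powr ((2 - p) / 2)" "(2 - p) / 2"]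
      have "\<mu>1 \<tau> * \<tau> powr ((2 - p) / 2) + ((2 - p) / 2 * \<tau> powr ((2 - p) / 2 - 1)) * \<mu> \<tau> = ?w * (\<mu>1 \<tau> / \<mu> \<tau> + (2 - p) / (2 * \<tau>))"
        unfolding e by simp
      ultimately show ?thesis by (simp only:)
    qed
    have "((\<lambda>w. w powr e / 2) has_real_derivative e * ?w powr (e - 1) / 2) (at ?w)" for e
      using w by (auto intro!: derivative_eq_intros)
    note 2 = this[of "1 / (p - 1)"]
    have "(K has_real_derivative (1 / (p - 1)) * ?w powr (1 / (p - 1) - 1) / 2 * (?w * (\<mu>1 \<tau> / \<mu> \<tau> + (2 - p) / (2 * \<tau>)))) (at \<tau>)"
      unfolding K_def by (rule DERIV_chain2[OF 2 1])
    moreover have e: "?w powr (1 / (p - 1) - 1) = ?w powr (1 / (p - 1)) / ?w" using w powr_diff[of ?w "1 / (p - 1)" 1] by simp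
    have "e * (X / w) / 2 * (w * z) = X / 2 * e * z" if "w > 0" for e X w z :: real using that by simp
    from this[OF w] have "(1 / (p - 1)) * ?w powr (1 / (p - 1) - 1) / 2 * (?w * (\<mu>1 \<tau> / \<mu> \<tau> + (2 - p) / (2 * \<tau>)))
        = K \<tau> * (1 / (p - 1)) * (\<mu>1 \<tau> / \<mu> \<tau> + (2 - p) / (2 * \<tau>))"
      unfolding e K_def .
    ultimately show ?thesis by (simp only:)
  qed
  have "continuous_on {\<tau>0 - \<delta>..\<tau>0 + \<delta>} (\<lambda>\<tau>. - K \<tau>)"
  proof (intro continuous_on_minus continuous_at_imp_continuous_on ballI)
    fix \<tau> assume "\<tau> \<in> {\<tau>0 - \<delta>..\<tau>0 + \<delta>}"
    then have "\<bar>\<tau> - \<tau>0\<bar> \<le> \<delta>" by auto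
    then show "isCont K \<tau>" using K_deriv DERIV_isCont by blast
  qed
  then obtain H where H': "\<And>\<tau>. \<tau>0 - \<delta> < \<tau> \<Longrightarrow> \<tau> < \<tau>0 + \<delta> \<Longrightarrow> (H has_real_derivative - K \<tau>) (at \<tau>)"
    by (rule continuous_antiderivative) blast
  have H: "(H has_real_derivative - K \<tau>) (at \<tau>)" if "\<bar>\<tau> - \<tau>0\<bar> < \<delta>" for \<tau> using H'[of \<tau>] that by (simp add: abs_less_iff)
  have K0: "K \<tau>0 = \<kappa>"
  proof -
    have "\<mu> \<tau>0 * \<tau>0 powr ((2 - p) / 2) = (2 * \<kappa>) powr (p - 1) * (\<tau>0 powr ((p - 2) / 2) * \<tau>0 powr ((2 - p) / 2))"
      by (simp add: \<mu>_\<tau>0 \<mu>0_def)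
    also have "\<tau>0 powr ((p - 2) / 2) * \<tau>0 powr ((2 - p) / 2) = 1"
      using pos by (simp add: powr_add[symmetric] add_divide_distrib[symmetric])
    finally show ?thesis using pos p by (simp add: K_def powr_powr)
  qed
  show thesis
  proof (rule that[OF \<delta>(1,2) K_pos H K0])
    have \<tau>: "\<bar>\<tau>0 - \<tau>0\<bar> \<le> \<delta>" using \<delta> by simp
    have "K \<tau>0 * (1 / (p - 1)) * (\<mu>1 \<tau>0 / \<mu> \<tau>0 + (2 - p) / (2 * \<tau>0)) = - \<kappa> / (2 * \<tau>0 * (p - 1)) * (n + p - 2 + c / \<mu>0)"
    proof -
      have "m = X / (2 * \<tau>0)" if "2 * \<tau>0 * m = X" for m X using that pos by (auto simp: field_simps)
      from this[OF \<mu>1_\<tau>[OF pos(1)]] have "\<mu>1 \<tau>0 = - n * (\<mu>0 + c / n) / (2 * \<tau>0)" unfolding \<mu>_\<tau>0 .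
      then have "\<mu>1 \<tau>0 / \<mu> \<tau>0 = - (n + c / \<mu>0) / (2 * \<tau>0)" 
      proof -
        assume m: "\<mu>1 \<tau>0 = - n * (\<mu>0 + c / n) / (2 * \<tau>0)"
        have "- n * (\<mu>0 + c / n) / (2 * \<tau>0) / \<mu>0 = - (n + c / \<mu>0) / (2 * \<tau>0)"
          using n \<mu>0 pos by (simp add: field_simps)
        then show ?thesis unfolding m \<mu>_\<tau>0 .
      qed
      then have f: "\<mu>1 \<tau>0 / \<mu> \<tau>0 + (2 - p) / (2 * \<tau>0) = - (n + p - 2 + c / \<mu>0) / (2 * \<tau>0)"
        by (simp add: add_divide_distrib[symmetric])
      have "k * (1 / q) * (- X / (2 * t)) = - k / (2 * t * q) * X" for k q X t :: real by (simp add: mult_ac)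
      then show ?thesis unfolding K0 f .
    qed
    then show "(K has_real_derivative - \<kappa> / (2 * \<tau>0 * (p - 1)) * (n + p - 2 + c / ((2 * \<kappa>) powr (p - 1) * \<tau>0 powr ((p - 2) / 2)))) (at \<tau>0)"
      using K_deriv[OF \<tau>] by (simp add: \<mu>0_def)
    fix W and y :: "real^'n" and t1 t2 d
    assume W: "\<And>x. x \<in> W \<Longrightarrow> \<bar>(norm (x - y))^2 - \<tau>0\<bar> < \<delta>"
    let ?\<tau> = "\<lambda>x. (norm (x - y))^2"
    show "p_parabolic p (W \<times> {t1<..<t2}) (\<lambda>z. H (?\<tau> (fst z)) + d + c * snd z)"
    proof (rule classical_p_parabolic[OF p, where \<eta>="\<lambda>x. H (?\<tau> x) + d" and g="\<lambda>x. (- 2 * K (?\<tau> x)) *\<^sub>R (x - y)"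
          and a="\<lambda>x. (- \<mu> (?\<tau> x)) *\<^sub>R (x - y)" and da="\<lambda>i x. - (2 * \<mu>1 (?\<tau> x) * (x $ i - y $ i) * (x $ i - y $ i) + \<mu> (?\<tau> x))"])
      have comp: "continuous_on W (\<lambda>x. F (?\<tau> x))" if "\<And>\<tau>. \<bar>\<tau> - \<tau>0\<bar> < \<delta> \<Longrightarrow> isCont F \<tau>" for F :: "real \<Rightarrow> real"
      proof (rule continuous_on_compose2[of "{\<tau>. \<bar>\<tau> - \<tau>0\<bar> < \<delta>}" F W ?\<tau>])
        show "continuous_on {\<tau>. \<bar>\<tau> - \<tau>0\<bar> < \<delta>} F" using that by (intro continuous_at_imp_continuous_on) auto
      qed (use W in \<open>auto intro!: continuous_intros\<close>)
      have iH: "continuous_on W (\<lambda>x. H (?\<tau> x))" by (rule comp) (use H DERIV_isCont in blast)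
      have iK: "continuous_on W (\<lambda>x. K (?\<tau> x))" by (rule comp) (use K_deriv DERIV_isCont less_imp_le in blast)
      have i\<mu>: "continuous_on W (\<lambda>x. \<mu> (?\<tau> x))" by (rule comp) (use \<mu>_deriv near(1) DERIV_isCont less_imp_le in blast)
      have i\<mu>1: "continuous_on W (\<lambda>x. \<mu>1 (?\<tau> x))"
      proof (rule comp)
        fix \<tau> assume "\<bar>\<tau> - \<tau>0\<bar> < \<delta>"
        then have "\<tau> > 0" using near(1)[of \<tau>] by simp
        then have "(\<mu>1 has_real_derivative - (n / 2) * C * ((- n / 2 - 1) * \<tau> powr (- n / 2 - 1 - 1))) (at \<tau>)"
          unfolding \<mu>1_def by (auto intro!: derivative_eq_intros)
        then show "isCont \<mu>1 \<tau>" by (rule DERIV_isCont)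
      qed
      show "continuous_on W (\<lambda>x. H (?\<tau> x) + d)" "continuous_on W (\<lambda>x. (- 2 * K (?\<tau> x)) *\<^sub>R (x - y))"
        "continuous_on W (\<lambda>x. (- \<mu> (?\<tau> x)) *\<^sub>R (x - y))"
        by (intro continuous_intros iH iK i\<mu>)+
      show "continuous_on W (\<lambda>x. - (2 * \<mu>1 (?\<tau> x) * (x $ i - y $ i) * (x $ i - y $ i) + \<mu> (?\<tau> x)))" for i
        by (intro continuous_intros i\<mu> i\<mu>1)
      fix x assume x: "x \<in> W"
      then have t: "\<bar>?\<tau> x - \<tau>0\<bar> < \<delta>" "\<bar>?\<tau> x - \<tau>0\<bar> \<le> \<delta>" using W by (auto intro: less_imp_le)
      note np = near[OF t(2)]
      have xy: "norm (x - y) > 0" using np(1) by simp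
      show "has_partial (\<lambda>x. H (?\<tau> x) + d) (axis i 1) (((- 2 * K (?\<tau> x)) *\<^sub>R (x - y)) $ i) x" for i
      proof -
        have "((\<lambda>\<tau>. H \<tau> + d) has_real_derivative - K (?\<tau> x)) (at (?\<tau> x))"
          using H[OF t(1)] by (auto intro!: derivative_eq_intros)
        from radial_partial[OF this, of i] show ?thesis by simp
      qed
      show "has_partial (\<lambda>x. ((- \<mu> (?\<tau> x)) *\<^sub>R (x - y)) $ i) (axis i 1)
          (- (2 * \<mu>1 (?\<tau> x) * (x $ i - y $ i) * (x $ i - y $ i) + \<mu> (?\<tau> x))) x" for i
      proof -
        have 1: "has_partial (\<lambda>x. x $ i - y $ i) (axis i 1) 1 x"
          unfolding has_partial_def by (auto intro!: derivative_eq_intros)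
        have "has_partial (\<lambda>x. - \<mu> (?\<tau> x) * (x $ i - y $ i)) (axis i 1)
            (2 * - \<mu>1 (?\<tau> x) * (x $ i - y $ i) * (x $ i - y $ i) + - \<mu> (?\<tau> x) * 1) x"
          by (intro has_partial_mult radial_partial[of "\<lambda>\<tau>. - \<mu> \<tau>"] DERIV_minus \<mu>_deriv np(1) 1)
        moreover have "2 * - m1 * d * d + - m * 1 = - (2 * m1 * d * d + m)" for m1 d m :: real by simp
        moreover have "(\<lambda>x. ((- \<mu> (?\<tau> x)) *\<^sub>R (x - y)) $ i) = (\<lambda>x. - \<mu> (?\<tau> x) * (x $ i - y $ i))"
          by (rule ext) (simp only: vector_scaleR_component vector_minus_component real_scaleR_def)
        ultimately show ?thesis by (simp only:)
      qed
      have nrm: "norm ((- 2 * K (?\<tau> x)) *\<^sub>R (x - y)) = (2 * K (?\<tau> x)) * norm (x - y)"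
        using K_pos[OF t(2)] by simp
      have "norm ((- 2 * K (?\<tau> x)) *\<^sub>R (x - y)) powr (p - 2) * (2 * K (?\<tau> x)) = \<mu> (?\<tau> x)"
      proof -
        have "norm (x - y) powr (p - 2) = ?\<tau> x powr ((p - 2) / 2)"
        proof -
          have "?\<tau> x = norm (x - y) powr 2" using xy by simp
          moreover have "2 * ((p - 2) / 2) = p - 2" by simp
          ultimately show ?thesis by (simp only: powr_powr)
        qed
        then have "norm ((- 2 * K (?\<tau> x)) *\<^sub>R (x - y)) powr (p - 2) * (2 * K (?\<tau> x))
            = ((2 * K (?\<tau> x)) powr (p - 2) * (2 * K (?\<tau> x))) * ?\<tau> x powr ((p - 2) / 2)"
          unfolding nrm using K_pos[OF t(2)] by (simp add: powr_mult mult_ac)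
        also have "(2 * K (?\<tau> x)) powr (p - 2) * (2 * K (?\<tau> x)) = (2 * K (?\<tau> x)) powr (p - 1)"
          using powr_mult_base[of "2 * K (?\<tau> x)" "p - 2"] K_pos[OF t(2)] by (simp add: mult.commute)
        also have "\<dots> * ?\<tau> x powr ((p - 2) / 2) = \<mu> (?\<tau> x) * (?\<tau> x powr ((2 - p) / 2) * ?\<tau> x powr ((p - 2) / 2))"
          unfolding K_pow[OF t(2)] by simp
        also have "?\<tau> x powr ((2 - p) / 2) * ?\<tau> x powr ((p - 2) / 2) = 1"
          using np(1) by (simp add: powr_add[symmetric] add_divide_distrib[symmetric])
        finally show ?thesis by simp
      qed
      then show "norm ((- 2 * K (?\<tau> x)) *\<^sub>R (x - y)) powr (p - 2) *\<^sub>R ((- 2 * K (?\<tau> x)) *\<^sub>R (x - y)) = (- \<mu> (?\<tau> x)) *\<^sub>R (x - y)"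
        by (simp add: mult_ac)
      have sq: "(\<Sum>i\<in>UNIV. (x $ i - y $ i) * (x $ i - y $ i)) = ?\<tau> x"
        unfolding power2_norm_eq_inner inner_vec_def by simp
      have "(\<Sum>i\<in>UNIV. - (2 * m1 * d i * d i + m)) = - (2 * m1 * (\<Sum>i\<in>UNIV. d i * d i) + n * m)"
        for m1 m and d :: "'n \<Rightarrow> real"
        by (simp only: sum_negf sum.distrib mult.assoc sum_distrib_left[symmetric] sum_constant n_def)
      from this[of "\<mu>1 (?\<tau> x)" "\<lambda>i. x $ i - y $ i" "\<mu> (?\<tau> x)"]
      have "(\<Sum>i\<in>UNIV. - (2 * \<mu>1 (?\<tau> x) * (x $ i - y $ i) * (x $ i - y $ i) + \<mu> (?\<tau> x)))
          = - (2 * ?\<tau> x * \<mu>1 (?\<tau> x) + n * \<mu> (?\<tau> x))"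
        unfolding sq by (simp add: mult_ac)
      also have "\<dots> = c" unfolding \<mu>1_\<tau>[OF np(1)] using n by (simp add: field_simps)
      finally show "(\<Sum>i\<in>UNIV. - (2 * \<mu>1 (?\<tau> x) * (x $ i - y $ i) * (x $ i - y $ i) + \<mu> (?\<tau> x))) = c" .
    qed
  qed (auto intro: less_imp_le)
qed

section \<open>Superparabolic functions and Gaussian subsolutions\<close>

text \<open>In this form compactness is evident, so a continuous function attains its minimum
  there.\<close>

lemma parabolic_boundary_compact_cover:
  fixes a b :: "real^'n"
  assumes ab: "\<And>i. a $ i < b $ i" and t: "t1 < t2"
  shows "parabolic_boundary (box a b) t1 t2 \<subseteq> cbox a b \<times> {t1} \<union> (cbox a b - box a b) \<times> {t1..t2}"
proof -
  have "box a b \<noteq> {}" using ab by (simp add: interval_ne_empty_cart)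
  then show ?thesis by (auto simp: parabolic_boundary_def closure_box frontier_box)
qed

text \<open>Second derivative test asking only for differentiability of \<open>f'\<close> at the
  critical point, which is what \<open>radial_solution\<close> provides for
  \<open>K\<close>.\<close>

lemma min_at_critical_point:
  fixes f f' :: "real \<Rightarrow> real"
  assumes "e > 0" "\<And>s. \<bar>s\<bar> < e \<Longrightarrow> (f has_real_derivative f' s) (at s)" "f' 0 = 0" "(f' has_real_derivative l) (at 0)" "l > 0"
  obtains d where "d > 0" "\<And>s. \<bar>s\<bar> < d \<Longrightarrow> f 0 \<le> f s"
proof -
  obtain d1 where d1: "d1 > 0" "\<And>h. 0 < h \<Longrightarrow> h < d1 \<Longrightarrow> f' 0 < f' (0 + h)"
    using DERIV_pos_inc_right[OF assms(4,5)] by blast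
  obtain d2 where d2: "d2 > 0" "\<And>h. 0 < h \<Longrightarrow> h < d2 \<Longrightarrow> f' (0 - h) < f' 0"
    using DERIV_pos_inc_left[OF assms(4,5)] by blast
  define d where "d = min e (min d1 d2)"
  have d: "d > 0" "d \<le> e" "d \<le> d1" "d \<le> d2" using assms(1) d1(1) d2(1) by (auto simp: d_def)
  have "f 0 \<le> f s" if s: "\<bar>s\<bar> < d" for s
  proof (cases "0 \<le> s")
    case True
    show ?thesis
    proof (rule DERIV_nonneg_imp_nondecreasing[OF True])
      fix x assume x: "0 \<le> x" "x \<le> s"
      have "f' x \<ge> 0" using d1(2)[of x] x s d assms(3) by (cases "x = 0") auto
      then show "\<exists>y. (f has_real_derivative y) (at x) \<and> 0 \<le> y" using assms(2)[of x] x s d by auto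
    qed
  next
    case False
    show ?thesis
    proof (rule DERIV_nonpos_imp_nonincreasing[of s 0])
      fix x assume x: "s \<le> x" "x \<le> 0"
      have "f' x \<le> 0" using d2(2)[of "- x"] x s d assms(3) by (cases "x = 0") auto
      then show "\<exists>y. (f has_real_derivative y) (at x) \<and> y \<le> 0" using assms(2)[of x] x s d by auto
    qed (use False in simp)
  qed
  then show thesis using d(1) that by blast
qed

lemma isCont_ball_less:
  fixes f :: "'a::metric_space \<Rightarrow> real"
  assumes "isCont f z" "f z < c"
  obtains r where "r > 0" "\<And>w. dist w z < r \<Longrightarrow> f w < c"
proof -
  have "eventually (\<lambda>w. f w < c) (nhds z)"
    using assms by (intro order_tendstoD(2)[of f "f z"]) (auto simp: isCont_def tendsto_at_iff_tendsto_nhds)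
  then show thesis using that unfolding eventually_nhds_metric by blast
qed

text \<open>An exact solution \<open>H (|x - y'|\<^sup>2) + c t\<close> centred at the midpoint \<open>y'\<close> of \<open>x\<^sub>0\<close> and the centre of the Gaussian
  has smaller second derivatives but a larger time derivative than the Gaussian subsolution at the touching point.
  Raised slightly, it lies below \<open>u\<close> on the parabolic boundary of a small box, but not at the touching point.\<close>

lemma gaussian_not_touching:
  fixes \<Theta> :: "'n::finite spacetime set" and z0 \<zeta> :: "'n spacetime"
  assumes p: "1 < p" and \<Theta>: "open \<Theta>" and u: "p_superparabolic p \<Theta> u" and z0: "z0 \<in> \<Theta>"
    and B: "B > 0" "\<gamma> > 0" and x0: "fst z0 \<noteq> fst \<zeta>"
    and \<Lambda>0: "0 \<le> \<Lambda>"
    and \<Lambda>: "(2 * \<gamma> * gauss B \<gamma> \<zeta> z0 * norm (fst z0 - fst \<zeta>)) powr (2 - p) * (snd \<zeta> - snd z0) \<le> \<Lambda>"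
    and cond: "\<Lambda> + real CARD('n) + p - 2 < \<gamma> * (p - 1) * (norm (fst z0 - fst \<zeta>))^2"
    and below: "\<And>z. z \<in> \<Theta> \<Longrightarrow> ereal (k + gauss B \<gamma> \<zeta> z) \<le> u z"
  shows "u z0 \<noteq> ereal (k + gauss B \<gamma> \<zeta> z0)"
proof
  assume touch: "u z0 = ereal (k + gauss B \<gamma> \<zeta> z0)"
  define n where "n = real CARD('n)"
  have n: "n \<ge> 1" by (simp add: n_def Suc_leI)
  define E where "E = gauss B \<gamma> \<zeta>"
  define E0 where "E0 = E z0"
  have E0: "E0 > 0" using B by (simp add: E0_def E_def gauss_def)
  define x y t s where "x = fst z0" and "y = fst \<zeta>" and "t = snd z0" and "s = snd \<zeta>"
  have z0eq: "z0 = (x, t)" by (simp add: x_def t_def)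
  define r0 where "r0 = (norm (x - y))^2"
  have r0: "r0 > 0" using x0 by (simp add: r0_def x_def y_def)
  define gap where "gap = \<gamma> * (p - 1) * r0 - (n + p - 2) - \<Lambda>"
  have gap: "gap > 0" using cond by (simp add: gap_def r0_def n_def x_def y_def)
  \<comment> \<open>The Gaussian has spatial gradient \<open>- 2 * \<gamma> * E0 (x - y)\<close> at
    the touching point. The solution has \<open>- 2 * \<kappa> (x - y')\<close>, which is
    \<open>- \<kappa> (x - y)\<close> as \<open>y'\<close> is the midpoint. This \<kappa> matches
    the two gradients.\<close>
  define \<kappa> where "\<kappa> = 2 * \<gamma> * E0"
  have \<kappa>: "\<kappa> > 0" using B E0 by (simp add: \<kappa>_def)
  \<comment> \<open>The squared distance from \<open>x\<close> to the midpoint, which is half as far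
    away as \<open>y\<close>.\<close>
  define \<tau> where "\<tau> = r0 / 4"
  have \<tau>: "\<tau> > 0" using r0 by (simp add: \<tau>_def)
  define \<mu> where "\<mu> = (2 * \<kappa>) powr (p - 1) * \<tau> powr ((p - 2) / 2)"
  have \<mu>: "\<mu> > 0" using \<kappa> \<tau> by (simp add: \<mu>_def)
  \<comment> \<open>Here \<open>g\<close> is the common length of the two gradients and
    \<open>\<mu> = 2 * \<kappa> * g powr (p - 2)\<close>, which turns the hypothesis on \<Lambda>
    into a bound for the time derivative.\<close>
  have \<mu>\<Lambda>: "2 * \<kappa> * (s - t) \<le> \<mu> * \<Lambda>"
  proof -
    define g where "g = \<kappa> * norm (x - y)"
    have g: "g > 0" using \<kappa> x0 by (simp add: g_def x_def y_def)
    have nt: "norm (x - y) = 2 * \<tau> powr (1 / 2)"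
      using r0 by (simp add: \<tau>_def r0_def powr_half_sqrt real_sqrt_divide)
    have "\<mu> = 2 * \<kappa> * g powr (p - 2)"
    proof -
      have "(2 * \<kappa>) powr (p - 1) = 2 * \<kappa> * (2 * \<kappa>) powr (p - 2)" using powr_mult_base[of "2 * \<kappa>" "p - 2"] \<kappa> by simp
      moreover have "\<tau> powr ((p - 2) / 2) = (\<tau> powr (1 / 2)) powr (p - 2)" by (simp add: powr_powr)
      moreover have "g powr (p - 2) = (2 * \<kappa>) powr (p - 2) * (\<tau> powr (1 / 2)) powr (p - 2)"
        unfolding g_def nt using \<kappa> \<tau> by (simp add: powr_mult mult_ac)
      ultimately show ?thesis by (simp add: \<mu>_def mult.assoc)
    qed
    moreover have "g powr (2 - p) * (s - t) \<le> \<Lambda>"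
      using \<Lambda> by (simp add: g_def \<kappa>_def E0_def E_def x_def y_def t_def s_def)
    then have "\<mu> * (g powr (2 - p) * (s - t)) \<le> \<mu> * \<Lambda>" using \<mu> by (intro mult_left_mono) auto
    moreover have "g powr (p - 2) * g powr (2 - p) = 1" using g by (simp add: powr_add[symmetric])
    then have "2 * \<kappa> * g powr (p - 2) * (g powr (2 - p) * (s - t)) = 2 * \<kappa> * (s - t)"
      by (metis mult.assoc mult.right_neutral)
    ultimately show ?thesis by simp
  qed
  \<comment> \<open>\<open>c\<close> has to exceed the time derivative
    \<open>\<kappa> * (s - t) \<le> \<mu> * \<Lambda> / 2\<close> of the Gaussian, and yet be small
    enough for the solution to have the smaller second derivative. The second demand is the
    inequality \<open>c1\<close>; the positive \<open>gap\<close> leaves room for both.\<close>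
  define c where "c = \<mu> * (\<Lambda> / 2 + gap / 2)"
  have c1: "n + p - 2 + c / \<mu> < \<gamma> * (p - 1) * r0"
  proof -
    have "c / \<mu> = \<Lambda> / 2 + gap / 2" using \<mu> by (simp add: c_def)
    then show ?thesis using \<Lambda>0 gap gap_def by linarith
  qed
  define vt where "vt z = - (2 * \<gamma> * (snd z - s)) * E z" for z
  have c2: "vt z0 < c"
  proof -
    have "vt z0 = \<kappa> * (- (t - s))" by (simp add: vt_def \<kappa>_def E0_def t_def algebra_simps)
    also have "\<dots> \<le> \<mu> * (\<Lambda> / 2)" using \<mu>\<Lambda> by simp
    also have "\<dots> < c" using \<mu> gap unfolding c_def by (intro mult_strict_left_mono) auto
    finally show ?thesis .
  qed
  obtain \<delta> H K where \<delta>: "\<delta> > 0" "\<delta> < \<tau>" and K: "\<And>\<tau>'. \<bar>\<tau>' - \<tau>\<bar> < \<delta> \<Longrightarrow> K \<tau>' > 0"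
    and H: "\<And>\<tau>'. \<bar>\<tau>' - \<tau>\<bar> < \<delta> \<Longrightarrow> (H has_real_derivative - K \<tau>') (at \<tau>')" and K\<tau>: "K \<tau> = \<kappa>"
    and K': "(K has_real_derivative - \<kappa> / (2 * \<tau> * (p - 1)) * (n + p - 2 + c / \<mu>)) (at \<tau>)"
    and par: "\<And>W (y::real^'n) t1 t2 d. (\<And>x. x \<in> W \<Longrightarrow> \<bar>(norm (x - y))^2 - \<tau>\<bar> < \<delta>) \<Longrightarrow>
        p_parabolic p (W \<times> {t1<..<t2}) (\<lambda>z. H ((norm (fst z - y))^2) + d + c * snd z)"
  proof (rule radial_solution[where 'n='n, OF p \<tau> \<kappa>, of c, folded n_def \<mu>_def], goal_cases)
    case 1
    show ?case by (rule 1(1)[OF 1(2-)])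
  qed
  \<comment> \<open>Gaussian minus solution at time \<open>t\<close>, up to a constant, as a
    function of the level variable \<sigma> of the Gaussian alone. The slopes agree at 0, and
    \<open>c1\<close> is exactly positivity of the second derivative there.\<close>
  define P where "P \<sigma> = E0 * exp (- \<gamma> * \<sigma>) - H (\<tau> + \<sigma> / 2)" for \<sigma>
  define P' where "P' \<sigma> = - \<gamma> * (E0 * exp (- \<gamma> * \<sigma>)) + K (\<tau> + \<sigma> / 2) / 2" for \<sigma>
  obtain d where d: "d > 0" "\<And>\<sigma>. \<bar>\<sigma>\<bar> < d \<Longrightarrow> P 0 \<le> P \<sigma>"
  proof (rule min_at_critical_point)
    show "2 * \<delta> > 0" using \<delta> by simp
    show "(P has_real_derivative P' \<sigma>) (at \<sigma>)" if "\<bar>\<sigma>\<bar> < 2 * \<delta>" for \<sigma>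
    proof -
      have "((\<lambda>\<sigma>. H (\<tau> + \<sigma> / 2)) has_real_derivative - K (\<tau> + \<sigma> / 2) * (1 / 2)) (at \<sigma>)"
        by (rule DERIV_chain2[where f=H]) (use H[of "\<tau> + \<sigma> / 2"] that in \<open>auto intro!: derivative_eq_intros\<close>)
      then show ?thesis unfolding P_def P'_def by (auto intro!: derivative_eq_intros)
    qed
    show "P' 0 = 0" by (simp add: P'_def K\<tau> \<kappa>_def)
    have "((\<lambda>\<sigma>. K (\<tau> + \<sigma> / 2)) has_real_derivative (- \<kappa> / (2 * \<tau> * (p - 1)) * (n + p - 2 + c / \<mu>)) * (1 / 2)) (at 0)"
      by (rule DERIV_chain2[where f=K]) (use K' in \<open>auto intro!: derivative_eq_intros\<close>)
    then show "(P' has_real_derivative \<gamma> * (\<gamma> * E0) + (- \<kappa> / (2 * \<tau> * (p - 1)) * (n + p - 2 + c / \<mu>)) / 4) (at 0)"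
      unfolding P'_def by (auto intro!: derivative_eq_intros)
    have "(n + p - 2 + c / \<mu>) / (r0 * (p - 1)) < \<gamma>"
      using c1 r0 p by (simp add: pos_divide_less_eq mult_ac)
    then have lt: "\<gamma> * E0 * ((n + p - 2 + c / \<mu>) / (r0 * (p - 1))) < \<gamma> * E0 * \<gamma>"
      using B E0 by (intro mult_strict_left_mono) auto
    have e: "(- \<kappa> / (2 * \<tau> * (p - 1)) * X) / 4 = - (\<gamma> * E0 * (X / (r0 * (p - 1))))" for X
      using r0 p by (simp add: \<kappa>_def \<tau>_def)
    have "\<gamma> * (\<gamma> * E0) = \<gamma> * E0 * \<gamma>" by simp
    then show "\<gamma> * (\<gamma> * E0) + (- \<kappa> / (2 * \<tau> * (p - 1)) * (n + p - 2 + c / \<mu>)) / 4 > 0"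
      unfolding e using lt by linarith
  qed blast
  obtain \<delta>2 where \<delta>2: "\<delta>2 > 0" "\<And>\<tau>'. dist \<tau>' \<tau> < \<delta>2 \<Longrightarrow> - K \<tau>' < - (\<kappa> / 2)"
  proof -
    have "isCont (\<lambda>\<tau>'. - K \<tau>') \<tau>" "- K \<tau> < - (\<kappa> / 2)" using DERIV_isCont[OF K'] K\<tau> \<kappa> by auto
    from isCont_ball_less[OF this] that show thesis by blast
  qed
  define \<delta>3 where "\<delta>3 = min \<delta> \<delta>2"
  have H_dec: "(\<kappa> / 2) * (b - a) \<le> H a - H b" if ab: "\<bar>a - \<tau>\<bar> < \<delta>3" "\<bar>b - \<tau>\<bar> < \<delta>3" "a \<le> b" for a b
  proof (cases "a = b")
    case False
    have "\<exists>q>a. q < b \<and> H b - H a = (b - a) * - K q"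
      by (rule MVT2) (use False ab in \<open>auto intro!: H simp: \<delta>3_def\<close>)
    then obtain q where q: "a < q" "q < b" "H b - H a = (b - a) * - K q" by blast
    have "\<delta>3 \<le> \<delta>2" by (simp add: \<delta>3_def)
    then have "dist q \<tau> < \<delta>2" using q(1,2) ab(1,2) unfolding dist_real_def abs_less_iff by linarith
    then have "\<kappa> / 2 \<le> K q" using \<delta>2(2)[of q] by simp
    then have "(b - a) * (\<kappa> / 2) \<le> (b - a) * K q" using ab(3) by (intro mult_left_mono) auto
    then show ?thesis using q(3) by (simp add: algebra_simps)
  qed simp
  \<comment> \<open>The reason for the midpoint is the identity \<open>y'eq\<close>: the squared
    distance to \<open>y'\<close> is \<tau> plus half of \<sigma>, on which the Gaussian depends,
    plus half of \<omega>, the squared distance to \<open>x\<close>. Since \<open>H\<close>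
    decreases, the second summand pushes the solution strictly below the Gaussian in every spatial
    direction.\<close>
  define y' where "y' = (1 / 2) *\<^sub>R (x + y)"
  define \<sigma> \<omega> where "\<sigma> w = (norm (w - y))^2 - r0" and "\<omega> w = (norm (w - x))^2" for w
  have par_law: "(norm (a + b))^2 = 2 * (norm a)^2 + 2 * (norm b)^2 - (norm (b - a))^2" for a b :: "real^'n"
    unfolding power2_norm_eq_inner by (simp add: inner_add_left inner_add_right inner_diff_left inner_diff_right inner_commute)
  have y'eq: "(norm (w - y'))^2 = \<tau> + \<sigma> w / 2 + \<omega> w / 2" for w
  proof -
    have "4 * (norm (w - y'))^2 = (norm (2 *\<^sub>R (w - y')))^2" by (simp add: power2_eq_square)
    also have "2 *\<^sub>R (w - y') = (w - x) + (w - y)" by (simp add: y'_def vec_eq_iff field_simps)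
    also have "(norm ((w - x) + (w - y)))^2 = 2 * (norm (w - x))^2 + 2 * (norm (w - y))^2 - (norm ((w - y) - (w - x)))^2"
      by (rule par_law)
    also have "(w - y) - (w - x) = x - y" by simp
    finally show ?thesis by (simp add: \<tau>_def \<sigma>_def \<omega>_def r0_def field_simps)
  qed
  have cont_\<sigma>: "isCont (\<lambda>z::'n spacetime. \<bar>\<sigma> (fst z)\<bar>) z0" "isCont (\<lambda>z::'n spacetime. \<bar>\<sigma> (fst z)\<bar> / 2 + \<omega> (fst z) / 2) z0"
    unfolding \<sigma>_def \<omega>_def by (intro continuous_intros; simp)+
  have \<sigma>0: "\<sigma> x = 0" "\<omega> x = 0" by (simp_all add: \<sigma>_def \<omega>_def r0_def)
  obtain R1 where R1: "R1 > 0" "\<And>z::'n spacetime. dist z z0 < R1 \<Longrightarrow> \<bar>\<sigma> (fst z)\<bar> < d"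
    using isCont_ball_less[OF cont_\<sigma>(1), of d] d(1) \<sigma>0 by (auto simp: x_def)
  obtain R2 where R2: "R2 > 0" "\<And>z::'n spacetime. dist z z0 < R2 \<Longrightarrow> \<bar>\<sigma> (fst z)\<bar> / 2 + \<omega> (fst z) / 2 < \<delta>3"
    using isCont_ball_less[OF cont_\<sigma>(2), of \<delta>3] \<sigma>0 \<delta>(1) \<delta>2(1) by (auto simp: x_def \<delta>3_def)
  have vtc: "isCont vt z0"
  proof -
    have "continuous_on UNIV vt" unfolding vt_def E_def by (intro continuous_intros gauss_continuous)
    then show ?thesis unfolding continuous_on_eq_continuous_at[OF open_UNIV] by blast
  qed
  obtain R3 where R3: "R3 > 0" "\<And>z. dist z z0 < R3 \<Longrightarrow> vt z < c" using isCont_ball_less[OF vtc c2] by blast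
  \<comment> \<open>Near \<open>z0\<close> the solution overtakes the Gaussian in time at a rate
    below \<open>L\<close>.\<close>
  define L where "L = c - vt z0 + 1"
  obtain R4 where R4: "R4 > 0" "\<And>z. dist z z0 < R4 \<Longrightarrow> - vt z < L - c"
  proof -
    have "isCont (\<lambda>z. - vt z) z0" "- vt z0 < L - c" using vtc by (auto simp: L_def)
    from isCont_ball_less[OF this] that show thesis by blast
  qed
  have L: "L > 0" using c2 by (simp add: L_def)
  obtain R5 where R5: "R5 > 0" "ball z0 R5 \<subseteq> \<Theta>" using \<Theta> z0 open_contains_ball by blast
  define R where "R = min R1 (min R2 (min R3 (min R4 R5)))"
  have R: "R > 0" "R \<le> R1" "R \<le> R2" "R \<le> R3" "R \<le> R4" "R \<le> R5"
    using R1(1) R2(1) R3(1) R4(1) R5(1) by (auto simp: R_def)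
  \<comment> \<open>Half the side of the box: \<open>n * e = R / 2\<close> bounds the spatial
    distance to \<open>x\<close>, by the sum of the coordinates.\<close>
  define e where "e = R / (2 * n)"
  have e: "e > 0" using R n by (simp add: e_def)
  \<comment> \<open>The duration is so short compared with the width that the loss
    \<open>L * \<eta>\<close> after time \<open>t\<close> stays below the gain
    \<open>(\<kappa> / 4) * e^2\<close> on the lateral faces.\<close>
  define \<eta> where "\<eta> = min (R / 4) (\<kappa> * e^2 / (8 * L))"
  have \<eta>: "\<eta> > 0" "\<eta> < R / 2" using R \<kappa> e L by (auto simp: \<eta>_def)
  have L\<eta>: "L * \<eta> < (\<kappa> / 4) * e^2"
  proof -
    have "L * \<eta> \<le> L * (\<kappa> * e^2 / (8 * L))" using L by (intro mult_left_mono) (auto simp: \<eta>_def)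
    also have "\<dots> = \<kappa> * e^2 / 8" using L by simp
    also have "\<dots> < (\<kappa> / 4) * e^2" using \<kappa> e by simp
    finally show ?thesis .
  qed
  define a b where "a = x - (\<chi> i. e)" and "b = x + (\<chi> i. e)"
  define t1 t2 where "t1 = t - \<eta>" and "t2 = t + \<eta>"
  have ab: "a $ i < b $ i" for i using e by (simp add: a_def b_def)
  have t12: "t1 < t2" using \<eta> by (simp add: t1_def t2_def)
  have near: "dist z z0 < R" if z: "z \<in> cbox a b \<times> {t1..t2}" for z
  proof -
    have "norm (fst z - x) \<le> (\<Sum>i\<in>UNIV. \<bar>(fst z - x) $ i\<bar>)" by (rule norm_le_l1_cart)
    also have "\<dots> \<le> (\<Sum>i\<in>(UNIV::'n set). e)"
    proof (rule sum_mono)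
      fix i :: 'n
      have "a $ i \<le> fst z $ i" "fst z $ i \<le> b $ i" using z by (auto simp: mem_box_cart)
      then show "\<bar>(fst z - x) $ i\<bar> \<le> e" by (simp add: a_def b_def)
    qed
    also have "\<dots> = R / 2" using n by (simp add: e_def n_def[symmetric])
    finally have "norm (fst z - x) \<le> R / 2" .
    moreover have "\<bar>snd z - t\<bar> \<le> \<eta>" using z by (auto simp: t1_def t2_def)
    moreover have "dist z z0 \<le> norm (fst z - x) + \<bar>snd z - t\<bar>"
      using norm_Pair_le[of "fst z - x" "snd z - t"] by (simp add: dist_norm z0eq minus_prod_def)
    ultimately show ?thesis using \<eta> by linarith
  qed
  have sub: "cbox a b \<times> {t1..t2} \<subseteq> \<Theta>"
    using near R(6) R5(2) by (fastforce simp: dist_commute)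
  define h where "h z = H ((norm (fst z - y'))^2) + (k + E0 - H \<tau> - c * t) + c * snd z" for z
  have hz0: "h z0 = k + E0" using y'eq[of x] by (simp add: h_def \<sigma>0 t_def[symmetric] x_def[symmetric])
  have in_\<delta>: "\<bar>(norm (w - y'))^2 - \<tau>\<bar> < \<delta>3 \<and> \<bar>(\<tau> + \<sigma> w / 2) - \<tau>\<bar> < \<delta>3" if "w \<in> cbox a b" for w
  proof -
    have "(w, t) \<in> cbox a b \<times> {t1..t2}" using that \<eta> by (simp add: t1_def t2_def)
    then have "\<bar>\<sigma> w\<bar> / 2 + \<omega> w / 2 < \<delta>3" using R2(2)[of "(w, t)"] near[of "(w, t)"] R(3) by simp
    moreover have "\<omega> w \<ge> 0" by (simp add: \<omega>_def)
    ultimately show ?thesis unfolding y'eq by (simp add: abs_if split: if_splits)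
  qed
  have hp: "p_parabolic p (box a b \<times> {t1<..<t2}) (\<lambda>z. h z + \<epsilon>)" for \<epsilon>
  proof -
    have "p_parabolic p (box a b \<times> {t1<..<t2}) (\<lambda>z. H ((norm (fst z - y'))^2) + (k + E0 - H \<tau> - c * t + \<epsilon>) + c * snd z)"
    proof (rule par)
      fix w assume "w \<in> box a b"
      then show "\<bar>(norm (w - y'))^2 - \<tau>\<bar> < \<delta>" using in_\<delta>[of w] box_subset_cbox[of a b] by (auto simp: \<delta>3_def)
    qed
    then show ?thesis by (simp add: h_def algebra_simps)
  qed
  have hcont: "continuous_on (cbox a b \<times> {t1..t2}) h"
  proof -
    have "continuous_on {\<tau>'. \<bar>\<tau>' - \<tau>\<bar> < \<delta>} H"
      using H DERIV_isCont by (intro continuous_at_imp_continuous_on) blast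
    then have "continuous_on (cbox a b \<times> {t1..t2}) (\<lambda>z. H ((norm (fst z - y'))^2))"
      by (rule continuous_on_compose2[where f="\<lambda>z. (norm (fst z - y'))^2"])
        (use in_\<delta> in \<open>auto intro!: continuous_intros simp: \<delta>3_def\<close>)
    then show ?thesis unfolding h_def by (intro continuous_intros)
  qed
  define v where "v z = k + E z" for z
  have E_slice: "E (w, t) = E0 * exp (- \<gamma> * \<sigma> w)" for w
  proof -
    have "(norm ((w, t) - \<zeta>))^2 = (norm (z0 - \<zeta>))^2 + \<sigma> w"
      unfolding \<sigma>_def r0_def z0eq y_def by (simp add: power2_norm_eq_inner inner_prod_def)
    then show ?thesis by (simp add: E_def E0_def gauss_def exp_add[symmetric] algebra_simps)
  qed
  \<comment> \<open>The two comparisons are added: along \<sigma> by the minimum of \<open>P\<close>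
    at 0, and from \<open>\<tau> + \<sigma>/2\<close> to the true squared distance by the decrease
    of \<open>H\<close>.\<close>
  have S: "(\<kappa> / 4) * \<omega> w \<le> E (w, t) - E0 - H ((norm (w - y'))^2) + H \<tau>" if w: "w \<in> cbox a b" for w
  proof -
    have "(w, t) \<in> cbox a b \<times> {t1..t2}" using that \<eta> by (simp add: t1_def t2_def)
    then have "\<bar>\<sigma> w\<bar> < d" using R1(2)[of "(w, t)"] near[of "(w, t)"] R(2) by simp
    then have "P 0 \<le> P (\<sigma> w)" by (rule d(2))
    then have 1: "0 \<le> E (w, t) - E0 - H (\<tau> + \<sigma> w / 2) + H \<tau>" by (simp add: P_def E_slice)
    have "(\<kappa> / 2) * ((norm (w - y'))^2 - (\<tau> + \<sigma> w / 2)) \<le> H (\<tau> + \<sigma> w / 2) - H ((norm (w - y'))^2)"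
      using in_\<delta>[OF w] by (intro H_dec) (auto simp: y'eq \<omega>_def)
    then have "(\<kappa> / 4) * \<omega> w \<le> H (\<tau> + \<sigma> w / 2) - H ((norm (w - y'))^2)" by (simp add: y'eq)
    then show ?thesis using 1 by simp
  qed
  have time_deriv: "((\<lambda>r. E (w, r)) has_real_derivative vt (w, r)) (at r)" for w r
  proof -
    have "has_partial E time_dir (vt (w, r)) (w, r)"
      using gauss_partial[of B \<gamma> \<zeta> time_dir "(w, r)"] by (simp add: E_def vt_def inner_time_dir s_def)
    moreover have "(w, r) = (w, 0) + r *\<^sub>R time_dir" by (simp add: time_dir_def)
    ultimately have "((\<lambda>r. E ((w, 0) + r *\<^sub>R time_dir)) has_real_derivative vt (w, r)) (at r)"
      by (intro has_partial_line) (simp only:)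
    then show ?thesis by (simp add: time_dir_def)
  qed
  have diff_eq: "v (w, r) - h (w, r) = (E (w, r) - E (w, t) - c * (r - t)) + (E (w, t) - E0 - H ((norm (w - y'))^2) + H \<tau>)" for w r
    by (simp add: v_def h_def algebra_simps)
  \<comment> \<open>Since the solution grows faster in time than the Gaussian, it lies strictly
    lower at earlier times; this handles the bottom of the box.\<close>
  have before: "0 < E (w, r) - E (w, t) - c * (r - t)" if w: "w \<in> cbox a b" and r: "t1 \<le> r" "r < t" for w r
  proof -
    have "\<exists>q>r. q < t \<and> E (w, t) - E (w, r) = (t - r) * vt (w, q)"
      by (rule MVT2) (use r time_deriv in auto)
    then obtain q where q: "r < q" "q < t" "E (w, t) - E (w, r) = (t - r) * vt (w, q)" by blast
    have "vt (w, q) < c" using near[of "(w, q)"] w q r R(4) \<eta> by (intro R3(2)) (auto simp: t2_def)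
    then have "(t - r) * vt (w, q) < (t - r) * c" using r by (intro mult_strict_left_mono) auto
    then show ?thesis using q(3) by (simp add: algebra_simps)
  qed
  have after: "- (L * \<eta>) \<le> E (w, r) - E (w, t) - c * (r - t)" if w: "w \<in> cbox a b" and r: "t < r" "r \<le> t2" for w r
  proof -
    have "\<exists>q>t. q < r \<and> E (w, r) - E (w, t) = (r - t) * vt (w, q)"
      by (rule MVT2) (use r time_deriv in auto)
    then obtain q where q: "t < q" "q < r" "E (w, r) - E (w, t) = (r - t) * vt (w, q)" by blast
    have "- vt (w, q) < L - c" using near[of "(w, q)"] w q r R(5) \<eta> by (intro R4(2)) (auto simp: t1_def)
    then have "(r - t) * (c - vt (w, q)) \<le> (r - t) * L" using r by (intro mult_left_mono) auto
    also have "\<dots> \<le> L * \<eta>" using r L by (simp add: t2_def mult.commute)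
    finally show ?thesis using q(3) by (simp add: algebra_simps)
  qed
  define S where "S = cbox a b \<times> {t1} \<union> (cbox a b - box a b) \<times> {t1..t2}"
  have pos: "0 < v z - h z" if "z \<in> S" for z
  proof -
    obtain w r where zeq: "z = (w, r)" by (cases z)
    have w: "w \<in> cbox a b" and r: "t1 \<le> r" "r \<le> t2" using that t12 by (auto simp: S_def zeq)
    have \<omega>0: "\<omega> w \<ge> 0" by (simp add: \<omega>_def)
    have S0: "0 \<le> E (w, t) - E0 - H ((norm (w - y'))^2) + H \<tau>"
      using S[OF w] mult_nonneg_nonneg[of "\<kappa> / 4", OF _ \<omega>0] \<kappa> by linarith
    show ?thesis
    proof (cases "r < t")
      case True
      then show ?thesis using before[OF w r(1)] S0 unfolding zeq diff_eq by linarith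
    next
      case False
      then have "w \<notin> box a b" using that \<eta> by (auto simp: S_def zeq t1_def)
      then obtain i where "\<not> (a $ i < w $ i \<and> w $ i < b $ i)" by (auto simp: mem_box_cart)
      then have "e \<le> \<bar>(w - x) $ i\<bar>" by (auto simp: a_def b_def)
      then have "e \<le> norm (w - x)" using component_le_norm_cart[of "w - x" i] by linarith
      then have "e^2 \<le> \<omega> w" unfolding \<omega>_def using e by (intro power_mono) auto
      then have "(\<kappa> / 4) * e^2 \<le> (\<kappa> / 4) * \<omega> w" using \<kappa> by (intro mult_left_mono) auto
      then have 1: "(\<kappa> / 4) * e^2 \<le> E (w, t) - E0 - H ((norm (w - y'))^2) + H \<tau>" using S[OF w] by linarith
      have "- (L * \<eta>) \<le> E (w, r) - E (w, t) - c * (r - t)"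
      proof (cases "r = t")
        case True
        then show ?thesis using L \<eta> by simp
      next
        case False
        then show ?thesis using \<open>\<not> r < t\<close> by (intro after[OF w _ r(2)]) simp
      qed
      then show ?thesis using 1 L\<eta> unfolding zeq diff_eq by linarith
    qed
  qed
  have Ssub: "S \<subseteq> cbox a b \<times> {t1..t2}" using t12 by (auto simp: S_def)
  have "compact S"
    unfolding S_def by (intro compact_Un compact_Times compact_diff) auto
  moreover have "S \<noteq> {}"
  proof -
    have "(x, t1) \<in> S" using e by (auto simp: S_def mem_box_cart a_def b_def)
    then show ?thesis by auto
  qed
  moreover have "continuous_on S (\<lambda>z. v z - h z)"
    using continuous_on_subset[OF hcont Ssub] unfolding v_def E_def by (intro continuous_intros gauss_continuous)
  ultimately obtain zm where zm: "zm \<in> S" "\<And>z. z \<in> S \<Longrightarrow> v zm - h zm \<le> v z - h z"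
    using continuous_attains_inf[of S "\<lambda>z. v z - h z"] by blast
  \<comment> \<open>The least gap on the parabolic boundary. Raised by it, the solution still lies
    below \<open>u\<close> there, but exceeds \<open>u\<close> at \<open>z0\<close>, where solution
    and Gaussian agree.\<close>
  define \<epsilon> where "\<epsilon> = v zm - h zm"
  have \<epsilon>: "\<epsilon> > 0" using pos[OF zm(1)] by (simp add: \<epsilon>_def)
  have cl: "closure (box a b \<times> {t1<..<t2}) = cbox a b \<times> {t1..t2}" by (rule closure_box_cylinder[OF ab t12])
  have "compactly_contained (box a b \<times> {t1<..<t2}) \<Theta>"
    unfolding compactly_contained_def cl using sub by (auto intro: compact_Times)
  moreover have "continuous_on (closure (box a b \<times> {t1<..<t2})) (\<lambda>z. h z + \<epsilon>)"
    unfolding cl by (intro continuous_intros hcont)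
  moreover have "\<forall>\<xi>\<in>parabolic_boundary (box a b) t1 t2. ereal (h \<xi> + \<epsilon>) \<le> u \<xi>"
  proof
    fix \<xi> assume "\<xi> \<in> parabolic_boundary (box a b) t1 t2"
    then have \<xi>: "\<xi> \<in> S" using parabolic_boundary_compact_cover[OF ab t12] by (auto simp: S_def)
    have "ereal (h \<xi> + \<epsilon>) \<le> ereal (v \<xi>)" using zm(2)[OF \<xi>] by (simp add: \<epsilon>_def)
    also have "\<dots> \<le> u \<xi>" using below[of \<xi>] \<xi> Ssub sub by (auto simp: v_def E_def)
    finally show "ereal (h \<xi> + \<epsilon>) \<le> u \<xi>" .
  qed
  moreover have "z0 \<in> box a b \<times> {t1<..<t2}"
    using e \<eta> by (auto simp: z0eq mem_box_cart a_def b_def t1_def t2_def)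
  ultimately have "ereal (h z0 + \<epsilon>) \<le> u z0"
    using u ab t12 hp unfolding p_superparabolic_def by blast
  then show False using touch hz0 \<epsilon> by (simp add: E0_def E_def)
qed

section \<open>Minimum principles for superparabolic functions\<close>

lemma lsc_minus_continuous_attains_inf:
  fixes u :: "'a::euclidean_space \<Rightarrow> ereal" and v :: "'a \<Rightarrow> real"
  assumes \<Theta>: "open \<Theta>" "bounded \<Theta>" and u: "\<And>\<xi>. \<xi> \<in> \<Theta> \<Longrightarrow> u \<xi> \<noteq> -\<infinity>" "lower_semicontinuous_on \<Theta> u"
    and v: "continuous_on UNIV v" and bdry: "\<And>\<xi>. \<xi> \<in> frontier \<Theta> \<Longrightarrow> ereal (v \<xi>) \<le> Liminf (at \<xi> within \<Theta>) u"
    and z1: "z1 \<in> \<Theta>" "u z1 < ereal (v z1)"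
  obtains z0 m where "z0 \<in> \<Theta>" "m < 0" "u z0 = ereal (m + v z0)" "\<And>z. z \<in> \<Theta> \<Longrightarrow> ereal (m + v z) \<le> u z"
proof -
  define w where "w z = u z - ereal (v z)" for z
  define I where "I = (INF z\<in>\<Theta>. w z)"
  have Iw: "I \<le> w z" if "z \<in> \<Theta>" for z unfolding I_def using that by (rule INF_lower)
  have uw: "u z = w z + ereal (v z)" for z unfolding w_def by (cases "u z") auto
  have "w z1 < 0" using z1(2) unfolding w_def by (cases "u z1") auto
  then have I0: "I < 0" using Iw[OF z1(1)] by simp
  \<comment> \<open>A minimising sequence for \<open>u - v\<close>. Its cluster point lies in the
    closure, and it remains to exclude the frontier.\<close>
  obtain f where f: "\<And>n. f n \<in> w ` \<Theta>" "f \<longlonglongrightarrow> I"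
    using Inf_as_limit[of "w ` \<Theta>"] z1(1) unfolding I_def by blast
  have "\<forall>n. \<exists>z. z \<in> \<Theta> \<and> w z = f n" using f(1) by (metis imageE)
  then obtain s where s: "\<And>n. s n \<in> \<Theta>" "\<And>n. w (s n) = f n" by metis
  have "compact (closure \<Theta>)" using \<Theta>(2) by simp
  then obtain z0 r where r: "z0 \<in> closure \<Theta>" "strict_mono r" "(s \<circ> r) \<longlonglongrightarrow> z0"
    using s(1) closure_subset unfolding compact_def by (metis subsetD)
  have "isCont v z0" using v by (simp add: continuous_on_eq_continuous_at)
  then have vl: "(\<lambda>n. v (s (r n))) \<longlonglongrightarrow> v z0"
    using r(3) isCont_tendsto_compose[of z0 v "s \<circ> r"] by (simp add: comp_def)
  have wl: "(\<lambda>n. w (s (r n))) \<longlonglongrightarrow> I"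
    using LIMSEQ_subseq_LIMSEQ[OF f(2) r(2)] s(2) by (simp add: comp_def)
  have ul: "(\<lambda>n. u (s (r n))) \<longlonglongrightarrow> I + ereal (v z0)"
    unfolding uw using wl vl I0 by (intro tendsto_add_ereal_general) auto
  \<comment> \<open>Treats interior and frontier points together. The limit inferior ignores the
    value at the point itself, hence the extra condition in case \<open>z0\<close> lies in
    \<Theta>.\<close>
  have lower: "L \<le> I + ereal (v z0)" if L: "L \<le> Liminf (at z0 within \<Theta>) u" "z0 \<in> \<Theta> \<Longrightarrow> L \<le> u z0" for L
  proof (rule ccontr)
    assume "\<not> L \<le> I + ereal (v z0)"
    then obtain y where y: "I + ereal (v z0) < y" "y < L" by (meson dense not_le)
    have "eventually (\<lambda>z. y < u z) (at z0 within \<Theta>)" using L(1) y(2) unfolding le_Liminf_iff by blast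
    then obtain S where S: "open S" "z0 \<in> S" "\<And>z. z \<in> S \<Longrightarrow> z \<noteq> z0 \<Longrightarrow> z \<in> \<Theta> \<Longrightarrow> y < u z"
      unfolding eventually_at_topological by blast
    have S': "y < u z" if "z \<in> S" "z \<in> \<Theta>" for z
      using S(3)[OF that(1) _ that(2)] L(2) y(2) that(2) by (cases "z = z0") (auto intro: less_le_trans)
    have "eventually (\<lambda>n. s (r n) \<in> S) sequentially"
      using topological_tendstoD[OF r(3) S(1,2)] by (simp add: comp_def)
    then have "eventually (\<lambda>n. y \<le> u (s (r n))) sequentially"
      by (rule eventually_mono) (use S' s(1) in \<open>auto intro: less_imp_le\<close>)
    then have "y \<le> I + ereal (v z0)" using tendsto_lowerbound[OF ul] by simp
    then show False using y(1) by simp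
  qed
  \<comment> \<open>At a frontier point the boundary condition would give
    \<open>v z0 \<le> I + v z0\<close>, impossible for negative \<open>I\<close>.\<close>
  have z0: "z0 \<in> \<Theta>"
  proof (rule ccontr)
    assume "z0 \<notin> \<Theta>"
    then have "z0 \<in> frontier \<Theta>" using r(1) \<Theta>(1) by (simp add: frontier_def interior_open)
    then have "ereal (v z0) \<le> I + ereal (v z0)" using lower bdry \<open>z0 \<notin> \<Theta>\<close> by blast
    then show False using I0 by (cases I) auto
  qed
  have "u z0 \<le> I + ereal (v z0)" using lower[of "u z0"] u(2) z0 by (auto simp: lower_semicontinuous_on_def)
  moreover have "I + ereal (v z0) \<le> u z0" unfolding uw using Iw[OF z0] by (intro add_right_mono)
  ultimately have eq: "u z0 = I + ereal (v z0)" by (rule antisym)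
  have "I \<noteq> -\<infinity>" using eq u(1)[OF z0] by auto
  then obtain m where m: "I = ereal m" using I0 by (cases I) auto
  show thesis
  proof (rule that[OF z0])
    show "m < 0" using I0 m by simp
    show "u z0 = ereal (m + v z0)" using eq m by simp
    show "ereal (m + v z) \<le> u z" if "z \<in> \<Theta>" for z
      using add_right_mono[OF Iw[OF that], of "ereal (v z)"] m by (simp add: uw)
  qed
qed

text \<open>If the inequality fails, the Gaussian shifted down by the minimum of the difference
  touches \<open>u\<close> from below at an interior point, against
  \<open>gaussian_not_touching\<close>. That minimum is negative, so \<open>u\<close> lies below the
  original Gaussian at the touching point; therefore \<open>cond\<close> speaks about such points
  only. The shift goes into \<open>k\<close> and leaves all slopes unchanged.\<close>

lemma superparabolic_ge_gauss:
  fixes \<Theta> :: "'n::finite spacetime set"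
  assumes p: "1 < p" and \<Theta>: "open \<Theta>" "bounded \<Theta>" and u: "p_superparabolic p \<Theta> u"
    and B: "B > 0" "\<gamma> > 0"
    and bdry: "\<And>\<xi>. \<xi> \<in> frontier \<Theta> \<Longrightarrow> ereal (k + gauss B \<gamma> \<zeta> \<xi>) \<le> Liminf (at \<xi> within \<Theta>) u"
    and cond: "\<And>z. z \<in> \<Theta> \<Longrightarrow> u z < ereal (k + gauss B \<gamma> \<zeta> z) \<Longrightarrow> fst z \<noteq> fst \<zeta> \<and> (\<exists>\<Lambda>\<ge>0.
      (2 * \<gamma> * gauss B \<gamma> \<zeta> z * norm (fst z - fst \<zeta>)) powr (2 - p) * (snd \<zeta> - snd z) \<le> \<Lambda> \<and>
      \<Lambda> + real CARD('n) + p - 2 < \<gamma> * (p - 1) * (norm (fst z - fst \<zeta>))^2)"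
    and z: "z \<in> \<Theta>"
  shows "ereal (k + gauss B \<gamma> \<zeta> z) \<le> u z"
proof (rule ccontr)
  assume neg: "\<not> ereal (k + gauss B \<gamma> \<zeta> z) \<le> u z"
  have us: "\<And>\<xi>. \<xi> \<in> \<Theta> \<Longrightarrow> u \<xi> \<noteq> -\<infinity>" "lower_semicontinuous_on \<Theta> u"
    using u unfolding p_superparabolic_def by blast+
  have vc: "continuous_on UNIV (\<lambda>z. k + gauss B \<gamma> \<zeta> z)" by (intro continuous_intros gauss_continuous)
  obtain z0 m where z0: "z0 \<in> \<Theta>" "m < 0" "u z0 = ereal (m + (k + gauss B \<gamma> \<zeta> z0))"
    "\<And>z. z \<in> \<Theta> \<Longrightarrow> ereal (m + (k + gauss B \<gamma> \<zeta> z)) \<le> u z"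
    using lsc_minus_continuous_attains_inf[OF \<Theta> us vc bdry z] neg by (metis not_le)
  have "u z0 < ereal (k + gauss B \<gamma> \<zeta> z0)" using z0(2,3) by simp
  from cond[OF z0(1) this] obtain \<Lambda> where "fst z0 \<noteq> fst \<zeta>" "0 \<le> \<Lambda>"
    "(2 * \<gamma> * gauss B \<gamma> \<zeta> z0 * norm (fst z0 - fst \<zeta>)) powr (2 - p) * (snd \<zeta> - snd z0) \<le> \<Lambda>"
    "\<Lambda> + real CARD('n) + p - 2 < \<gamma> * (p - 1) * (norm (fst z0 - fst \<zeta>))^2" by blast
  from gaussian_not_touching[OF p \<Theta>(1) u z0(1) B this, of "m + k"] z0(3,4) show False
    by (simp add: add.assoc)
qed

text \<open>A constant has no slope with which to run the touching argument, so it is approximated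
  by Gaussians of amplitude \<open>B\<close>, and \<open>B\<close> tends to 0.\<close>

lemma superparabolic_ge_const:
  fixes \<Theta> :: "'n::finite spacetime set"
  assumes p: "1 < p" and \<Theta>: "open \<Theta>" "bounded \<Theta>" and u: "p_superparabolic p \<Theta> u"
    and bdry: "\<And>\<xi>. \<xi> \<in> frontier \<Theta> \<Longrightarrow> ereal k \<le> Liminf (at \<xi> within \<Theta>) u"
    and z: "z \<in> \<Theta>"
  shows "ereal k \<le> u z"
proof -
  obtain R where R: "R > 0" "\<And>z. z \<in> \<Theta> \<Longrightarrow> norm z < R"
    using \<Theta>(2) unfolding bounded_pos_less by blast
  define j :: 'n where "j = undefined"
  \<comment> \<open>The centre lies at spatial distance at least 1 from all points of \<Theta> and
    not later than any of them. The time term in the subsolution condition is then nonpositive for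
    every amplitude, and \<open>\<Lambda> = 0\<close> serves.\<close>
  define \<zeta> :: "'n spacetime" where "\<zeta> = ((R + 1) *\<^sub>R axis j 1, - R)"
  \<comment> \<open>Makes \<open>\<gamma> * (p - 1) = n + p\<close>, which exceeds
    \<open>n + p - 2\<close>.\<close>
  define \<gamma> where "\<gamma> = (real CARD('n) + p) / (p - 1)"
  have \<gamma>: "\<gamma> > 0" using p by (simp add: \<gamma>_def add_nonneg_pos)
  have dist: "norm (fst z - fst \<zeta>) \<ge> 1" "snd \<zeta> - snd z \<le> 0" if "z \<in> \<Theta>" for z
  proof -
    have "norm (fst z) < R" "\<bar>snd z\<bar> < R"
      using R(2)[OF that] norm_fst_le[of "fst z" "snd z"] norm_snd_le[of "snd z" "fst z"] by auto
    moreover have "norm (fst \<zeta>) = R + 1" using R(1) by (simp add: \<zeta>_def)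
    ultimately show "norm (fst z - fst \<zeta>) \<ge> 1" "snd \<zeta> - snd z \<le> 0"
      using norm_triangle_ineq2[of "fst \<zeta>" "fst z"] by (auto simp: norm_minus_commute \<zeta>_def)
  qed
  have approx: "ereal (k - B) \<le> u z" if B: "B > 0" for B
  proof -
    have le: "gauss B \<gamma> \<zeta> w \<le> B" "0 \<le> gauss B \<gamma> \<zeta> w" for w using B \<gamma> by (simp_all add: gauss_def)
    have "ereal (k - B + gauss B \<gamma> \<zeta> z) \<le> u z"
    proof (rule superparabolic_ge_gauss[OF p \<Theta> u B \<gamma> _ _ z])
      fix \<xi> assume "\<xi> \<in> frontier \<Theta>"
      have "ereal (k - B + gauss B \<gamma> \<zeta> \<xi>) \<le> ereal k" using le(1)[of \<xi>] by simp
      also have "\<dots> \<le> Liminf (at \<xi> within \<Theta>) u" by (rule bdry) fact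
      finally show "ereal (k - B + gauss B \<gamma> \<zeta> \<xi>) \<le> Liminf (at \<xi> within \<Theta>) u" .
    next
      fix w assume w: "w \<in> \<Theta>"
      have "real CARD('n) + p - 2 < \<gamma> * (p - 1) * 1" using p by (simp add: \<gamma>_def)
      also have "\<dots> \<le> \<gamma> * (p - 1) * (norm (fst w - fst \<zeta>))^2"
        using dist(1)[OF w] \<gamma> p by (intro mult_left_mono) auto
      finally have 1: "0 + real CARD('n) + p - 2 < \<gamma> * (p - 1) * (norm (fst w - fst \<zeta>))^2" by simp
      have 2: "(2 * \<gamma> * gauss B \<gamma> \<zeta> w * norm (fst w - fst \<zeta>)) powr (2 - p) * (snd \<zeta> - snd w) \<le> 0"
        using dist(2)[OF w] by (intro mult_nonneg_nonpos) auto
      have 3: "fst w \<noteq> fst \<zeta>" using dist(1)[OF w] by auto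
      show "fst w \<noteq> fst \<zeta> \<and> (\<exists>\<Lambda>\<ge>0.
        (2 * \<gamma> * gauss B \<gamma> \<zeta> w * norm (fst w - fst \<zeta>)) powr (2 - p) * (snd \<zeta> - snd w) \<le> \<Lambda> \<and>
        \<Lambda> + real CARD('n) + p - 2 < \<gamma> * (p - 1) * (norm (fst w - fst \<zeta>))^2)"
        by (rule conjI[OF 3], rule exI[of _ 0]) (use 1 2 in simp)
    qed
    moreover have "ereal (k - B) \<le> ereal (k - B + gauss B \<gamma> \<zeta> z)" using le(2)[of z] by simp
    ultimately show ?thesis by (rule order_trans[rotated])
  qed
  show ?thesis
  proof (rule ccontr)
    assume "\<not> ereal k \<le> u z"
    then obtain q where q: "u z < ereal q" "ereal q < ereal k" using ereal_dense2[of "u z" "ereal k"] by (auto simp: not_le)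
    have "ereal (k - (k - q)) \<le> u z" using q(2) by (intro approx) simp
    then show False using q(1) by simp
  qed
qed

section \<open>Regularity\<close>

text \<open>After division by \<gamma>, the time term is of order
  \<open>\<gamma> powr (1 - p)\<close> and the dimensional term of order
  \<open>1 / \<gamma>\<close>; both tend to 0. The right-hand side stays above
  \<open>(p - 1) * (X / 4)^2\<close>, as points with \<open>M < gauss\<close> are close to the
  origin and hence spatially away from the centre.\<close>

lemma barrier_parameter:
  fixes \<xi>1 :: "'n::finite spacetime"
  defines "\<zeta> \<equiv> (1 / 2) *\<^sub>R \<xi>1"
  assumes p: "1 < p" and M: "M > 0" and x1: "fst \<xi>1 \<noteq> 0"
  shows "\<exists>\<gamma>0>0. \<forall>\<gamma>\<ge>\<gamma>0. \<forall>z. (norm z)^2 / 2 \<le> (norm (z - \<zeta>))^2 - (norm \<zeta>)^2 \<longrightarrow>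
      M < gauss (2 * M * exp (\<gamma> * (norm \<zeta>)^2)) \<gamma> \<zeta> z \<longrightarrow>
      fst z \<noteq> fst \<zeta> \<and> slope_ratio p (2 * M * exp (\<gamma> * (norm \<zeta>)^2)) \<gamma> \<zeta> z + real CARD('n) + p - 2
        < \<gamma> * (p - 1) * (norm (fst z - fst \<zeta>))^2"
proof -
  define X T n where "X = norm (fst \<xi>1)" and "T = \<bar>snd \<xi>1\<bar>" and "n = real CARD('n)"
  have X: "X > 0" "T \<ge> 0" using x1 by (simp_all add: X_def T_def)
  \<comment> \<open>Bounds for the gradient divided by \<gamma>, that is for
    \<open>2 * E * r\<close>: the Gaussian lies between \<open>M\<close> and \<open>2 * M\<close>,
    and \<open>r\<close> between \<open>X / 4\<close> and \<open>X\<close>.\<close>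
  define a1 a2 where "a1 = M * X / 2" and "a2 = 4 * M * X"
  have a: "a1 > 0" "a2 > 0" using M X by (simp_all add: a1_def a2_def)
  \<comment> \<open>The power \<open>2 - p\<close> is monotone in a direction depending on
    \<open>p\<close>; adding the values at both ends covers either case. \<open>X + T\<close> bounds
    the time distance to the centre.\<close>
  define D where "D = (a1 powr (2 - p) + a2 powr (2 - p)) * (X + T)"
  have "((\<lambda>\<gamma>. \<gamma> powr (1 - p) * D + (n + p - 2) / \<gamma>) \<longlongrightarrow> 0 * D + 0) at_top"
    using p by (intro tendsto_intros tendsto_neg_powr tendsto_divide_0[OF tendsto_const] filterlim_at_top_imp_at_infinity filterlim_ident) auto
  then have "eventually (\<lambda>\<gamma>. \<gamma> powr (1 - p) * D + (n + p - 2) / \<gamma> < (p - 1) * X^2 / 16) at_top"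
    using p X by (intro order_tendstoD(2)) auto
  then obtain \<gamma>1 where \<gamma>1: "\<And>\<gamma>. \<gamma> \<ge> \<gamma>1 \<Longrightarrow> \<gamma> powr (1 - p) * D + (n + p - 2) / \<gamma> < (p - 1) * X^2 / 16"
    unfolding eventually_at_top_linorder by blast
  \<comment> \<open>The second entry yields \<open>q < 1 / \<gamma> \<le> X^2 / 32\<close>, hence
    \<open>|z|^2 < X^2 / 16\<close>.\<close>
  define \<gamma>0 where "\<gamma>0 = max \<gamma>1 (32 / X^2)"
  have \<gamma>0: "\<gamma>0 > 0" using X by (simp add: \<gamma>0_def less_max_iff_disj)
  have main: "fst z \<noteq> fst \<zeta> \<and> slope_ratio p (2 * M * exp (\<gamma> * (norm \<zeta>)^2)) \<gamma> \<zeta> z + real CARD('n) + p - 2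
        < \<gamma> * (p - 1) * (norm (fst z - fst \<zeta>))^2"
    if \<gamma>: "\<gamma> \<ge> \<gamma>0" and q: "(norm z)^2 / 2 \<le> (norm (z - \<zeta>))^2 - (norm \<zeta>)^2"
      and E: "M < gauss (2 * M * exp (\<gamma> * (norm \<zeta>)^2)) \<gamma> \<zeta> z" for \<gamma> z
  proof -
    define q where "q = (norm (z - \<zeta>))^2 - (norm \<zeta>)^2"
    define E where "E = gauss (2 * M * exp (\<gamma> * (norm \<zeta>)^2)) \<gamma> \<zeta> z"
    have \<gamma>p: "\<gamma> > 0" using \<gamma> \<gamma>0 by simp
    have Eq: "E = 2 * M * exp (- (\<gamma> * q))"
      by (simp add: E_def gauss_def q_def mult.assoc exp_add[symmetric] algebra_simps)
    have "q \<ge> 0" using q zero_le_power2[of "norm z"] unfolding q_def by linarith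
    then have E2: "E \<le> 2 * M" using \<gamma>p M by (simp add: Eq)
    have E1: "M < E" using E by (simp add: E_def)
    \<comment> \<open>\<open>E > M\<close> means \<open>exp (- \<gamma> * q) > 1/2\<close>, and
      \<open>1/2 \<ge> exp (-1)\<close>, so that \<open>\<gamma> * q < 1\<close>.\<close>
    then have "exp (- 1) < exp (- (\<gamma> * q))"
    proof -
      have "exp (- 1 :: real) \<le> 1 / 2" using exp_ge_add_one_self[of "1::real"] by (simp add: exp_minus divide_simps)
      also have "1 / 2 < exp (- (\<gamma> * q))" using E1 M by (simp add: Eq)
      finally show ?thesis .
    qed
    then have "q < 1 / \<gamma>" using \<gamma>p by (simp add: pos_less_divide_eq mult.commute)
    also have "1 / \<gamma> \<le> X^2 / 32"
    proof -
      have "32 / X^2 \<le> \<gamma>" using \<gamma> by (simp add: \<gamma>0_def)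
      then show ?thesis using X \<gamma>p by (simp add: field_simps)
    qed
    finally have "q < X^2 / 32" .
    moreover have "(norm z)^2 / 2 \<le> q" using q by (simp add: q_def)
    moreover have "(X / 4)^2 = X^2 / 16" by (simp add: power_divide)
    ultimately have "(norm z)^2 < (X / 4)^2" by linarith
    then have nz: "norm z < X / 4" by (rule power2_less_imp_less) (use X in simp)
    have z12: "norm (fst z) < X / 4" "\<bar>snd z\<bar> < X / 4"
      using nz norm_fst_le[of "fst z" "snd z"] norm_snd_le[of "snd z" "fst z"] by auto
    define r where "r = norm (fst z - fst \<zeta>)"
    have n\<zeta>: "norm (fst \<zeta>) = X / 2" by (simp add: \<zeta>_def X_def)
    have r1: "X / 4 < r" using norm_triangle_ineq2[of "fst \<zeta>" "fst z"] z12 n\<zeta> by (simp add: r_def norm_minus_commute)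
    have r2: "r \<le> X" using norm_triangle_ineq4[of "fst z" "fst \<zeta>"] z12 n\<zeta> X by (simp add: r_def)
    have ts: "\<bar>snd z - snd \<zeta>\<bar> \<le> X + T" using z12 X by (simp add: \<zeta>_def T_def)
    define g where "g = 2 * \<gamma> * E * r"
    have g1: "\<gamma> * a1 \<le> g"
    proof -
      have "M * (X / 4) \<le> E * r" using E1 r1 M X by (intro mult_mono) auto
      then have "2 * \<gamma> * (M * (X / 4)) \<le> 2 * \<gamma> * (E * r)" using \<gamma>p by (intro mult_left_mono) auto
      then show ?thesis by (simp add: g_def a1_def mult_ac)
    qed
    have g2: "g \<le> \<gamma> * a2"
    proof -
      have "E * r \<le> 2 * M * X" using E2 r2 M X E1 by (intro mult_mono) (auto simp: r_def)
      then have "2 * \<gamma> * (E * r) \<le> 2 * \<gamma> * (2 * M * X)" using \<gamma>p by (intro mult_left_mono) auto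
      then show ?thesis by (simp add: g_def a2_def mult_ac)
    qed
    have gp: "g powr (2 - p) \<le> \<gamma> powr (2 - p) * (a1 powr (2 - p) + a2 powr (2 - p))"
    proof (cases "p \<le> 2")
      case True
      have "g powr (2 - p) \<le> (\<gamma> * a2) powr (2 - p)" using g1 g2 \<gamma>p a True by (intro powr_mono2) (auto intro: order_trans[rotated])
      also have "\<dots> \<le> \<gamma> powr (2 - p) * (a1 powr (2 - p) + a2 powr (2 - p))"
        using \<gamma>p a by (simp add: powr_mult distrib_left)
      finally show ?thesis .
    next
      case False
      have "g powr (2 - p) \<le> (\<gamma> * a1) powr (2 - p)" using g1 \<gamma>p a False by (intro powr_mono2') auto
      also have "\<dots> \<le> \<gamma> powr (2 - p) * (a1 powr (2 - p) + a2 powr (2 - p))"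
        using \<gamma>p a by (simp add: powr_mult distrib_left)
      finally show ?thesis .
    qed
    have "slope_ratio p (2 * M * exp (\<gamma> * (norm \<zeta>)^2)) \<gamma> \<zeta> z = g powr (2 - p) * \<bar>snd z - snd \<zeta>\<bar>"
      by (simp add: slope_ratio_def g_def E_def r_def)
    also have "\<dots> \<le> (\<gamma> powr (2 - p) * (a1 powr (2 - p) + a2 powr (2 - p))) * (X + T)"
      using gp ts by (intro mult_mono) auto
    also have "\<dots> = \<gamma> * (\<gamma> powr (1 - p) * D)"
      using powr_mult_base[of \<gamma> "1 - p"] \<gamma>p by (simp add: D_def mult_ac)
    finally have "slope_ratio p (2 * M * exp (\<gamma> * (norm \<zeta>)^2)) \<gamma> \<zeta> z + n + p - 2
        \<le> \<gamma> * (\<gamma> powr (1 - p) * D + (n + p - 2) / \<gamma>)" using \<gamma>p by (simp add: distrib_left)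
    also have "\<dots> < \<gamma> * ((p - 1) * X^2 / 16)"
      using \<gamma>1[of \<gamma>] \<gamma> \<gamma>p by (intro mult_strict_left_mono) (auto simp: \<gamma>0_def)
    also have "\<dots> = \<gamma> * (p - 1) * (X / 4)^2" by (simp add: power2_eq_square)
    also have "\<dots> \<le> \<gamma> * (p - 1) * r^2"
      using r1 X \<gamma>p p by (intro mult_left_mono power_mono) auto
    finally show ?thesis using r1 X by (auto simp: r_def n_def)
  qed
  then show ?thesis using \<gamma>0 by blast
qed

theorem proposition4p1:
  fixes p :: real
    and \<Theta> :: "((real^'n) \<times> real) set"
    and x\<^sub>1 :: "real^'n" and t\<^sub>1 R\<^sub>1 :: real
  assumes "1 < p"
    and "open \<Theta>" and "bounded \<Theta>" and "\<Theta> \<noteq> {}"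
    and "(0, 0) \<in> frontier \<Theta>"
    and "R\<^sub>1 > 0"
    and "ball (x\<^sub>1, t\<^sub>1) R\<^sub>1 \<inter> \<Theta> = {}"
    and "(0, 0) \<in> frontier (ball (x\<^sub>1, t\<^sub>1) R\<^sub>1) \<inter> frontier \<Theta>"
    and "x\<^sub>1 \<noteq> 0"
  shows "regular_point p \<Theta> (0, 0)"
proof -
  define \<xi>1 where "\<xi>1 = (x\<^sub>1, t\<^sub>1)"
  define \<zeta> where "\<zeta> = (1 / 2) *\<^sub>R \<xi>1"
  have n\<xi>1: "norm \<xi>1 = R\<^sub>1"
    using assms(6,8) by (simp add: frontier_ball \<xi>1_def dist_norm zero_prod_def[symmetric])
  have x1: "fst \<xi>1 \<noteq> 0" using assms(9) by (simp add: \<xi>1_def)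
  \<comment> \<open>A point outside the large ball satisfies
    \<open>2 (z \<bullet> \<xi>1) \<le> |z|^2\<close>. With the centre at half of
    \<open>\<xi>1\<close>, the right-hand side equals
    \<open>|z|^2 - z \<bullet> \<xi>1\<close>.\<close>
  have q: "(norm z)^2 / 2 \<le> (norm (z - \<zeta>))^2 - (norm \<zeta>)^2" if "z \<in> closure \<Theta>" for z
  proof -
    have "ball \<xi>1 R\<^sub>1 \<inter> closure \<Theta> = {}" using assms(7) by (simp add: \<xi>1_def open_Int_closure_eq_empty)
    then have "z \<notin> ball \<xi>1 R\<^sub>1" using that by blast
    then have "norm \<xi>1 \<le> norm (z - \<xi>1)" using n\<xi>1 by (simp add: dist_norm norm_minus_commute)
    then have "(norm \<xi>1)^2 \<le> (norm (z - \<xi>1))^2" by (intro power_mono) auto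
    then have 1: "2 * (z \<bullet> \<xi>1) \<le> z \<bullet> z"
      unfolding power2_norm_eq_inner by (simp add: inner_diff_left inner_diff_right inner_commute)
    have "(norm (z - \<zeta>))^2 - (norm \<zeta>)^2 = z \<bullet> z - z \<bullet> \<xi>1"
      unfolding power2_norm_eq_inner \<zeta>_def by (simp add: inner_diff_left inner_diff_right inner_commute)
    then show ?thesis using 1 by (simp add: power2_norm_eq_inner)
  qed
  \<comment> \<open>Frontier points of an open set are limit points of it, so the limit inferior of
    a continuous function there is its value.\<close>
  have nontriv: "at \<xi> within \<Theta> \<noteq> bot" if "\<xi> \<in> frontier \<Theta>" for \<xi>
  proof -
    have "\<xi> \<in> closure \<Theta>" "\<xi> \<notin> \<Theta>" using that assms(2) by (auto simp: frontier_def interior_open)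
    then show ?thesis using not_trivial_limit_within by force
  qed
  have fr: "frontier \<Theta> \<subseteq> closure \<Theta>" by (simp add: frontier_def)
  show ?thesis
    unfolding regular_point_def
  proof (intro conjI allI impI)
    show "(0, 0) \<in> frontier \<Theta>" by (rule assms(5))
    fix f :: "'n spacetime \<Rightarrow> real"
    assume f: "continuous_on (frontier \<Theta>) f"
    define f0 where "f0 = f (0, 0)"
    have cF: "compact (frontier \<Theta>)" using assms(3) by (rule compact_frontier_bounded)
    have "bounded (f ` frontier \<Theta>)" using f cF by (intro compact_imp_bounded compact_continuous_image)
    then obtain b where b: "\<And>\<xi>. \<xi> \<in> frontier \<Theta> \<Longrightarrow> \<bar>f \<xi>\<bar> \<le> b"
      unfolding bounded_iff by (metis image_eqI real_norm_def)
    \<comment> \<open>\<open>2 * b\<close> bounds the oscillation of \<open>f\<close> on the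
      frontier; adding 1 makes \<open>M\<close> positive even when \<open>f\<close>
      vanishes.\<close>
    define M where "M = 2 * b + 1"
    have fM: "\<bar>f \<xi> - f0\<bar> \<le> M" if "\<xi> \<in> frontier \<Theta>" for \<xi>
      using b[OF that] b[OF assms(5)] by (simp add: M_def f0_def)
    have M: "M > 0" using b[OF assms(5)] by (simp add: M_def)
    obtain \<gamma>0 where \<gamma>0: "\<gamma>0 > 0" and par: "\<And>\<gamma> z. \<gamma> \<ge> \<gamma>0 \<Longrightarrow> (norm z)^2 / 2 \<le> (norm (z - \<zeta>))^2 - (norm \<zeta>)^2 \<Longrightarrow>
      M < gauss (2 * M * exp (\<gamma> * (norm \<zeta>)^2)) \<gamma> \<zeta> z \<Longrightarrow>
      fst z \<noteq> fst \<zeta> \<and> slope_ratio p (2 * M * exp (\<gamma> * (norm \<zeta>)^2)) \<gamma> \<zeta> z + real CARD('n) + p - 2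
        < \<gamma> * (p - 1) * (norm (fst z - fst \<zeta>))^2"
      using barrier_parameter[OF assms(1) M x1] unfolding \<zeta>_def by blast
    have near: "eventually (\<lambda>z. ereal (f0 - 2 * \<epsilon>) < upper_perron p \<Theta> f z \<and> upper_perron p \<Theta> f z < ereal (f0 + 2 * \<epsilon>))
        (at (0, 0) within \<Theta>)" if \<epsilon>: "\<epsilon> > 0" for \<epsilon>
    proof -
      obtain \<delta> where \<delta>: "\<delta> > 0" "\<And>\<xi>. \<xi> \<in> frontier \<Theta> \<Longrightarrow> dist \<xi> (0, 0) < \<delta> \<Longrightarrow> dist (f \<xi>) (f (0, 0)) < \<epsilon>"
        using f assms(5) \<epsilon> unfolding continuous_on_iff by metis
      \<comment> \<open>Two demands: the one of \<open>barrier_parameter\<close>, and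
        \<open>\<gamma> * \<delta>^2 / 2 \<ge> 1\<close>, by which \<Psi> is at least
        \<open>M\<close> at distance \<delta> from the origin.\<close>
      define \<gamma> where "\<gamma> = max \<gamma>0 (2 / \<delta>^2)"
      have \<gamma>: "\<gamma> > 0" "\<gamma> \<ge> \<gamma>0" "\<gamma> \<ge> 2 / \<delta>^2" using \<gamma>0 by (auto simp: \<gamma>_def)
      define B where "B = 2 * M * exp (\<gamma> * (norm \<zeta>)^2)"
      have B: "B > 0" using M by (simp add: B_def)
      define \<Psi> where "\<Psi> z = 2 * M - gauss B \<gamma> \<zeta> z" for z
      have \<Psi>eq: "\<Psi> z = 2 * M * (1 - exp (- (\<gamma> * ((norm (z - \<zeta>))^2 - (norm \<zeta>)^2))))" for z
      proof -
        have "gauss B \<gamma> \<zeta> z = 2 * M * exp (- (\<gamma> * ((norm (z - \<zeta>))^2 - (norm \<zeta>)^2)))"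
          by (simp add: B_def gauss_def mult.assoc exp_add[symmetric] algebra_simps)
        then show ?thesis by (simp add: \<Psi>_def algebra_simps)
      qed
      have \<Psi>0: "\<Psi> z \<ge> 0" if "z \<in> closure \<Theta>" for z
      proof -
        have "0 \<le> (norm (z - \<zeta>))^2 - (norm \<zeta>)^2" using q[OF that] zero_le_power2[of "norm z"] by linarith
        then show ?thesis using M \<gamma>(1) unfolding \<Psi>eq by simp
      qed
      have \<Psi>M: "\<Psi> z \<ge> M" if z: "z \<in> closure \<Theta>" "norm z \<ge> \<delta>" for z
      proof -
        have "\<delta>^2 \<le> (norm z)^2" using z(2) \<delta>(1) by (intro power_mono) auto
        then have "\<delta>^2 / 2 \<le> (norm (z - \<zeta>))^2 - (norm \<zeta>)^2" using q[OF z(1)] by linarith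
        then have "\<gamma> * (\<delta>^2 / 2) \<le> \<gamma> * ((norm (z - \<zeta>))^2 - (norm \<zeta>)^2)" using \<gamma>(1) by (intro mult_left_mono) auto
        moreover have "1 \<le> \<gamma> * (\<delta>^2 / 2)" using \<gamma>(3) \<delta>(1) by (simp add: divide_simps)
        ultimately have "exp (- (\<gamma> * ((norm (z - \<zeta>))^2 - (norm \<zeta>)^2))) \<le> exp (- 1)" by simp
        also have "exp (- 1 :: real) \<le> 1 / 2" using exp_ge_add_one_self[of "1::real"] by (simp add: exp_minus divide_simps)
        finally have "2 * M * (1 / 2) \<le> \<Psi> z" using M unfolding \<Psi>eq by (intro mult_left_mono) auto
        then show ?thesis by simp
      qed
      have \<Psi>cont: "continuous_on UNIV \<Psi>" unfolding \<Psi>_def by (intro continuous_intros gauss_continuous)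
      have cond: "fst z \<noteq> fst \<zeta> \<and> slope_ratio p B \<gamma> \<zeta> z + real CARD('n) + p - 2 < \<gamma> * (p - 1) * (norm (fst z - fst \<zeta>))^2"
        if "z \<in> \<Theta>" "\<Psi> z < M" for z
        using par[OF \<gamma>(2) q, of z] that closure_subset[of \<Theta>] by (auto simp: B_def \<Psi>_def)
      \<comment> \<open>Near the origin continuity of \<open>f\<close> supplies \<epsilon>; farther
        away \<Psi> is at least \<open>M\<close>, which exceeds the oscillation. The two-sided form
        serves the upper and the lower bound alike.\<close>
      have fnear: "\<bar>f \<xi> - f0\<bar> \<le> \<epsilon> + min (\<Psi> \<xi>) M" if "\<xi> \<in> frontier \<Theta>" for \<xi>
      proof (cases "norm \<xi> < \<delta>")
        case True
        then have "\<bar>f \<xi> - f0\<bar> < \<epsilon>" using \<delta>(2)[OF that] by (simp add: dist_norm f0_def zero_prod_def[symmetric])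
        then show ?thesis using \<Psi>0[of \<xi>] that fr M by auto
      next
        case False
        then show ?thesis using \<Psi>M[of \<xi>] fM[OF that] that fr \<epsilon> by auto
      qed
      define w where "w z = f0 + \<epsilon> + min (\<Psi> z) M" for z
      have wc: "continuous_on UNIV w" unfolding w_def by (intro continuous_intros \<Psi>cont)
      have "(\<lambda>z. ereal (w z)) \<in> upper_class p \<Theta> f"
        unfolding upper_class_def
      proof (intro CollectI conjI ballI)
        show "p_superparabolic p \<Theta> (\<lambda>z. ereal (w z))"
          unfolding w_def \<Psi>_def
          by (rule barrier_superparabolic[OF assms(1) B \<gamma>(1)]) (use cond in \<open>auto simp: \<Psi>_def\<close>)
        have "ereal f0 \<le> ereal (w \<xi>)" if "\<xi> \<in> \<Theta>" for \<xi>
          using \<Psi>0[of \<xi>] closure_subset[of \<Theta>] that \<epsilon> M by (auto simp: w_def)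
        then show "\<exists>m::real. \<forall>\<xi>\<in>\<Theta>. ereal m \<le> ereal (w \<xi>)" by blast
        fix \<xi> assume \<xi>: "\<xi> \<in> frontier \<Theta>"
        have "isCont w \<xi>" using wc continuous_on_eq_continuous_at[OF open_UNIV] by blast
        then have "(w \<longlongrightarrow> w \<xi>) (at \<xi> within \<Theta>)" using continuous_at_imp_continuous_at_within continuous_within by blast
        then have "Liminf (at \<xi> within \<Theta>) (\<lambda>z. ereal (w z)) = ereal (w \<xi>)"
          by (intro lim_imp_Liminf nontriv[OF \<xi>] tendsto_ereal)
        then show "ereal (f \<xi>) \<le> Liminf (at \<xi> within \<Theta>) (\<lambda>z. ereal (w z))"
          using fnear[OF \<xi>] by (simp add: w_def)
      qed
      then have upper: "upper_perron p \<Theta> f z \<le> ereal (w z)" for z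
        unfolding upper_perron_def by (rule INF_lower)
      have lower: "ereal (f0 - \<epsilon> - \<Psi> z) \<le> upper_perron p \<Theta> f z" if z: "z \<in> \<Theta>" for z
        unfolding upper_perron_def
      proof (rule INF_greatest)
        fix u assume "u \<in> upper_class p \<Theta> f"
        then have u: "p_superparabolic p \<Theta> u" and bd: "\<And>\<xi>. \<xi> \<in> frontier \<Theta> \<Longrightarrow> ereal (f \<xi>) \<le> Liminf (at \<xi> within \<Theta>) u"
          unfolding upper_class_def by blast+
        \<comment> \<open>With this, \<open>u\<close> can lie below
          \<open>f0 - \<epsilon> - \<Psi>\<close> only where \<Psi> < M, which is where the Gaussian
          satisfies the subsolution condition.\<close>
        have const: "ereal (f0 - M) \<le> u y" if "y \<in> \<Theta>" for y
        proof (rule superparabolic_ge_const[OF assms(1-3) u _ that])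
          fix \<xi> assume \<xi>: "\<xi> \<in> frontier \<Theta>"
          have "ereal (f0 - M) \<le> ereal (f \<xi>)" using fM[OF \<xi>] by simp
          then show "ereal (f0 - M) \<le> Liminf (at \<xi> within \<Theta>) u" using bd[OF \<xi>] by (rule order_trans)
        qed
        have eq: "f0 - \<epsilon> - 2 * M + gauss B \<gamma> \<zeta> y = f0 - \<epsilon> - \<Psi> y" for y by (simp add: \<Psi>_def)
        have "ereal (f0 - \<epsilon> - 2 * M + gauss B \<gamma> \<zeta> z) \<le> u z"
        proof (rule superparabolic_ge_gauss[OF assms(1-3) u B \<gamma>(1) _ _ z])
          fix \<xi> assume \<xi>: "\<xi> \<in> frontier \<Theta>"
          have "ereal (f0 - \<epsilon> - 2 * M + gauss B \<gamma> \<zeta> \<xi>) \<le> ereal (f \<xi>)" unfolding eq using fnear[OF \<xi>] by simp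
          then show "ereal (f0 - \<epsilon> - 2 * M + gauss B \<gamma> \<zeta> \<xi>) \<le> Liminf (at \<xi> within \<Theta>) u" using bd[OF \<xi>] by (rule order_trans)
        next
          fix y assume y: "y \<in> \<Theta>" "u y < ereal (f0 - \<epsilon> - 2 * M + gauss B \<gamma> \<zeta> y)"
          have "ereal (f0 - M) < ereal (f0 - \<epsilon> - \<Psi> y)" using const[OF y(1)] y(2) unfolding eq by (rule order_le_less_trans)
          then have c: "fst y \<noteq> fst \<zeta>" "slope_ratio p B \<gamma> \<zeta> y + real CARD('n) + p - 2 < \<gamma> * (p - 1) * (norm (fst y - fst \<zeta>))^2"
            using cond[OF y(1)] \<epsilon> by auto
          \<comment> \<open>The touching argument asks for a one-sided bound on the time term;
            \<open>slope_ratio\<close>, with the absolute value, is an admissible \<Lambda>.\<close>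
          have "(2 * \<gamma> * gauss B \<gamma> \<zeta> y * norm (fst y - fst \<zeta>)) powr (2 - p) * (snd \<zeta> - snd y) \<le> slope_ratio p B \<gamma> \<zeta> y"
            unfolding slope_ratio_def by (intro mult_left_mono) auto
          moreover have "slope_ratio p B \<gamma> \<zeta> y \<ge> 0" by (simp add: slope_ratio_def)
          ultimately show "fst y \<noteq> fst \<zeta> \<and> (\<exists>\<Lambda>\<ge>0.
              (2 * \<gamma> * gauss B \<gamma> \<zeta> y * norm (fst y - fst \<zeta>)) powr (2 - p) * (snd \<zeta> - snd y) \<le> \<Lambda> \<and>
              \<Lambda> + real CARD('n) + p - 2 < \<gamma> * (p - 1) * (norm (fst y - fst \<zeta>))^2)"
            using c by blast
        qed
        then show "ereal (f0 - \<epsilon> - \<Psi> z) \<le> u z" unfolding eq .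
      qed
      have "\<Psi> (0, 0) = 0" unfolding \<Psi>eq by (simp add: zero_prod_def[symmetric])
      moreover have "isCont \<Psi> (0, 0)" using \<Psi>cont continuous_on_eq_continuous_at[OF open_UNIV] by blast
      then have "(\<Psi> \<longlongrightarrow> \<Psi> (0, 0)) (at (0, 0) within \<Theta>)"
        using continuous_at_imp_continuous_at_within continuous_within by blast
      ultimately have "eventually (\<lambda>z. \<Psi> z < \<epsilon>) (at (0, 0) within \<Theta>)" using \<epsilon> by (intro order_tendstoD(2)) auto
      moreover have "eventually (\<lambda>z. z \<in> \<Theta>) (at (0, 0) within \<Theta>)" by (simp add: eventually_at_filter)
      ultimately show ?thesis
      proof eventually_elim
        fix z assume z: "\<Psi> z < \<epsilon>" "z \<in> \<Theta>"
        have "ereal (f0 - 2 * \<epsilon>) < ereal (f0 - \<epsilon> - \<Psi> z)" using z(1) by simp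
        then have "ereal (f0 - 2 * \<epsilon>) < upper_perron p \<Theta> f z" using lower[OF z(2)] by (rule less_le_trans)
        moreover have "ereal (w z) < ereal (f0 + 2 * \<epsilon>)" using z(1) by (simp add: w_def min_less_iff_disj)
        then have "upper_perron p \<Theta> f z < ereal (f0 + 2 * \<epsilon>)" by (rule order_le_less_trans[OF upper])
        ultimately show "ereal (f0 - 2 * \<epsilon>) < upper_perron p \<Theta> f z \<and> upper_perron p \<Theta> f z < ereal (f0 + 2 * \<epsilon>)" ..
      qed
    qed
    show "(upper_perron p \<Theta> f \<longlongrightarrow> ereal (f (0, 0))) (at (0, 0) within \<Theta>)"
      unfolding f0_def[symmetric]
    proof (rule order_tendstoI)
      fix a assume "a < ereal f0"
      then obtain r where r: "a < ereal r" "r < f0" using ereal_dense2[of a "ereal f0"] by auto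
      have "eventually (\<lambda>z. ereal r < upper_perron p \<Theta> f z) (at (0, 0) within \<Theta>)"
        using near[of "(f0 - r) / 2"] r(2) by (auto elim!: eventually_mono simp: field_simps)
      then show "eventually (\<lambda>z. a < upper_perron p \<Theta> f z) (at (0, 0) within \<Theta>)"
        by (rule eventually_mono) (use r(1) in \<open>auto intro: less_trans\<close>)
    next
      fix a assume "ereal f0 < a"
      then obtain r where r: "ereal r < a" "f0 < r" using ereal_dense2[of "ereal f0" a] by auto
      have "eventually (\<lambda>z. upper_perron p \<Theta> f z < ereal r) (at (0, 0) within \<Theta>)"
        using near[of "(r - f0) / 2"] r(2) by (auto elim!: eventually_mono simp: field_simps)
      then show "eventually (\<lambda>z. upper_perron p \<Theta> f z < a) (at (0, 0) within \<Theta>)"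
        by (rule eventually_mono) (use r(1) in \<open>auto intro: less_trans\<close>)
    qed
  qed
qed

end
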